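(* Let $\mathfrak{g}$ be any Lie algebra over $\mathbb{C}$. Then there exists a vertex algebra $V$ such that $P_2(V)$ is isomorphic to $S(\mathfrak{g})$ as a Poisson algebra.
   Context: A vertex algebra $(V,Y,\mathbf{1})$ over $\mathbb{C}$ is taken in the usual sense (truncation, vacuum and creation properties, Jacobi identity; no grading or conformal vector assumed); write $Y(a,x)=\sum_{n\in\mathbb{Z}}a_nx^{-n-1}$. $P_2(V)=V/C_2(V)$, where $C_2(V)$ is the subspace of $V$ spanned by $a_{-2}b$ for $a,b\in V$. It is a Poisson algebra with commutative associative product $(a+C_2(V))\cdot(b+C_2(V))=a_{-1}b+C_2(V)$ and Lie bracket $[a+C_2(V),b+C_2(V)]=a_0b+C_2(V)$. A Poisson algebra is a commutative associative algebra $A$ with a Lie bracket satisfying $[a,bc]=[a,b]c+[a,c]b$. $S(\mathfrak{g})$ is the symmetric algebra of $\mathfrak{g}$ with the Poisson bracket that extends the Lie bracket of $\mathfrak{g}$ by the Leibniz rule: in terms of a basis $\{u^i\}_{i\in I}$ of $\mathfrak{g}$, $\{f,g\}=\sum_{i,j\in I}\frac{\partial f}{\partial u^i}\frac{\partial g}{\partial u^j}[u^i,u^j]$. *)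

theory Defs
  imports
    Complex_Main
    "HOL-Library.Poly_Mapping"
    "HOL-Algebra.QuotRing"
    "HOL-Algebra.Module"
begin

section \<open>Lie algebras and Poisson algebras\<close>

definition complex_ring :: "complex ring"
  where "complex_ring = \<lparr>carrier = UNIV, mult = (*), one = 1, zero = 0, add = (+)\<rparr>"

text \<open>
  In a record that only describes a Lie algebra, the fields \<open>mult\<close> and \<open>one\<close> inherited from
  \<^type>\<open>module\<close> are irrelevant; in a Poisson algebra they are the associative product and its unit.
\<close>

record 'a lie = "(complex, 'a) module" +
  lie_bracket :: "'a \<Rightarrow> 'a \<Rightarrow> 'a"  (\<open>\<lbrace>_,/ _\<rbrace>\<index>\<close>)

locale lie_algebra = module complex_ring L
  for L :: "('a, 'm) lie_scheme" (structure) +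
  assumes bracket_closed [simp, intro]:
      "\<lbrakk>x \<in> carrier L; y \<in> carrier L\<rbrakk> \<Longrightarrow> \<lbrace>x, y\<rbrace> \<in> carrier L"
    and bracket_add_left:
      "\<lbrakk>x \<in> carrier L; y \<in> carrier L; z \<in> carrier L\<rbrakk> \<Longrightarrow> \<lbrace>x \<oplus> y, z\<rbrace> = \<lbrace>x, z\<rbrace> \<oplus> \<lbrace>y, z\<rbrace>"
    and bracket_add_right:
      "\<lbrakk>x \<in> carrier L; y \<in> carrier L; z \<in> carrier L\<rbrakk> \<Longrightarrow> \<lbrace>x, y \<oplus> z\<rbrace> = \<lbrace>x, y\<rbrace> \<oplus> \<lbrace>x, z\<rbrace>"
    and bracket_smult_left:
      "\<lbrakk>x \<in> carrier L; y \<in> carrier L\<rbrakk> \<Longrightarrow> \<lbrace>c \<odot> x, y\<rbrace> = c \<odot> \<lbrace>x, y\<rbrace>"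
    and bracket_smult_right:
      "\<lbrakk>x \<in> carrier L; y \<in> carrier L\<rbrakk> \<Longrightarrow> \<lbrace>x, c \<odot> y\<rbrace> = c \<odot> \<lbrace>x, y\<rbrace>"
    and bracket_alternating:
      "x \<in> carrier L \<Longrightarrow> \<lbrace>x, x\<rbrace> = \<zero>"
    and bracket_Jacobi:
      "\<lbrakk>x \<in> carrier L; y \<in> carrier L; z \<in> carrier L\<rbrakk> \<Longrightarrow>
        \<lbrace>x, \<lbrace>y, z\<rbrace>\<rbrace> \<oplus> \<lbrace>y, \<lbrace>z, x\<rbrace>\<rbrace> \<oplus> \<lbrace>z, \<lbrace>x, y\<rbrace>\<rbrace> = \<zero>"

locale poisson_algebra = lie_algebra A + algebra complex_ring A
  for A :: "('a, 'm) lie_scheme" (structure) +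
  assumes bracket_Leibniz:
    "\<lbrakk>x \<in> carrier A; y \<in> carrier A; z \<in> carrier A\<rbrakk> \<Longrightarrow>
      \<lbrace>x, y \<otimes> z\<rbrace> = \<lbrace>x, y\<rbrace> \<otimes> z \<oplus> \<lbrace>x, z\<rbrace> \<otimes> y"

definition poisson_iso :: "('a, 'm) lie_scheme \<Rightarrow> ('b, 'n) lie_scheme \<Rightarrow> ('a \<Rightarrow> 'b) set"
  where "poisson_iso A B = {h \<in> ring_iso A B.
    (\<forall>c. \<forall>x\<in>carrier A. h (c \<odot>\<^bsub>A\<^esub> x) = c \<odot>\<^bsub>B\<^esub> h x) \<and>
    (\<forall>x\<in>carrier A. \<forall>y\<in>carrier A. h \<lbrace>x, y\<rbrace>\<^bsub>A\<^esub> = \<lbrace>h x, h y\<rbrace>\<^bsub>B\<^esub>)}"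

definition poisson_isomorphic :: "('a, 'm) lie_scheme \<Rightarrow> ('b, 'n) lie_scheme \<Rightarrow> bool"
  where "poisson_isomorphic A B \<longleftrightarrow>
    poisson_algebra A \<and> poisson_algebra B \<and> poisson_iso A B \<noteq> {}"

text \<open>
  The quotient of the vector space \<open>M\<close> by the subspace \<open>N\<close>, with unit \<open>N + e\<close> and with the product
  and the bracket induced by the operations \<open>m\<close> and \<open>b\<close> on representatives. As for \<^const>\<open>FactRing\<close>,
  the operations on cosets are unions over all representatives; such a union is a single coset
  when the operation is compatible with \<open>N\<close>.
\<close>

definition coset_op ::
    "('c, 'a, 'm) module_scheme \<Rightarrow> 'a set \<Rightarrow> ('a \<Rightarrow> 'a \<Rightarrow> 'a) \<Rightarrow> 'a set \<Rightarrow> 'a set \<Rightarrow> 'a set"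
  where "coset_op M N f S T = (\<Union>x\<in>S. \<Union>y\<in>T. N +>\<^bsub>M\<^esub> f x y)"

definition poisson_quotient ::
    "(complex, 'a, 'm) module_scheme \<Rightarrow> 'a set \<Rightarrow> 'a \<Rightarrow> ('a \<Rightarrow> 'a \<Rightarrow> 'a) \<Rightarrow> ('a \<Rightarrow> 'a \<Rightarrow> 'a) \<Rightarrow> 'a set lie"
  where "poisson_quotient M N e m b =
    \<lparr>carrier = a_rcosets\<^bsub>M\<^esub> N,
     mult = coset_op M N m,
     one = N +>\<^bsub>M\<^esub> e,
     zero = N,
     add = set_add M,
     smult = (\<lambda>c S. \<Union>x\<in>S. N +>\<^bsub>M\<^esub> (c \<odot>\<^bsub>M\<^esub> x)),
     lie_bracket = coset_op M N b\<rparr>"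


section \<open>The symmetric algebra of a Lie algebra\<close>

text \<open>
  \<open>poly_algebra X\<close> is the polynomial algebra with one variable for each element of the set \<open>X\<close>.
  A monomial is a finitely supported exponent function \<^typ>\<open>'a \<Rightarrow>\<^sub>0 nat\<close>.
\<close>

type_synonym 'a polynomial = "('a \<Rightarrow>\<^sub>0 nat) \<Rightarrow>\<^sub>0 complex"

definition pvar :: "'a \<Rightarrow> 'a polynomial"
  where "pvar a = Poly_Mapping.single (Poly_Mapping.single a 1) 1"

definition pconst :: "complex \<Rightarrow> 'a polynomial"
  where "pconst c = Poly_Mapping.single 0 c"

definition pvars :: "'a polynomial \<Rightarrow> 'a set"
  where "pvars p = (\<Union>m\<in>Poly_Mapping.keys p. Poly_Mapping.keys m)"

definition poly_algebra :: "'a set \<Rightarrow> (complex, 'a polynomial) module"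
  where "poly_algebra X =
    \<lparr>carrier = {p. pvars p \<subseteq> X}, mult = (*), one = 1, zero = 0, add = (+),
     smult = (\<lambda>c p. pconst c * p)\<rparr>"

text \<open>
  Monomials not containing \<open>a\<close> contribute with coefficient \<open>0\<close>, so the truncated subtraction of
  exponents is harmless.
\<close>

definition partial_deriv :: "'a \<Rightarrow> 'a polynomial \<Rightarrow> 'a polynomial"
  where "partial_deriv a p = (\<Sum>m\<in>Poly_Mapping.keys p.
    Poly_Mapping.single (m - Poly_Mapping.single a 1)
      (of_nat (Poly_Mapping.lookup m a) * Poly_Mapping.lookup p m))"

definition poly_bracket ::
    "('a, 'm) lie_scheme \<Rightarrow> 'a polynomial \<Rightarrow> 'a polynomial \<Rightarrow> 'a polynomial"
  where "poly_bracket L p q = (\<Sum>a\<in>pvars p. \<Sum>b\<in>pvars q.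
    partial_deriv a p * partial_deriv b q * pvar \<lbrace>a, b\<rbrace>\<^bsub>L\<^esub>)"

text \<open>
  The symmetric algebra is the commutative algebra generated by the vector space \<open>L\<close>: the polynomial
  algebra on all elements of \<open>L\<close>, modulo the relations saying that the map from \<open>L\<close> to the
  algebra is linear. This needs no choice of a basis; the formula for the Poisson bracket in terms
  of partial derivatives is used with the generating set \<open>L\<close> in place of a basis, and induces a
  well-defined bracket on the quotient.
\<close>

definition linearity_ideal :: "('a, 'm) lie_scheme \<Rightarrow> 'a polynomial set"
  where "linearity_ideal L = Idl\<^bsub>poly_algebra (carrier L)\<^esub>
    ({pvar (x \<oplus>\<^bsub>L\<^esub> y) - (pvar x + pvar y) | x y. x \<in> carrier L \<and> y \<in> carrier L} \<union>
     {pvar (c \<odot>\<^bsub>L\<^esub> x) - pconst c * pvar x | c x. x \<in> carrier L})"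

definition symmetric_algebra :: "('a, 'm) lie_scheme \<Rightarrow> 'a polynomial set lie"
  where "symmetric_algebra L =
    poisson_quotient (poly_algebra (carrier L)) (linearity_ideal L) 1 (*) (poly_bracket L)"


section \<open>Vertex algebras\<close>

text \<open>
  \<open>nprod V a n b\<close> is \<open>a\<^sub>n b\<close>, the coefficient of \<open>x\<^sup>-\<^sup>n\<^sup>-\<^sup>1\<close> in \<open>Y(a,x)b\<close>. The fields \<open>mult\<close> and \<open>one\<close> are
  irrelevant.
\<close>

record 'v vertex = "(complex, 'v) module" +
  vacuum :: 'v
  nprod :: "'v \<Rightarrow> int \<Rightarrow> 'v \<Rightarrow> 'v"

text \<open>
  The sum of a family with finite support (\<^const>\<open>finsum\<close> is only meaningful on finite index sets).
  Below, all supports are finite by the truncation condition.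
\<close>

definition fsupp_sum :: "('v, 'm) ring_scheme \<Rightarrow> (nat \<Rightarrow> 'v) \<Rightarrow> 'v"
  where "fsupp_sum M f = finsum M f {i. f i \<noteq> \<zero>\<^bsub>M\<^esub>}"

text \<open>
  The Jacobi identity is
  \<open>x\<^sub>0\<^sup>-\<^sup>1 \<delta>((x\<^sub>1 - x\<^sub>2)/x\<^sub>0) Y(a,x\<^sub>1) Y(b,x\<^sub>2) c - x\<^sub>0\<^sup>-\<^sup>1 \<delta>((x\<^sub>2 - x\<^sub>1)/(-x\<^sub>0)) Y(b,x\<^sub>2) Y(a,x\<^sub>1) c
   = x\<^sub>2\<^sup>-\<^sup>1 \<delta>((x\<^sub>1 - x\<^sub>0)/x\<^sub>2) Y(Y(a,x\<^sub>0)b,x\<^sub>2) c\<close>;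
  the equation below, for all integers \<open>l\<close>, \<open>m\<close>, \<open>n\<close>, compares the coefficients of
  \<open>x\<^sub>0\<^sup>-\<^sup>l\<^sup>-\<^sup>1 x\<^sub>1\<^sup>-\<^sup>m\<^sup>-\<^sup>1 x\<^sub>2\<^sup>-\<^sup>n\<^sup>-\<^sup>1\<close>.
\<close>

locale vertex_algebra = module complex_ring V
  for V :: "('v, 'm) vertex_scheme" (structure) +
  assumes vacuum_closed [simp, intro]: "vacuum V \<in> carrier V"
    and nprod_closed [simp, intro]:
      "\<lbrakk>a \<in> carrier V; b \<in> carrier V\<rbrakk> \<Longrightarrow> nprod V a n b \<in> carrier V"
    and nprod_add_left:
      "\<lbrakk>a \<in> carrier V; b \<in> carrier V; c \<in> carrier V\<rbrakk> \<Longrightarrow>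
        nprod V (a \<oplus> b) n c = nprod V a n c \<oplus> nprod V b n c"
    and nprod_add_right:
      "\<lbrakk>a \<in> carrier V; b \<in> carrier V; c \<in> carrier V\<rbrakk> \<Longrightarrow>
        nprod V a n (b \<oplus> c) = nprod V a n b \<oplus> nprod V a n c"
    and nprod_smult_left:
      "\<lbrakk>a \<in> carrier V; b \<in> carrier V\<rbrakk> \<Longrightarrow> nprod V (k \<odot> a) n b = k \<odot> nprod V a n b"
    and nprod_smult_right:
      "\<lbrakk>a \<in> carrier V; b \<in> carrier V\<rbrakk> \<Longrightarrow> nprod V a n (k \<odot> b) = k \<odot> nprod V a n b"
    and truncation:
      "\<lbrakk>a \<in> carrier V; b \<in> carrier V\<rbrakk> \<Longrightarrow> \<exists>N. \<forall>n\<ge>N. nprod V a n b = \<zero>"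
    and vacuum_property:
      "a \<in> carrier V \<Longrightarrow> nprod V (vacuum V) n a = (if n = -1 then a else \<zero>)"
    and creation_regular:
      "\<lbrakk>a \<in> carrier V; n \<ge> 0\<rbrakk> \<Longrightarrow> nprod V a n (vacuum V) = \<zero>"
    and creation:
      "a \<in> carrier V \<Longrightarrow> nprod V a (-1) (vacuum V) = a"
    and Jacobi_identity:
      "\<lbrakk>a \<in> carrier V; b \<in> carrier V; c \<in> carrier V\<rbrakk> \<Longrightarrow>
        fsupp_sum V (\<lambda>i. ((-1) ^ i * (of_int l gchoose i)) \<odot>
            nprod V a (m + l - int i) (nprod V b (n + int i) c))
        \<ominus> fsupp_sum V (\<lambda>i. ((-1) powi l * (-1) ^ i * (of_int l gchoose i)) \<odot>
            nprod V b (n + l - int i) (nprod V a (m + int i) c))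
        = fsupp_sum V (\<lambda>i. (of_int m gchoose i) \<odot>
            nprod V (nprod V a (l + int i) b) (m + n - int i) c)"

definition C2 :: "('v, 'm) vertex_scheme \<Rightarrow> 'v set"
  where "C2 V = (\<lambda>H. submodule H complex_ring V) hull
    {nprod V a (-2) b | a b. a \<in> carrier V \<and> b \<in> carrier V}"

definition P2 :: "('v, 'm) vertex_scheme \<Rightarrow> 'v set lie"
  where "P2 V = poisson_quotient V (C2 V) (vacuum V) (\<lambda>a b. nprod V a (-1) b) (\<lambda>a b. nprod V a 0 b)"

type_synonym 'g vertex_universe = "(('g \<times> int) list \<Rightarrow>\<^sub>0 complex) set"

text \<open>
  Existence of a vertex algebra can only be asserted on a fixed type, large enough for the
  construction. The elements of \<^typ>\<open>'g vertex_universe\<close> are sets of noncommutative polynomials in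
  symbols \<open>(u, n)\<close>, standing for \<open>u \<otimes> t\<^sup>n\<close>, which gives room for the cosets making up any quotient
  of the enveloping algebra of the loop algebra of a Lie algebra on \<^typ>\<open>'g\<close>.
\<close>

end

theory Submission
  imports Defs "HOL-Library.Multiset"
begin

text \<open>
  \<open>V\<close> is the universal vertex algebra of level \<open>0\<close> of the loop algebra \<open>L[t, t\<^sup>-\<^sup>1]\<close>, realised on the
  enveloping algebra \<open>U\<close> of \<open>t\<^sup>-\<^sup>1 L[t\<^sup>-\<^sup>1]\<close>. The positive modes act on \<open>U\<close> by commuting them to the right
  until they kill the vacuum; that this respects the relations of \<open>U\<close> is checked directly, so no
  Poincare--Birkhoff--Witt theorem is needed. The generating fields \<open>u(x)\<close> are mutually local and
  translation covariant and generate \<open>U\<close> from the vacuum. By Dong's lemma the fields generated by them are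
  mutually local; by Goddard's uniqueness argument such a field is determined by the vector it creates from
  the vacuum, which makes \<open>U\<close> a vertex algebra; its Jacobi identity follows from locality by Pascal's rule.

  The algebra map \<open>U \<rightarrow> S(L)\<close> with \<open>u t\<^sup>-\<^sup>1 \<mapsto> u\<close> and \<open>u t\<^sup>-\<^sup>n \<mapsto> 0\<close> for \<open>n \<ge> 2\<close> sends \<open>a\<^sub>-\<^sub>2 b\<close>,
  \<open>a\<^sub>-\<^sub>1 b\<close>, \<open>a\<^sub>0 b\<close> to \<open>0\<close>, the product and the Poisson bracket of the images, by induction on \<open>a\<close>. Modulo
  its kernel the letters \<open>u t\<^sup>-\<^sup>1\<close> commute, so the kernel is spanned by the \<open>(u t\<^sup>-\<^sup>n) b\<close> with \<open>n \<ge> 2\<close>; these are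
  multiples of \<open>(u t\<^sup>-\<^sup>n\<^sup>+\<^sup>1)\<^sub>-\<^sub>2 b\<close>, hence the kernel is \<open>C\<^sub>2(V)\<close>.
\<close>

section \<open>Fields on a complex vector space\<close>

text \<open>Cosets are avoided during the construction. A linear projection along the relations,
  obtained by choosing a complement, keeps all operators total and linear on one type of words;
  membership in the span of the relations becomes an equation after projecting, and the singletons
  of projected words serve as elements of the vertex algebra. Since nothing is known about the size
  of \<open>U\<close>, each operator has to be shown compatible with the relations, and the
  dependencies are delicate. A nonnegative mode commutes with a letter exactly, by construction.
  Linearity in the label and the commutators with at least one negative mode rest on this, modulo
  relations; they give stability of the relations under nonnegative modes, and only that stability
  yields the commutator of two nonnegative modes. Letters are labelled by all elements of
  \<open>L\<close>, not by a basis, both in \<open>U\<close> and in the symmetric algebra. So even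
  additivity, antisymmetry and the Jacobi identity in the labels are congruences and not equations.
  A central term would require an invariant form on \<open>L\<close>; at level 0 the bracket alone
  suffices, and one factor x1 - x2 already annihilates every commutator of generating
  fields.\<close>

locale complex_vector_space = vector_space scale
  for scale :: "complex \<Rightarrow> 'v::ab_group_add \<Rightarrow> 'v"  (infixr \<open>*s\<close> 75)
begin

sublocale endo: vector_space_pair scale scale ..

abbreviation lin :: "('v \<Rightarrow> 'v) \<Rightarrow> bool"
  where "lin f \<equiv> Vector_Spaces.linear scale scale f"

lemma linI: "(\<And>x y. f (x + y) = f x + f y) \<Longrightarrow> (\<And>c x. f (c *s x) = c *s f x) \<Longrightarrow> lin f"
  by (simp add: Vector_Spaces.linear_iff vector_space_axioms)

section \<open>Finite sums weighted by signed binomial coefficients\<close>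

definition vanishing :: "(nat \<Rightarrow> 'v) \<Rightarrow> bool"
  where "vanishing X \<longleftrightarrow> (\<exists>K. \<forall>i\<ge>K. X i = 0)"

text \<open>
  This is the coefficient sum of \<open>(x\<^sub>1 - x\<^sub>2)\<^sup>c\<close>, expanded in nonnegative powers of \<open>x\<^sub>2\<close>, against \<open>X\<close>.
\<close>

definition binsum :: "complex \<Rightarrow> (nat \<Rightarrow> 'v) \<Rightarrow> 'v"
  where "binsum c X = Sum_any (\<lambda>i. ((-1) ^ i * (c gchoose i)) *s X i)"

lemma vanishingI: "(\<And>i. i \<ge> K \<Longrightarrow> X i = 0) \<Longrightarrow> vanishing X"
  by (auto simp: vanishing_def)

lemma vanishing_Suc: "vanishing X \<Longrightarrow> vanishing (\<lambda>i. X (Suc i))"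
  unfolding vanishing_def by (meson le_SucI)

lemma vanishing_scale: "vanishing X \<Longrightarrow> vanishing (\<lambda>i. g i *s X i)"
  by (auto simp: vanishing_def)

lemma vanishing_add: "vanishing X \<Longrightarrow> vanishing Y \<Longrightarrow> vanishing (\<lambda>i. X i + Y i)"
  unfolding vanishing_def by (metis add_0_left le_trans linorder_le_cases)

lemma vanishing_diff: "vanishing X \<Longrightarrow> vanishing Y \<Longrightarrow> vanishing (\<lambda>i. X i - Y i)"
  unfolding vanishing_def by (metis diff_zero le_trans linorder_le_cases)

lemma vanishing_lin: "vanishing X \<Longrightarrow> lin f \<Longrightarrow> vanishing (\<lambda>i. f (X i))"
  unfolding vanishing_def using endo.linear_0 by metis

lemma binsum_eq:
  assumes "\<And>i. i \<ge> K \<Longrightarrow> X i = 0"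
  shows "binsum c X = (\<Sum>i<K. ((-1) ^ i * (c gchoose i)) *s X i)"
  unfolding binsum_def
proof (rule Sum_any.expand_superset)
  show "{i. ((-1) ^ i * (c gchoose i)) *s X i \<noteq> 0} \<subseteq> {..<K}"
  proof
    fix i assume "i \<in> {i. ((-1) ^ i * (c gchoose i)) *s X i \<noteq> 0}"
    then have "X i \<noteq> 0" by auto
    then show "i \<in> {..<K}" using assms[of i] by (cases "K \<le> i") auto
  qed
qed simp

lemma vanishing2:
  assumes "vanishing X" "vanishing Y"
  obtains K where "\<And>i. i \<ge> K \<Longrightarrow> X i = 0" "\<And>i. i \<ge> K \<Longrightarrow> Y i = 0"
proof -
  obtain K L where "\<And>i. i \<ge> K \<Longrightarrow> X i = 0" "\<And>i. i \<ge> L \<Longrightarrow> Y i = 0"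
    using assms unfolding vanishing_def by blast
  then show thesis by (intro that[of "max K L"]) auto
qed

lemma binsum_add:
  "vanishing X \<Longrightarrow> vanishing Y \<Longrightarrow> binsum c (\<lambda>i. X i + Y i) = binsum c X + binsum c Y"
proof -
  assume "vanishing X" "vanishing Y"
  then obtain K where "\<And>i. i \<ge> K \<Longrightarrow> X i = 0" "\<And>i. i \<ge> K \<Longrightarrow> Y i = 0"
    using vanishing2 by blast
  then show ?thesis by (simp add: binsum_eq[of K] scale_right_distrib sum.distrib)
qed

lemma binsum_diff:
  "vanishing X \<Longrightarrow> vanishing Y \<Longrightarrow> binsum c (\<lambda>i. X i - Y i) = binsum c X - binsum c Y"
proof -
  assume "vanishing X" "vanishing Y"
  then obtain K where "\<And>i. i \<ge> K \<Longrightarrow> X i = 0" "\<And>i. i \<ge> K \<Longrightarrow> Y i = 0"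
    using vanishing2 by blast
  then show ?thesis by (simp add: binsum_eq[of K] scale_right_diff_distrib sum_subtractf)
qed

lemma binsum_lin:
  assumes "vanishing X" "lin f"
  shows "f (binsum c X) = binsum c (\<lambda>i. f (X i))"
proof -
  obtain K where "\<And>i. i \<ge> K \<Longrightarrow> X i = 0" using assms(1) unfolding vanishing_def by blast
  then show ?thesis
    by (simp add: binsum_eq[of K] endo.linear_sum[OF assms(2)] endo.linear_scale[OF assms(2)]
        endo.linear_0[OF assms(2)])
qed

lemma lin_scale_left: "lin ((*s) c)"
  by (rule linear_scale_self)

lemma binsum_scale: "vanishing X \<Longrightarrow> binsum c (\<lambda>i. k *s X i) = k *s binsum c X"
  using binsum_lin[OF _ lin_scale_left] by simp

lemma binsum_zero [simp]: "binsum c (\<lambda>i. 0) = 0"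
  by (simp add: binsum_def)

lemma binsum_first:
  assumes "\<And>i. i > 0 \<Longrightarrow> X i = 0"
  shows "binsum c X = X 0"
proof -
  have "binsum c X = (\<Sum>i<Suc 0. ((-1) ^ i * (c gchoose i)) *s X i)"
    by (rule binsum_eq) (use assms in auto)
  then show ?thesis by simp
qed

lemma binsum_0 [simp]: "binsum 0 X = X 0"
proof -
  have "binsum 0 X = (\<Sum>i<Suc 0. ((-1) ^ i * (0 gchoose i)) *s X i)"
    unfolding binsum_def
    by (rule Sum_any.expand_superset) (auto simp: gbinomial_0_left split: if_splits)
  then show ?thesis by simp
qed

text \<open>Pascal's rule, valid for a complex upper index. On coefficients it is one more factor x1
  - x2.\<close>

lemma binsum_plus1:
  assumes "vanishing X"
  shows "binsum (c + 1) X = binsum c X - binsum c (\<lambda>i. X (Suc i))"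
proof -
  obtain K where K: "\<And>i. i \<ge> K \<Longrightarrow> X i = 0" using assms unfolding vanishing_def by blast
  have "binsum (c + 1) X = (\<Sum>i<Suc K. ((-1) ^ i * ((c + 1) gchoose i)) *s X i)"
    by (rule binsum_eq) (use K in auto)
  also have "\<dots> = X 0 + (\<Sum>i<K. ((-1) ^ Suc i * ((c + 1) gchoose Suc i)) *s X (Suc i))"
    by (subst sum.lessThan_Suc_shift) simp
  also have "(\<Sum>i<K. ((-1) ^ Suc i * ((c + 1) gchoose Suc i)) *s X (Suc i)) =
     (\<Sum>i<K. ((-1) ^ Suc i * (c gchoose Suc i)) *s X (Suc i)) -
     (\<Sum>i<K. ((-1) ^ i * (c gchoose i)) *s X (Suc i))"
    unfolding sum_subtractf[symmetric] gbinomial_Suc_Suc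
    by (intro sum.cong refl) (simp add: algebra_simps scale_left_distrib scale_left_diff_distrib)
  also have "X 0 + (\<dots>) = (\<Sum>i<Suc K. ((-1) ^ i * (c gchoose i)) *s X i)
       - (\<Sum>i<K. ((-1) ^ i * (c gchoose i)) *s X (Suc i))"
    by (subst sum.lessThan_Suc_shift) simp
  also have "(\<Sum>i<Suc K. ((-1) ^ i * (c gchoose i)) *s X i) = binsum c X"
    by (rule binsum_eq[symmetric]) (use K in auto)
  also have "(\<Sum>i<K. ((-1) ^ i * (c gchoose i)) *s X (Suc i)) = binsum c (\<lambda>i. X (Suc i))"
    by (rule binsum_eq[symmetric]) (use K in auto)
  finally show ?thesis .
qed

text \<open>The absorption identity (i + 1) (c choose i + 1) = (c - i) (c choose i); the alternating
  sign produces the minus. It encodes that the x1- and x2-derivatives of (x1 - x2)^c add up to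
  0.\<close>

lemma binsum_absorb:
  assumes "vanishing X"
  shows "binsum c (\<lambda>i. of_nat i *s X i) = - binsum c (\<lambda>i. (c - of_nat i) *s X (Suc i))"
proof -
  obtain K where K: "\<And>i. i \<ge> K \<Longrightarrow> X i = 0" using assms unfolding vanishing_def by blast
  have "binsum c (\<lambda>i. of_nat i *s X i)
      = (\<Sum>i<Suc K. ((-1) ^ i * (c gchoose i)) *s (of_nat i *s X i))"
    by (rule binsum_eq) (use K in auto)
  also have "\<dots> = (\<Sum>i<K. ((-1) ^ Suc i * (c gchoose Suc i)) *s (of_nat (Suc i) *s X (Suc i)))"
    by (subst sum.lessThan_Suc_shift) simp
  also have "\<dots> = (\<Sum>i<K. - (((-1) ^ i * (c gchoose i)) *s ((c - of_nat i) *s X (Suc i))))"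
  proof (intro sum.cong refl)
    fix i
    have "(c gchoose Suc i) * of_nat (Suc i) = (c gchoose i) * (c - of_nat i)"
      using gbinomial_mult_1[of c i] by (simp add: algebra_simps)
    then have "((-1) ^ Suc i * (c gchoose Suc i)) * of_nat (Suc i)
        = - (((-1) ^ i * (c gchoose i)) * (c - of_nat i))"
      by (simp add: mult.assoc del: of_nat_Suc)
    then show "((-1) ^ Suc i * (c gchoose Suc i)) *s (of_nat (Suc i) *s X (Suc i))
        = - (((-1) ^ i * (c gchoose i)) *s ((c - of_nat i) *s X (Suc i)))"
      by (simp only: scale_scale scale_minus_left)
  qed
  also have "\<dots> = - binsum c (\<lambda>i. (c - of_nat i) *s X (Suc i))"
    unfolding sum_negf by (subst binsum_eq[of K]) (use K in auto)
  finally show ?thesis .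
qed

lemma binsum_mem: "subspace W \<Longrightarrow> (\<And>i. X i \<in> W) \<Longrightarrow> binsum c X \<in> W"
  unfolding binsum_def Sum_any.expand_set by (intro subspace_sum subspace_scale)

text \<open>The weight at i = 0 is 1, so modulo \<open>W\<close> the leading term is left
  unchanged.\<close>

lemma binsum_mem_first:
  assumes "vanishing X" "subspace W" "\<And>i. X (Suc i) \<in> W"
  shows "binsum c X - X 0 \<in> W"
proof -
  obtain K where "\<And>i. i \<ge> K \<Longrightarrow> X i = 0" using assms(1) unfolding vanishing_def by blast
  then have "binsum c X = (\<Sum>i<Suc K. ((-1) ^ i * (c gchoose i)) *s X i)"
    by (intro binsum_eq) simp
  also have "\<dots> = X 0 + (\<Sum>i<K. ((-1) ^ Suc i * (c gchoose Suc i)) *s X (Suc i))"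
    by (subst sum.lessThan_Suc_shift) simp
  finally have "binsum c X - X 0 = (\<Sum>i<K. ((-1) ^ Suc i * (c gchoose Suc i)) *s X (Suc i))"
    by simp
  then show ?thesis by (simp only:) (intro subspace_sum subspace_scale assms)
qed

section \<open>Fields, locality and products of fields\<close>

definition vfield :: "(int \<Rightarrow> 'v \<Rightarrow> 'v) \<Rightarrow> bool"
  where "vfield a \<longleftrightarrow> (\<forall>n. lin (a n)) \<and> (\<forall>v. \<exists>N. \<forall>n\<ge>N. a n v = 0)"

lemma vfield_lin: "vfield a \<Longrightarrow> lin (a n)"
  by (simp add: vfield_def)

lemmas vfield_simps = endo.linear_add[OF vfield_lin] endo.linear_scale[OF vfield_lin]
  endo.linear_0[OF vfield_lin] endo.linear_diff[OF vfield_lin] endo.linear_neg[OF vfield_lin]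

lemma vfield_vanishing: "vfield b \<Longrightarrow> vanishing (\<lambda>i. b (n + int i) v)"
proof -
  assume "vfield b"
  then obtain N where N: "\<forall>n\<ge>N. b n v = 0" unfolding vfield_def by blast
  show ?thesis by (rule vanishingI[of "nat (N - n)"]) (use N in auto)
qed

text \<open>The coefficient of x1^(-m-1) x2^(-n-1) in (x1 - x2)^l a(x1) b(x2), expanded in
  nonnegative powers of x2. In \<open>jacobi_lhs\<close> below, the factor (-1)^l turns (x2 - x1)^l
  into (x1 - x2)^l expanded in nonnegative powers of x1.\<close>

definition half_jacobi ::
    "(int \<Rightarrow> 'v \<Rightarrow> 'v) \<Rightarrow> (int \<Rightarrow> 'v \<Rightarrow> 'v) \<Rightarrow> int \<Rightarrow> int \<Rightarrow> int \<Rightarrow> 'v \<Rightarrow> 'v"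
  where "half_jacobi a b l m n v = binsum (of_int l) (\<lambda>i. a (m + l - int i) (b (n + int i) v))"

definition jacobi_lhs ::
    "(int \<Rightarrow> 'v \<Rightarrow> 'v) \<Rightarrow> (int \<Rightarrow> 'v \<Rightarrow> 'v) \<Rightarrow> int \<Rightarrow> int \<Rightarrow> int \<Rightarrow> 'v \<Rightarrow> 'v"
  where "jacobi_lhs a b l m n v = half_jacobi a b l m n v - ((-1) powi l) *s half_jacobi b a l n m v"

lemma half_jacobi_vanishing:
  "vfield a \<Longrightarrow> vfield b \<Longrightarrow> vanishing (\<lambda>i. a (m - int i) (b (n + int i) v))"
  using vfield_vanishing[of b n v] unfolding vanishing_def by (metis vfield_simps(3))

lemma half_jacobi_rec:
  assumes "vfield a" "vfield b"
  shows "half_jacobi a b (l + 1) m n v = half_jacobi a b l (m + 1) n v - half_jacobi a b l m (n + 1) v"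
proof -
  have "vanishing (\<lambda>i. a (m + 1 + l - int i) (b (n + int i) v))"
    by (rule half_jacobi_vanishing[OF assms])
  from binsum_plus1[OF this, of "of_int l"] show ?thesis
    by (simp add: half_jacobi_def algebra_simps)
qed

text \<open>One more factor x1 - x2. In the second half the two terms come in the opposite order,
  which the sign change of (-1)^l makes good.\<close>

lemma jacobi_lhs_rec:
  assumes "vfield a" "vfield b"
  shows "jacobi_lhs a b (l + 1) m n v = jacobi_lhs a b l (m + 1) n v - jacobi_lhs a b l m (n + 1) v"
  using half_jacobi_rec[OF assms, of l m n v] half_jacobi_rec[OF assms(2,1), of l n m v]
  by (simp add: jacobi_lhs_def power_int_add scale_right_diff_distrib)

lemma jacobi_lhs_0: "jacobi_lhs a b 0 m n v = a m (b n v) - b n (a m v)"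
  by (simp add: jacobi_lhs_def half_jacobi_def)

lemma half_jacobi_lin:
  assumes "vfield a" "vfield b"
  shows "lin (half_jacobi a b l m n)"
proof (rule linI)
  show "half_jacobi a b l m n (x + y) = half_jacobi a b l m n x + half_jacobi a b l m n y" for x y
    unfolding half_jacobi_def using assms
    by (simp add: vfield_simps[OF assms(1)] vfield_simps[OF assms(2)] binsum_add[symmetric] half_jacobi_vanishing)
  show "half_jacobi a b l m n (c *s x) = c *s half_jacobi a b l m n x" for c x
    unfolding half_jacobi_def using assms
    by (simp add: vfield_simps[OF assms(1)] vfield_simps[OF assms(2)] binsum_scale[symmetric] half_jacobi_vanishing)
qed

lemma jacobi_lhs_lin: "vfield a \<Longrightarrow> vfield b \<Longrightarrow> lin (jacobi_lhs a b l m n)"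
  unfolding jacobi_lhs_def
  by (intro endo.linear_compose_sub endo.linear_compose_scale_right half_jacobi_lin)

lemma jacobi_lhs_swap: "jacobi_lhs b a l n m v = - ((-1) powi l) *s jacobi_lhs a b l m n v"
proof -
  have "((-1) powi l) * ((-1) powi l) = (1::complex)"
    by (simp flip: power_int_add power_int_mult_distrib)
  then show ?thesis
    by (simp add: jacobi_lhs_def scale_right_diff_distrib scale_left_diff_distrib algebra_simps)
qed

text \<open>
  The recursion \<open>jacobi_lhs_rec\<close> makes this equivalent to the vanishing of
  \<open>(x\<^sub>1 - x\<^sub>2)\<^sup>N [a(x\<^sub>1), b(x\<^sub>2)]\<close>.
\<close>

definition local_pair :: "(int \<Rightarrow> 'v \<Rightarrow> 'v) \<Rightarrow> (int \<Rightarrow> 'v \<Rightarrow> 'v) \<Rightarrow> bool"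
  where "local_pair a b \<longleftrightarrow> (\<exists>N. \<forall>l\<ge>N. \<forall>m n v. jacobi_lhs a b l m n v = 0)"

text \<open>Setting m = 0 takes the residue in x1, which is the usual l-th product of two
  fields.\<close>

definition nth_product :: "(int \<Rightarrow> 'v \<Rightarrow> 'v) \<Rightarrow> int \<Rightarrow> (int \<Rightarrow> 'v \<Rightarrow> 'v) \<Rightarrow> int \<Rightarrow> 'v \<Rightarrow> 'v"
  where "nth_product a l b n = jacobi_lhs a b l 0 n"

lemma local_pair_sym: "local_pair a b \<Longrightarrow> local_pair b a"
  unfolding local_pair_def by (metis jacobi_lhs_swap scale_zero_right)

lemma local_pairI:
  assumes "vfield a" "vfield b" and "\<And>m n v. jacobi_lhs a b N m n v = 0"
  shows "local_pair a b"
  unfolding local_pair_def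
proof (intro exI[of _ N] allI impI)
  fix l m n v assume "N \<le> l"
  then show "jacobi_lhs a b l m n v = 0"
    by (induction l arbitrary: m n rule: int_ge_induct) (simp_all add: assms(3) jacobi_lhs_rec[OF assms(1,2)])
qed

lemma half_jacobi_add_left:
  "vfield a \<Longrightarrow> vfield a' \<Longrightarrow> vfield b \<Longrightarrow>
    half_jacobi (\<lambda>n v. a n v + a' n v) b l m n v = half_jacobi a b l m n v + half_jacobi a' b l m n v"
  unfolding half_jacobi_def by (simp add: binsum_add half_jacobi_vanishing)

lemma half_jacobi_add_right:
  "vfield a \<Longrightarrow> vfield a' \<Longrightarrow> vfield b \<Longrightarrow>
    half_jacobi b (\<lambda>n v. a n v + a' n v) l m n v = half_jacobi b a l m n v + half_jacobi b a' l m n v"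
  unfolding half_jacobi_def by (simp add: vfield_simps[of b] binsum_add half_jacobi_vanishing)

lemma half_jacobi_scale_left:
  "vfield a \<Longrightarrow> vfield b \<Longrightarrow>
    half_jacobi (\<lambda>n v. c *s a n v) b l m n v = c *s half_jacobi a b l m n v"
  unfolding half_jacobi_def by (simp add: binsum_scale half_jacobi_vanishing)

lemma half_jacobi_scale_right:
  "vfield a \<Longrightarrow> vfield b \<Longrightarrow>
    half_jacobi b (\<lambda>n v. c *s a n v) l m n v = c *s half_jacobi b a l m n v"
  unfolding half_jacobi_def by (simp add: vfield_simps[of b] binsum_scale half_jacobi_vanishing)

lemma local_pair_add:
  assumes "vfield a" "vfield a'" "vfield b" "local_pair a b" "local_pair a' b"
  shows "local_pair (\<lambda>n v. a n v + a' n v) b"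
proof -
  obtain N N' where "\<forall>l\<ge>N. \<forall>m n v. jacobi_lhs a b l m n v = 0"
      "\<forall>l\<ge>N'. \<forall>m n v. jacobi_lhs a' b l m n v = 0"
    using assms(4,5) unfolding local_pair_def by blast
  moreover have "jacobi_lhs (\<lambda>n v. a n v + a' n v) b l m n v
      = jacobi_lhs a b l m n v + jacobi_lhs a' b l m n v" for l m n v
    by (simp add: jacobi_lhs_def half_jacobi_add_left half_jacobi_add_right assms scale_right_distrib)
  ultimately show ?thesis
    unfolding local_pair_def by (intro exI[of _ "max N N'"]) auto
qed

lemma local_pair_scale:
  assumes "vfield a" "vfield b" "local_pair a b"
  shows "local_pair (\<lambda>n v. c *s a n v) b"
proof -
  have "jacobi_lhs (\<lambda>n v. c *s a n v) b l m n v = c *s jacobi_lhs a b l m n v" for l m n v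
    by (simp add: jacobi_lhs_def half_jacobi_scale_left half_jacobi_scale_right assms
        scale_right_diff_distrib scale_left_commute)
  then show ?thesis using assms(3) unfolding local_pair_def by (metis scale_zero_right)
qed

lemma vfield_nth_product:
  assumes a: "vfield a" and b: "vfield b"
  shows "vfield (nth_product a l b)"
  unfolding vfield_def
proof (intro conjI allI)
  show "lin (nth_product a l b n)" for n
    unfolding nth_product_def by (rule jacobi_lhs_lin[OF assms])
  fix v
  obtain N where N: "\<And>n. n \<ge> N \<Longrightarrow> b n v = 0" using b unfolding vfield_def by blast
  obtain K where K: "\<And>i. i \<ge> K \<Longrightarrow> a (int i) v = 0"
    using vfield_vanishing[OF a, of 0 v] by (auto simp: vanishing_def)
  have "\<forall>w. \<exists>N. \<forall>n\<ge>N. b n w = 0" using b unfolding vfield_def by blast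
  then obtain M' where M': "\<And>w n. n \<ge> M' w \<Longrightarrow> b n w = 0" by metis
  define M where "M i = M' (a (int i) v)" for i
  have M: "\<And>i n. n \<ge> M i \<Longrightarrow> b n (a (int i) v) = 0" by (simp add: M_def M')
  \<comment> \<open>Only the finitely many i < K have a_i v nonzero. For these,
    \<open>M i - l + int i\<close> is the bound on n from which \<open>b (n + l - int i)\<close>
    kills a_i v.\<close>
  define L where "L = Max (insert N ((\<lambda>i. M i - l + int i) ` {..<K}))"
  have "N \<le> L" and L: "i < K \<Longrightarrow> M i - l + int i \<le> L" for i
    unfolding L_def by (auto intro: Max_ge)
  show "\<exists>N. \<forall>n\<ge>N. nth_product a l b n v = 0"
  proof (intro exI[of _ L] allI impI)
    fix n assume "L \<le> n"
    have "b (n + int i) v = 0" for i using \<open>N \<le> L\<close> \<open>L \<le> n\<close> N by auto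
    then have "half_jacobi a b l 0 n v = 0"
      by (simp add: half_jacobi_def vfield_simps[OF a])
    moreover have "b (n + l - int i) (a (int i) v) = 0" for i
    proof (cases "i < K")
      case True
      then show ?thesis using L[OF True] \<open>L \<le> n\<close> by (intro M) auto
    next
      case False
      then show ?thesis using K by (simp add: vfield_simps[OF b])
    qed
    then have "half_jacobi b a l n 0 v = 0"
      by (simp add: half_jacobi_def)
    ultimately show "nth_product a l b n v = 0"
      by (simp add: nth_product_def jacobi_lhs_def)
  qed
qed

text \<open>The difference \<open>J\<close> of the two sides obeys a three-term Pascal recursion,
  vanishes at m = 0 by definition of the l-th product, and vanishes for large l by locality. Descent
  in l does the rest.\<close>

theorem field_jacobi_identity:
  assumes a: "vfield a" and b: "vfield b" and loc: "local_pair a b"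
  shows "jacobi_lhs a b l m n v
    = binsum (of_int m) (\<lambda>i. ((-1) ^ i) *s nth_product a (l + int i) b (m + n - int i) v)"
proof -
  obtain N where N: "\<And>l m n v. l \<ge> N \<Longrightarrow> jacobi_lhs a b l m n v = 0"
    using loc unfolding local_pair_def by blast
  define R where "R l m n = binsum (of_int m) (\<lambda>i. ((-1) ^ i) *s nth_product a (l + int i) b (m + n - int i) v)"
    for l m n
  define J where "J l m n = jacobi_lhs a b l m n v - R l m n" for l m n
  have van: "vanishing (\<lambda>i. ((-1) ^ i) *s nth_product a (l + int i) b (k - int i) v)" for l k
    by (rule vanishingI[of "nat (N - l)"]) (simp add: nth_product_def N)
  have "R l (m + 1) n = R (l + 1) m n + R l m (n + 1)" for l m n
  proof -
    have "R l (m + 1) n = binsum (of_int m) (\<lambda>i. ((-1) ^ i) *s nth_product a (l + int i) b (m + 1 + n - int i) v)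
       - binsum (of_int m) (\<lambda>i. ((-1) ^ Suc i) *s nth_product a (l + int (Suc i)) b (m + 1 + n - int (Suc i)) v)"
      unfolding R_def using binsum_plus1[OF van, of "of_int m" l "m + 1 + n"] by simp
    also have "binsum (of_int m) (\<lambda>i. ((-1) ^ Suc i) *s nth_product a (l + int (Suc i)) b (m + 1 + n - int (Suc i)) v)
        = - R (l + 1) m n"
      unfolding R_def using binsum_scale[OF van, of "of_int m" "-1" "l + 1" "m + n"]
      by (simp add: algebra_simps)
    finally show ?thesis by (simp add: R_def algebra_simps)
  qed
  then have rec: "J l (m + 1) n = J (l + 1) m n + J l m (n + 1)" for l m n
    unfolding J_def using jacobi_lhs_rec[OF a b, of l m n v] by simp
  have base: "J l 0 n = 0" for l n
    by (simp add: J_def R_def nth_product_def)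
  have top: "J l m n = 0" if "N \<le> l" for l m n
    using that by (simp add: J_def R_def N nth_product_def)
  have "J l m n = 0" if "l \<le> N" for l m n
    using that
  proof (induction l arbitrary: m n rule: int_le_induct)
    case base
    then show ?case using top by simp
  next
    case (step l)
    \<comment> \<open>With level l known to vanish, the recursion trades m against n at level l - 1.
      Hence \<open>J\<close> depends there on m + n only, and its values at m = 0 decide in both
      directions of m.\<close>
    have shift: "J (l - 1) (k + 1) n = J (l - 1) k (n + 1)" for k n
      using rec[of "l - 1" k n] step.IH by simp
    show ?case
    proof (induction m arbitrary: n rule: int_induct[of _ 0])
      case base
      show ?case using \<open>\<And>l n. J l 0 n = 0\<close> .
    next
      case (step1 i)
      then show ?case using shift by simp
    next
      case (step2 i)
      then show ?case using shift[of "i - 1" "n - 1"] by simp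
    qed
  qed
  then have "J l m n = 0"
    using top by (cases "l \<le> N") auto
  then show ?thesis by (simp add: J_def R_def)
qed

section \<open>Coefficient families in three variables and Dong's lemma\<close>

definition shift12 :: "(int \<Rightarrow> int \<Rightarrow> int \<Rightarrow> 'v) \<Rightarrow> int \<Rightarrow> int \<Rightarrow> int \<Rightarrow> 'v"
  where "shift12 f m n r = f (m + 1) n r - f m (n + 1) r"

definition shift13 :: "(int \<Rightarrow> int \<Rightarrow> int \<Rightarrow> 'v) \<Rightarrow> int \<Rightarrow> int \<Rightarrow> int \<Rightarrow> 'v"
  where "shift13 f m n r = f (m + 1) n r - f m n (r + 1)"

definition shift23 :: "(int \<Rightarrow> int \<Rightarrow> int \<Rightarrow> 'v) \<Rightarrow> int \<Rightarrow> int \<Rightarrow> int \<Rightarrow> 'v"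
  where "shift23 f m n r = f m (n + 1) r - f m n (r + 1)"

text \<open>Reading f m n r as the coefficient of x1^(-m-1) x2^(-n-1) x3^(-r-1), the shifts are
  multiplication by x1 - x2, x1 - x3 and x2 - x3.\<close>

lemma shift_commute:
  "shift13 (shift23 f) = shift23 (shift13 f)" "shift12 (shift23 f) = shift23 (shift12 f)"
  "shift12 (shift13 f) = shift13 (shift12 f)"
  by (intro ext, simp add: shift12_def shift13_def shift23_def)+

lemma shift_zero [simp]:
  "shift12 (\<lambda>_ _ _. 0) = (\<lambda>_ _ _. 0)" "shift13 (\<lambda>_ _ _. 0) = (\<lambda>_ _ _. 0)"
  "shift23 (\<lambda>_ _ _. 0) = (\<lambda>_ _ _. 0)"
  by (intro ext, simp add: shift12_def shift13_def shift23_def)+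

lemma funpow_zero3:
  fixes T :: "(int \<Rightarrow> int \<Rightarrow> int \<Rightarrow> 'v) \<Rightarrow> int \<Rightarrow> int \<Rightarrow> int \<Rightarrow> 'v"
  assumes "T (\<lambda>_ _ _. 0) = (\<lambda>_ _ _. 0)"
  shows "(T ^^ k) (\<lambda>_ _ _. 0) = (\<lambda>_ _ _. 0)"
  by (induction k) (simp_all add: assms)

lemma shift_pow_zero [simp]:
  "(shift13 ^^ k) (\<lambda>_ _ _. 0) = (\<lambda>_ _ _. 0)" "(shift23 ^^ k) (\<lambda>_ _ _. 0) = (\<lambda>_ _ _. 0)"
  by (rule funpow_zero3, simp)+

lemma funpow_commute2: "(\<And>f. S (T f) = T (S f)) \<Longrightarrow> (S ^^ i) ((T ^^ j) f) = (T ^^ j) ((S ^^ i) f)"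
proof -
  assume *: "\<And>f. S (T f) = T (S f)"
  have **: "S ((T ^^ j) f) = (T ^^ j) (S f)" for f j
    by (induction j) (simp_all add: *)
  show ?thesis by (induction i) (simp_all add: **)
qed

lemmas shift_pow_commute = funpow_commute2[of shift13 shift23, OF shift_commute(1)]

lemma shift23_pow_fun: "(shift23 ^^ k) f m = (shift23 ^^ k) (\<lambda>_. f m) m'"
  by (induction k) (simp_all add: fun_eq_iff shift23_def)

text \<open>The commutator of a(x1) and c(x3) acts on \<open>w n\<close>, where n is a spectator;
  this leaves room for a factor b(x2) applied beforehand.\<close>

lemma jacobi_lhs_shift13:
  assumes "vfield a" "vfield c"
  shows "(shift13 ^^ k) (\<lambda>m n r. a m (c r (w n)) - c r (a m (w n))) = (\<lambda>m n r. jacobi_lhs a c (int k) m r (w n))"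
proof (induction k)
  case 0
  show ?case by (simp add: jacobi_lhs_0)
next
  case (Suc k)
  then show ?case using jacobi_lhs_rec[OF assms, of "int k"]
    by (simp add: shift13_def fun_eq_iff add.commute)
qed

lemma jacobi_lhs_shift23:
  assumes "vfield b" "vfield c"
  shows "(shift23 ^^ k) (\<lambda>m n r. b n (c r (w m)) - c r (b n (w m))) = (\<lambda>m n r. jacobi_lhs b c (int k) n r (w m))"
proof (induction k)
  case 0
  show ?case by (simp add: jacobi_lhs_0)
next
  case (Suc k)
  then show ?case using jacobi_lhs_rec[OF assms, of "int k"]
    by (simp add: shift23_def fun_eq_iff add.commute)
qed

lemma shift_pow_add:
  "(shift13 ^^ k) (\<lambda>m n r. f m n r + g m n r) = (\<lambda>m n r. (shift13 ^^ k) f m n r + (shift13 ^^ k) g m n r)"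
  "(shift23 ^^ k) (\<lambda>m n r. f m n r + g m n r) = (\<lambda>m n r. (shift23 ^^ k) f m n r + (shift23 ^^ k) g m n r)"
  by (induction k) (auto simp: fun_eq_iff shift13_def shift23_def)

lemma shift_pow_diff:
  "(shift13 ^^ k) (\<lambda>m n r. f m n r - g m n r) = (\<lambda>m n r. (shift13 ^^ k) f m n r - (shift13 ^^ k) g m n r)"
  "(shift23 ^^ k) (\<lambda>m n r. f m n r - g m n r) = (\<lambda>m n r. (shift23 ^^ k) f m n r - (shift23 ^^ k) g m n r)"
  by (induction k) (auto simp: fun_eq_iff shift13_def shift23_def)

lemma shift_pow_scale:
  "(shift13 ^^ k) (\<lambda>m n r. c *s f m n r) = (\<lambda>m n r. c *s (shift13 ^^ k) f m n r)"
  "(shift23 ^^ k) (\<lambda>m n r. c *s f m n r) = (\<lambda>m n r. c *s (shift23 ^^ k) f m n r)"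
  by (induction k) (auto simp: fun_eq_iff shift13_def shift23_def scale_right_diff_distrib)

lemma shift23_pow_lin:
  assumes "\<And>m. lin (A m)"
  shows "(shift23 ^^ k) (\<lambda>m n r. A m (f m n r)) = (\<lambda>m n r. A m ((shift23 ^^ k) f m n r))"
  by (induction k) (auto simp: fun_eq_iff shift23_def endo.linear_diff[OF assms])

text \<open>\<open>[a b, c] = a [b, c] + [a, c] b\<close>.\<close>

lemma triple_commutator_shift:
  assumes a: "vfield a" and b: "vfield b" and c: "vfield c"
    and ac: "\<And>m n v. jacobi_lhs a c (int N) m n v = 0"
    and bc: "\<And>m n v. jacobi_lhs b c (int N) m n v = 0"
  shows "(shift13 ^^ N) ((shift23 ^^ N) (\<lambda>m n r. a m (b n (c r v)) - c r (a m (b n v)))) = (\<lambda>_ _ _. 0)"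
proof -
  have "(\<lambda>m n r. a m (b n (c r v)) - c r (a m (b n v))) =
     (\<lambda>m n r. a m (b n (c r v) - c r (b n v)) + (a m (c r (b n v)) - c r (a m (b n v))))"
    by (simp add: vfield_simps[OF a])
  moreover have "(shift23 ^^ N) (\<lambda>m n r. a m (b n (c r v) - c r (b n v))) = (\<lambda>_ _ _. 0)"
    using jacobi_lhs_shift23[OF b c, of N "\<lambda>_. v"]
    by (simp only: shift23_pow_lin[OF vfield_lin[OF a]] bc vfield_simps(3)[OF a])
  moreover have "(shift13 ^^ N) ((shift23 ^^ N) (\<lambda>m n r. a m (c r (b n v)) - c r (a m (b n v)))) = (\<lambda>_ _ _. 0)"
    using jacobi_lhs_shift13[OF a c, of N "\<lambda>n. b n v"]
    by (simp add: shift_pow_commute ac)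
  ultimately show ?thesis by (simp only: shift_pow_add shift_pow_zero add_0)
qed

text \<open>Multiplication by (x1 - x2)^l, expanded in nonnegative powers of x2, on families in
  three variables. Being a multiplication it commutes with the shifts, provided that all sums are
  finite.\<close>

definition spread :: "int \<Rightarrow> (int \<Rightarrow> int \<Rightarrow> int \<Rightarrow> 'v) \<Rightarrow> int \<Rightarrow> int \<Rightarrow> int \<Rightarrow> 'v"
  where "spread l f m n r = binsum (of_int l) (\<lambda>i. f (m + l - int i) (n + int i) r)"

lemma spread_shift:
  assumes "\<And>m n r. vanishing (\<lambda>i. f (m - int i) (n + int i) r)"
  shows "shift13 (spread l f) = spread l (shift13 f)" "shift23 (spread l f) = spread l (shift23 f)"
    "\<And>m n r. vanishing (\<lambda>i. shift13 f (m - int i) (n + int i) r)"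
    "\<And>m n r. vanishing (\<lambda>i. shift23 f (m - int i) (n + int i) r)"
proof -
  have v1: "vanishing (\<lambda>i. f (m - int i + 1) (n + int i) r)" for m n r
    using assms[of "m + 1" n r] by (simp add: algebra_simps)
  have v2: "vanishing (\<lambda>i. f (m - int i) (n + int i + 1) r)" for m n r
    using assms[of m "n + 1" r] by (simp add: algebra_simps)
  show "shift13 (spread l f) = spread l (shift13 f)"
    unfolding spread_def shift13_def fun_eq_iff
    by (auto simp: binsum_diff v1 assms) (simp add: algebra_simps)
  show "shift23 (spread l f) = spread l (shift23 f)"
    unfolding spread_def shift23_def fun_eq_iff
    by (auto simp: binsum_diff v2 assms) (simp add: algebra_simps)
  show "vanishing (\<lambda>i. shift13 f (m - int i) (n + int i) r)" for m n r
    unfolding shift13_def by (intro vanishing_diff v1 assms)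
  show "vanishing (\<lambda>i. shift23 f (m - int i) (n + int i) r)" for m n r
    unfolding shift23_def by (intro vanishing_diff v2 assms)
qed

lemma spread_shift_pow:
  assumes "\<And>m n r. vanishing (\<lambda>i. f (m - int i) (n + int i) r)"
  shows "(shift13 ^^ j) ((shift23 ^^ k) (spread l f)) = spread l ((shift13 ^^ j) ((shift23 ^^ k) f))"
proof -
  have 1: "(shift23 ^^ k) (spread l f) = spread l ((shift23 ^^ k) f) \<and>
      (\<forall>m n r. vanishing (\<lambda>i. (shift23 ^^ k) f (m - int i) (n + int i) r))"
    by (induction k) (simp_all add: assms spread_shift)
  have "(shift13 ^^ j) (spread l g) = spread l ((shift13 ^^ j) g) \<and>
      (\<forall>m n r. vanishing (\<lambda>i. (shift13 ^^ j) g (m - int i) (n + int i) r))"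
    if "\<And>m n r. vanishing (\<lambda>i. g (m - int i) (n + int i) r)" for g
    using that by (induction j) (simp_all add: spread_shift)
  then show ?thesis using 1 by simp
qed

text \<open>Each half of \<open>jacobi_lhs\<close> is a \<open>spread\<close> of a triple
  commutator, and the shifts pass through \<open>spread\<close> to reach
  \<open>triple_commutator_shift\<close>.\<close>

lemma nth_product_commutator_shift:
  assumes a: "vfield a" and b: "vfield b" and c: "vfield c"
    and ac: "\<And>m n v. jacobi_lhs a c (int N) m n v = 0"
    and bc: "\<And>m n v. jacobi_lhs b c (int N) m n v = 0"
  shows "(shift13 ^^ N) ((shift23 ^^ N)
      (\<lambda>m n r. jacobi_lhs a b l m n (c r v) - c r (jacobi_lhs a b l m n v))) = (\<lambda>_ _ _. 0)"
proof -
  define X where "X m n r = a m (b n (c r v)) - c r (a m (b n v))" for m n r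
  define X' where "X' n m r = b n (a m (c r v)) - c r (b n (a m v))" for n m r
  have vX: "vanishing (\<lambda>i. X (m - int i) (n + int i) r)" for m n r
    unfolding X_def by (intro vanishing_diff half_jacobi_vanishing[OF a b]
        vanishing_lin[OF half_jacobi_vanishing[OF a b] vfield_lin[OF c]])
  have vX': "vanishing (\<lambda>i. X' (m - int i) (n + int i) r)" for m n r
    unfolding X'_def by (intro vanishing_diff half_jacobi_vanishing[OF b a]
        vanishing_lin[OF half_jacobi_vanishing[OF b a] vfield_lin[OF c]])
  have hX: "half_jacobi a b l m n (c r v) - c r (half_jacobi a b l m n v) = spread l X m n r" for m n r
    unfolding half_jacobi_def spread_def X_def
    by (simp add: binsum_lin[OF half_jacobi_vanishing[OF a b] vfield_lin[OF c]] binsum_diff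
        half_jacobi_vanishing a b vanishing_lin[OF _ vfield_lin[OF c]])
  have hX': "half_jacobi b a l n m (c r v) - c r (half_jacobi b a l n m v) = spread l X' n m r" for m n r
    unfolding half_jacobi_def spread_def X'_def
    by (simp add: binsum_lin[OF half_jacobi_vanishing[OF b a] vfield_lin[OF c]] binsum_diff
        half_jacobi_vanishing a b vanishing_lin[OF _ vfield_lin[OF c]])
  \<comment> \<open>Exchange of x1 and x2. The second half is expanded in powers of x1, so it is a
    \<open>spread\<close> only after the exchange, which turns \<open>shift13\<close> into
    \<open>shift23\<close> and back.\<close>
  define sw where "sw f m n r = (f n m r :: 'v)" for f and m n r :: int
  have sw: "shift13 (sw f) = sw (shift23 f)" "shift23 (sw f) = sw (shift13 f)" for f
    by (auto simp: sw_def shift13_def shift23_def fun_eq_iff)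
  have sw_pow: "(shift13 ^^ k) (sw f) = sw ((shift23 ^^ k) f)" "(shift23 ^^ k) (sw f) = sw ((shift13 ^^ k) f)"
    for k f by (induction k) (simp_all add: sw)
  have K: "(\<lambda>m n r. jacobi_lhs a b l m n (c r v) - c r (jacobi_lhs a b l m n v)) =
    (\<lambda>m n r. spread l X m n r - ((-1) powi l) *s sw (spread l X') m n r)"
    unfolding hX[symmetric] hX'[symmetric] sw_def
    by (simp add: jacobi_lhs_def vfield_simps[OF c] scale_right_diff_distrib algebra_simps)
  have "(shift13 ^^ N) ((shift23 ^^ N) (spread l X)) = (\<lambda>_ _ _. 0)"
    using triple_commutator_shift[OF a b c ac bc]
    by (simp add: spread_shift_pow[OF vX]) (simp add: X_def[abs_def] spread_def[abs_def])
  moreover have "(shift13 ^^ N) ((shift23 ^^ N) (sw (spread l X'))) = (\<lambda>_ _ _. 0)"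
    using triple_commutator_shift[OF b a c bc ac]
    by (simp add: sw_pow shift_pow_commute[symmetric] spread_shift_pow[OF vX'])
       (simp add: X'_def[abs_def] spread_def[abs_def] sw_def[abs_def])
  ultimately show ?thesis
    unfolding K by (simp add: shift_pow_diff shift_pow_scale)
qed

text \<open>
  Dong's lemma. Where \<open>shift12\<close> vanishes, \<open>shift13\<close> and \<open>shift23\<close> agree, so locality descends from
  \<open>l + 1\<close> to \<open>l\<close>.
\<close>

theorem local_pair_nth_product:
  assumes a: "vfield a" and b: "vfield b" and c: "vfield c"
    and ab: "local_pair a b" and ac: "local_pair a c" and bc: "local_pair b c"
  shows "local_pair (nth_product a l b) c"
proof -
  obtain M where M: "\<And>l m n v. l \<ge> M \<Longrightarrow> jacobi_lhs a b l m n v = 0"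
    using ab unfolding local_pair_def by blast
  obtain N1 N2 where N1: "\<And>l m n v. l \<ge> N1 \<Longrightarrow> jacobi_lhs a c l m n v = 0"
    and N2: "\<And>l m n v. l \<ge> N2 \<Longrightarrow> jacobi_lhs b c l m n v = 0"
    using ac bc unfolding local_pair_def by metis
  define N where "N = nat (max N1 N2)"
  have N: "jacobi_lhs a c (int N) m n v = 0" "jacobi_lhs b c (int N) m n v = 0" for m n v
    by (auto simp: N_def intro!: N1 N2)
  define K where "K v l m n r = jacobi_lhs a b l m n (c r v) - c r (jacobi_lhs a b l m n v)" for v l m n r
  \<comment> \<open>Raising l by one multiplies the commutator family by x1 - x2.\<close>
  have K_rec: "K v (l + 1) = shift12 (K v l)" for v l
    unfolding K_def shift12_def fun_eq_iff
    by (simp add: jacobi_lhs_rec[OF a b] vfield_simps[OF c])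
  have K_shift: "(shift13 ^^ N) ((shift23 ^^ N) (K v l)) = (\<lambda>_ _ _. 0)" for v l
    using nth_product_commutator_shift[OF a b c N, of l v] unfolding K_def[abs_def] .
  have top: "K v l = (\<lambda>_ _ _. 0)" if "M \<le> l" for v l
    using that unfolding K_def fun_eq_iff by (simp add: M vfield_simps[OF c])
  have "\<exists>P. \<forall>v. (shift23 ^^ P) (K v l) = (\<lambda>_ _ _. 0)" if "l \<le> M" for l
    using that
  proof (induction l rule: int_le_induct)
    case base
    show ?case by (rule exI[of _ 0]) (simp add: top)
  next
    case (step l)
    then obtain P where P: "\<And>v. (shift23 ^^ P) (K v l) = (\<lambda>_ _ _. 0)" by blast
    \<comment> \<open>\<open>P\<close> factors x2 - x3 bring the family into the kernel of x1 - x2.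
      There x1 - x3 and x2 - x3 act alike, so the \<open>N\<close> factors of each kind in
      \<open>K_shift\<close> become \<open>N + N\<close> factors x2 - x3.\<close>
    show ?case
    proof (intro exI[of _ "N + N + P"] allI)
      fix v
      define X where "X = (shift23 ^^ P) (K v (l - 1))"
      have "shift12 X = (shift23 ^^ P) (K v l)"
        using funpow_commute2[of shift12 shift23, OF shift_commute(2), of 1 P "K v (l - 1)"] K_rec[of v "l - 1"]
        by (simp add: X_def)
      then have X12: "shift12 X = (\<lambda>_ _ _. 0)" by (simp add: P)
      have eq: "shift13 Y = shift23 Y" if "shift12 Y = (\<lambda>_ _ _. 0)" for Y
        using that by (simp add: fun_eq_iff shift12_def shift13_def shift23_def)
      have pow: "(shift13 ^^ k) Y = (shift23 ^^ k) Y" if "shift12 Y = (\<lambda>_ _ _. 0)" for k Y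
      proof (induction k)
        case (Suc k)
        have "shift12 ((shift23 ^^ k) Y) = (shift23 ^^ k) (shift12 Y)"
          using funpow_commute2[of shift12 shift23, OF shift_commute(2), of 1 k Y] by simp
        then show ?case using Suc eq that by simp
      qed simp
      have "shift12 ((shift23 ^^ N) X) = (\<lambda>_ _ _. 0)"
        using funpow_commute2[of shift12 shift23, OF shift_commute(2), of 1 N X] X12 by simp
      then have "(shift23 ^^ N) ((shift23 ^^ N) X) = (shift13 ^^ N) ((shift23 ^^ N) X)"
        by (simp add: pow)
      also have "\<dots> = (shift23 ^^ P) ((shift13 ^^ N) ((shift23 ^^ N) (K v (l - 1))))"
        unfolding X_def using funpow_commute2[of shift23 shift23 N P "K v (l - 1)"]
        by (simp add: shift_pow_commute)
      also have "\<dots> = (\<lambda>_ _ _. 0)" by (simp add: K_shift)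
      finally show "(shift23 ^^ (N + N + P)) (K v (l - 1)) = (\<lambda>_ _ _. 0)"
        by (simp add: X_def funpow_add)
    qed
  qed
  moreover have "\<exists>P. \<forall>v. (shift23 ^^ P) (K v l) = (\<lambda>_ _ _. 0)" if "M \<le> l" for l
    using top[OF that] by (intro exI[of _ 0]) simp
  ultimately obtain P where P: "\<And>v. (shift23 ^^ P) (K v l) = (\<lambda>_ _ _. 0)"
    by (metis linorder_linear)
  have f: "vfield (nth_product a l b)" by (rule vfield_nth_product[OF a b])
  show ?thesis
  proof (rule local_pairI[OF f c, of "int P"])
    fix m n v
    \<comment> \<open>The l-th product is the slice m = 0, and \<open>shift23\<close> never touches
      m.\<close>
    have K0: "K v l 0 = (\<lambda>n r. nth_product a l b n (c r v) - c r (nth_product a l b n v))"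
      by (simp add: fun_eq_iff K_def nth_product_def)
    have "(shift23 ^^ P) (\<lambda>_. K v l 0) 0 m n = jacobi_lhs (nth_product a l b) c (int P) m n v"
      unfolding K0 by (simp add: jacobi_lhs_shift23[OF f c, of P "\<lambda>_. v"])
    then show "jacobi_lhs (nth_product a l b) c (int P) m n v = 0"
      by (simp add: shift23_pow_fun[of P "K v l" 0 0, symmetric] P)
  qed
qed

text \<open>The hypotheses say that commuting with \<open>D\<close> differentiates each field. The
  factor (x1 - x2)^l is annihilated by the sum of the two partial derivatives, which is what
  \<open>binsum_absorb\<close> expresses.\<close>

lemma half_jacobi_derivation:
  assumes a: "vfield a" and b: "vfield b" and D: "lin D"
    and Da: "\<And>n v. D (a n v) = a n (D v) - of_int n *s a (n - 1) v"
    and Db: "\<And>n v. D (b n v) = b n (D v) - of_int n *s b (n - 1) v"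
  shows "D (half_jacobi a b l m n v) = half_jacobi a b l m n (D v)
    - of_int m *s half_jacobi a b l (m - 1) n v - of_int n *s half_jacobi a b l m (n - 1) v"
proof -
  \<comment> \<open>In \<open>Z i\<close> the index of b has dropped by one, in
    \<open>Z (Suc i)\<close> that of a. Their coefficients are split as n + i and m + (l -
    i).\<close>
  define Z where "Z i = a (m + l - int i) (b (n + int i - 1) v)" for i
  have vZ: "vanishing Z"
    using half_jacobi_vanishing[OF a b, of "m + l" "n - 1" v] by (simp add: Z_def[abs_def] algebra_simps)
  have vZS: "vanishing (\<lambda>i. Z (Suc i))" using vZ by (rule vanishing_Suc)
  have v0: "vanishing (\<lambda>i. a (m + l - int i) (b (n + int i) w))" for w
    by (rule half_jacobi_vanishing[OF a b])
  have "D (a (m + l - int i) (b (n + int i) v)) = a (m + l - int i) (b (n + int i) (D v))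
      - (of_int m *s Z (Suc i) + of_int n *s Z i + (of_int l - of_nat i) *s Z (Suc i) + of_nat i *s Z i)" for i
    by (simp add: Da Db vfield_simps[OF a] Z_def algebra_simps scale_left_distrib scale_left_diff_distrib)
  then have "D (half_jacobi a b l m n v) = half_jacobi a b l m n (D v)
      - (of_int m *s binsum (of_int l) (\<lambda>i. Z (Suc i)) + of_int n *s binsum (of_int l) Z
         + binsum (of_int l) (\<lambda>i. (of_int l - of_nat i) *s Z (Suc i)) + binsum (of_int l) (\<lambda>i. of_nat i *s Z i))"
    unfolding half_jacobi_def
    by (simp add: binsum_lin[OF v0 D] binsum_diff binsum_add binsum_scale v0 vZ vZS vanishing_add vanishing_scale)
  moreover have "half_jacobi a b l (m - 1) n v = binsum (of_int l) (\<lambda>i. Z (Suc i))"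
    "half_jacobi a b l m (n - 1) v = binsum (of_int l) Z"
    by (simp_all add: half_jacobi_def Z_def[abs_def] algebra_simps)
  ultimately show ?thesis
    unfolding binsum_absorb[OF vZ] by simp
qed

text \<open>The x1-derivative enters with the factor m = 0: residues annihilate derivatives.\<close>

lemma nth_product_derivation:
  assumes a: "vfield a" and b: "vfield b" and D: "lin D"
    and Da: "\<And>n v. D (a n v) = a n (D v) - of_int n *s a (n - 1) v"
    and Db: "\<And>n v. D (b n v) = b n (D v) - of_int n *s b (n - 1) v"
  shows "D (nth_product a l b n v) = nth_product a l b n (D v) - of_int n *s nth_product a l b (n - 1) v"
  unfolding nth_product_def jacobi_lhs_def
  by (simp add: endo.linear_diff[OF D] endo.linear_scale[OF D] half_jacobi_derivation[OF a b D Da Db]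
      half_jacobi_derivation[OF b a D Db Da] algebra_simps scale_right_diff_distrib)

end

section \<open>The vertex algebra generated by local fields\<close>

lemma cring_complex_ring: "cring complex_ring"
  by (rule cringI)
    (auto simp: complex_ring_def algebra_simps intro!: abelian_groupI comm_monoidI exI[of _ "- _"])

lemma complex_ring_simps [simp]:
  "carrier complex_ring = UNIV" "x \<otimes>\<^bsub>complex_ring\<^esub> y = x * y" "x \<oplus>\<^bsub>complex_ring\<^esub> y = x + y"
  "\<one>\<^bsub>complex_ring\<^esub> = 1" "\<zero>\<^bsub>complex_ring\<^esub> = 0"
  by (simp_all add: complex_ring_def)

text \<open>The carrier of the vertex algebra is the range of the projection \<open>P\<close>.\<close>

locale vertex_generators = complex_vector_space scale
  for scale :: "complex \<Rightarrow> 'v::ab_group_add \<Rightarrow> 'v"  (infixr \<open>*s\<close> 75) +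
  fixes P D :: "'v \<Rightarrow> 'v" and vac :: 'v and gens :: "(int \<Rightarrow> 'v \<Rightarrow> 'v) set"
  assumes P_lin: "lin P" and P_idem [simp]: "P (P v) = P v" and P_vac [simp]: "P vac = vac"
    and D_lin: "lin D" and D_P: "D (P v) = P (D v)" and D_vac [simp]: "D vac = 0"
    and gens_vfield: "a \<in> gens \<Longrightarrow> vfield a"
    and gens_P: "a \<in> gens \<Longrightarrow> P (a n v) = a n v" "a \<in> gens \<Longrightarrow> a n (P v) = a n v"
    and gens_D: "a \<in> gens \<Longrightarrow> D (a n v) = a n (D v) - of_int n *s a (n - 1) v"
    and gens_vac: "a \<in> gens \<Longrightarrow> n \<ge> 0 \<Longrightarrow> a n vac = 0"
    and gens_local: "a \<in> gens \<Longrightarrow> b \<in> gens \<Longrightarrow> local_pair a b"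
    and cyclic: "subspace W \<Longrightarrow> vac \<in> W \<Longrightarrow> (\<And>a n w. a \<in> gens \<Longrightarrow> w \<in> W \<Longrightarrow> a n w \<in> W) \<Longrightarrow> P v \<in> W"
begin

text \<open>\<open>P\<close> takes the place of the identity, so that this field too absorbs
  \<open>P\<close> on both sides.\<close>

definition one_field :: "int \<Rightarrow> 'v \<Rightarrow> 'v"
  where "one_field n v = (if n = -1 then P v else 0)"

text \<open>The locality premise of \<open>nth\<close> hands Dong's lemma its mutual locality in the
  inductions leading to \<open>fields_local\<close>; afterwards \<open>fields_nth\<close> discharges
  it.\<close>

inductive_set fields :: "(int \<Rightarrow> 'v \<Rightarrow> 'v) set"
  where
    one: "one_field \<in> fields"
  | gen: "a \<in> gens \<Longrightarrow> a \<in> fields"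
  | nth: "a \<in> fields \<Longrightarrow> b \<in> fields \<Longrightarrow> local_pair a b \<Longrightarrow> nth_product a l b \<in> fields"
  | add: "a \<in> fields \<Longrightarrow> b \<in> fields \<Longrightarrow> (\<lambda>n v. a n v + b n v) \<in> fields"
  | scale: "a \<in> fields \<Longrightarrow> (\<lambda>n v. c *s a n v) \<in> fields"

lemma fields_vfield: "a \<in> fields \<Longrightarrow> vfield a"
proof (induction rule: fields.induct)
  case one
  have "\<exists>N. \<forall>n\<ge>N. one_field n v = 0" for v
    by (intro exI[of _ 0]) (simp add: one_field_def)
  moreover have "lin (one_field n)" for n
    by (rule linI) (simp_all add: one_field_def endo.linear_add[OF P_lin] endo.linear_scale[OF P_lin])
  ultimately show ?case by (simp add: vfield_def)
next
  case (add a b)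
  have "\<exists>N. \<forall>n\<ge>N. a n v + b n v = 0" for v
  proof -
    obtain N M where "\<forall>n\<ge>N. a n v = 0" "\<forall>n\<ge>M. b n v = 0"
      using add.IH unfolding vfield_def by meson
    then show ?thesis by (intro exI[of _ "max N M"]) simp
  qed
  moreover have "lin (\<lambda>v. a n v + b n v)" for n
    by (intro endo.linear_compose_add vfield_lin add.IH)
  ultimately show ?case by (simp add: vfield_def)
next
  case (scale a c)
  have "\<exists>N. \<forall>n\<ge>N. c *s a n v = 0" for v
  proof -
    obtain N where "\<forall>n\<ge>N. a n v = 0"
      using scale.IH unfolding vfield_def by meson
    then show ?thesis by (intro exI[of _ N]) simp
  qed
  moreover have "lin (\<lambda>v. c *s a n v)" for n
    by (intro endo.linear_compose_scale_right vfield_lin scale.IH)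
  ultimately show ?case by (simp add: vfield_def)
qed (auto intro: gens_vfield vfield_nth_product)

lemma half_jacobi_P:
  assumes "vfield a" "vfield b" "\<And>n v. P (a n v) = a n v" "\<And>n v. b n (P v) = b n v"
  shows "P (half_jacobi a b l m n v) = half_jacobi a b l m n v"
    "half_jacobi a b l m n (P v) = half_jacobi a b l m n v"
  unfolding half_jacobi_def by (simp_all add: binsum_lin[OF half_jacobi_vanishing P_lin] assms)

lemma fields_P: "a \<in> fields \<Longrightarrow> (\<forall>n v. P (a n v) = a n v \<and> a n (P v) = a n v)"
proof (induction rule: fields.induct)
  case (nth a b l)
  then show ?case
    by (simp add: nth_product_def jacobi_lhs_def half_jacobi_P fields_vfield
        endo.linear_diff[OF P_lin] endo.linear_scale[OF P_lin])
qed (auto simp: one_field_def gens_P endo.linear_add[OF P_lin] endo.linear_scale[OF P_lin]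
      endo.linear_0[OF P_lin])

lemma fields_D: "a \<in> fields \<Longrightarrow> (\<forall>n v. D (a n v) = a n (D v) - of_int n *s a (n - 1) v)"
proof (induction rule: fields.induct)
  case (nth a b l)
  then show ?case
    by (simp add: nth_product_derivation[OF fields_vfield fields_vfield D_lin])
next
  case (gen a)
  then show ?case by (simp add: gens_D)
next
  case (scale a c)
  then show ?case
    by (simp add: endo.linear_scale[OF D_lin] scale_right_diff_distrib mult.commute)
qed (auto simp: one_field_def D_P endo.linear_add[OF D_lin] endo.linear_scale[OF D_lin]
      endo.linear_0[OF D_lin] algebra_simps)

text \<open>Nonnegative modes kill the vacuum, so at mode -1 only the term i = 0 of the first half
  survives. This is how products of fields correspond to products of states.\<close>

lemma nth_product_vac:
  assumes "vfield a" "vfield b" "\<And>n. n \<ge> 0 \<Longrightarrow> a n vac = 0" "\<And>n. n \<ge> 0 \<Longrightarrow> b n vac = 0"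
  shows "n \<ge> 0 \<Longrightarrow> nth_product a l b n vac = 0"
    "nth_product a l b (-1) vac = a l (b (-1) vac)"
proof -
  show "n \<ge> 0 \<Longrightarrow> nth_product a l b n vac = 0"
    by (simp add: nth_product_def jacobi_lhs_def half_jacobi_def assms(3,4)
        vfield_simps[OF assms(1)] vfield_simps[OF assms(2)])
  have "half_jacobi a b l 0 (-1) vac = a l (b (-1) vac)"
    unfolding half_jacobi_def by (subst binsum_first) (auto simp: assms(4) vfield_simps[OF assms(1)])
  then show "nth_product a l b (-1) vac = a l (b (-1) vac)"
    by (simp add: nth_product_def jacobi_lhs_def half_jacobi_def assms(3) vfield_simps[OF assms(2)])
qed

lemma fields_vac: "a \<in> fields \<Longrightarrow> (\<forall>n\<ge>0. a n vac = 0)"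
  by (induction rule: fields.induct)
    (auto simp: one_field_def gens_vac nth_product_vac fields_vfield)

lemma local_pair_one_field: "a \<in> fields \<Longrightarrow> local_pair one_field a"
  by (rule local_pairI[of _ _ 0])
    (auto simp: fields_vfield fields.one jacobi_lhs_0 one_field_def fields_P
      vfield_simps(3)[OF fields_vfield])

text \<open>Dong's lemma holds one field fixed, so locality is extended one argument at a time;
  \<open>fields_local\<close> handles the other argument by symmetry.\<close>

lemma fields_local_gens:
  assumes "a \<in> fields" "b \<in> gens"
  shows "local_pair a b"
  using assms(1)
proof (induction rule: fields.induct)
  case one
  then show ?case by (simp add: local_pair_one_field fields.gen assms(2))
next
  case (nth a a' l)
  then show ?case
    by (intro local_pair_nth_product) (auto intro: fields_vfield gens_vfield assms(2))
qed (auto intro: local_pair_add local_pair_scale fields_vfield gens_vfield gens_local assms(2))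

lemma fields_local:
  assumes "a \<in> fields" "b \<in> fields"
  shows "local_pair a b"
proof -
  have "local_pair b a" using assms(2)
  proof (induction rule: fields.induct)
    case one
    show ?case by (rule local_pair_one_field[OF assms(1)])
  next
    case (gen b)
    show ?case by (rule local_pair_sym[OF fields_local_gens[OF assms(1) gen]])
  next
    case (nth b b' l)
    then show ?case by (intro local_pair_nth_product) (auto intro: fields_vfield assms(1))
  qed (auto intro: local_pair_add local_pair_scale fields_vfield assms(1))
  then show ?thesis by (rule local_pair_sym)
qed

lemma fields_nth: "a \<in> fields \<Longrightarrow> b \<in> fields \<Longrightarrow> nth_product a l b \<in> fields"
  by (intro fields.nth fields_local)

lemma fields_diff:
  assumes "a \<in> fields" "b \<in> fields"
  shows "(\<lambda>n v. a n v - b n v) \<in> fields"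
  using fields.add[OF assms(1) fields.scale[OF assms(2), of "-1"]] by simp

text \<open>The states created by \<open>fields\<close> form a subspace that is stable under
  generating modes: a_n applied to the state of b is the state of the n-th product of a and
  b.\<close>

lemma fields_cyclic: "\<exists>a\<in>fields. a (-1) vac = P v"
proof -
  define W where "W = {a (-1) vac | a. a \<in> fields}"
  have "P v \<in> W"
  proof (rule cyclic)
    show "subspace W"
    proof (rule subspaceI)
      show "0 \<in> W"
        using fields.scale[OF fields.one, of 0] by (force simp: W_def)
      show "x + y \<in> W" if "x \<in> W" "y \<in> W" for x y
        using that fields.add by (fastforce simp: W_def)
      show "c *s x \<in> W" if "x \<in> W" for c x
        using that fields.scale by (fastforce simp: W_def)
    qed
    show "vac \<in> W"
      unfolding W_def using fields.one by (intro CollectI exI[of _ one_field]) (simp add: one_field_def)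
    show "a n w \<in> W" if "a \<in> gens" "w \<in> W" for a n w
    proof -
      obtain b where b: "b \<in> fields" "w = b (-1) vac" using \<open>w \<in> W\<close> by (auto simp: W_def)
      have "nth_product a n b (-1) vac = a n w"
        using b that by (subst nth_product_vac(2)) (auto simp: fields_vac fields_vfield gens_vfield gens_vac)
      then show ?thesis
        unfolding W_def using fields_nth[OF fields.gen[OF \<open>a \<in> gens\<close>] b(1), of n]
        by (intro CollectI exI[of _ "nth_product a n b"]) simp
    qed
  qed
  then show ?thesis by (auto simp: W_def)
qed

text \<open>
  Goddard's uniqueness argument: \<open>D\<close> determines \<open>a(x)vac\<close> from its constant term, and locality with a
  field that creates \<open>w\<close> from the vacuum then determines \<open>a(x)w\<close>.
\<close>

lemma fields_eq_0:
  assumes a: "a \<in> fields" and vac: "a (-1) vac = 0"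
  shows "a n v = 0"
proof -
  \<comment> \<open>Applying \<open>D\<close> to a_(-1-k) vac gives (k + 1) a_(-2-k) vac, so the
    vanishing spreads downwards one mode at a time.\<close>
  have neg: "a (-1 - int k) vac = 0" for k
  proof (induction k)
    case (Suc k)
    have "D (a (-1 - int k) vac) = a (-1 - int k) (D vac) - of_int (-1 - int k) *s a (-1 - int k - 1) vac"
      using fields_D[OF a] by blast
    then have "complex_of_int (-1 - int k) *s a (-1 - int k - 1) vac = 0"
      by (simp only: Suc D_vac vfield_simps(3)[OF fields_vfield[OF a]] endo.linear_0[OF D_lin]) simp
    moreover have "complex_of_int (-1 - int k) \<noteq> 0" by (simp only: of_int_eq_0_iff)
    ultimately have "a (-1 - int k - 1) vac = 0" using scale_eq_0_iff by blast
    then show ?case by (simp add: algebra_simps)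
  qed (simp add: vac)
  have a_vac: "a m vac = 0" for m
  proof (cases "m \<ge> 0")
    case True
    then show ?thesis using fields_vac[OF a] by simp
  next
    case False
    then show ?thesis using neg[of "nat (-1 - m)"] by simp
  qed
  obtain b where b: "b \<in> fields" "b (-1) vac = P v" using fields_cyclic by blast
  obtain N where N: "\<And>m k w. jacobi_lhs a b N m k w = 0"
    using fields_local[OF a b(1)] unfolding local_pair_def by blast
  \<comment> \<open>The index n - N compensates the shift by \<open>N\<close> in
    \<open>half_jacobi\<close>. As b_i vac = 0 for i >= 0, only a_n b_(-1) vac remains.\<close>
  have "half_jacobi a b N (n - N) (-1) vac = a n (P v)"
    unfolding half_jacobi_def using fields_vac[OF b(1)]
    by (subst binsum_first) (auto simp: b(2) vfield_simps(3)[OF fields_vfield[OF a]])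
  moreover have "half_jacobi b a N (-1) (n - N) vac = 0"
    by (simp add: half_jacobi_def a_vac vfield_simps(3)[OF fields_vfield[OF b(1)]])
  ultimately have "a n (P v) = 0"
    using N[of "n - N" "-1" vac] by (simp add: jacobi_lhs_def)
  then show ?thesis using fields_P[OF a] by simp
qed

section \<open>The state-field correspondence\<close>

definition Y :: "'v \<Rightarrow> int \<Rightarrow> 'v \<Rightarrow> 'v"
  where "Y v = (SOME a. a \<in> fields \<and> a (-1) vac = P v)"

lemma Y_fields [simp]: "Y v \<in> fields" and Y_vac: "Y v (-1) vac = P v"
  unfolding Y_def using someI_ex[of "\<lambda>a. a \<in> fields \<and> a (-1) vac = P v"] fields_cyclic[of v] by blast+

text \<open>The difference of the two fields creates 0 from the vacuum, so
  \<open>fields_eq_0\<close> applies. It reduces identities between fields to identities between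
  states.\<close>

lemma Y_eqI:
  assumes "a \<in> fields" "a (-1) vac = P v"
  shows "Y v = a"
proof (intro ext)
  fix n w
  have "Y v n w - a n w = 0"
    by (rule fields_eq_0[OF fields_diff[OF Y_fields assms(1)]]) (simp add: Y_vac assms(2))
  then show "Y v n w = a n w" by simp
qed

lemma Y_vfield [simp]: "vfield (Y v)"
  by (rule fields_vfield) simp

lemma Y_P [simp]: "P (Y v n w) = Y v n w" "Y v n (P w) = Y v n w" "Y (P v) = Y v"
  by (simp_all add: fields_P[OF Y_fields] Y_eqI Y_vac)

lemma Y_add: "Y (v + w) n x = Y v n x + Y w n x"
  by (subst Y_eqI[OF fields.add[OF Y_fields Y_fields]])
    (simp_all add: Y_vac endo.linear_add[OF P_lin])

lemma Y_scale: "Y (c *s v) n x = c *s Y v n x"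
  by (subst Y_eqI[OF fields.scale[OF Y_fields]]) (simp_all add: Y_vac endo.linear_scale[OF P_lin])

lemma Y_vacuum: "Y vac = one_field"
  by (rule Y_eqI[OF fields.one]) (simp add: one_field_def)

lemma Y_regular: "n \<ge> 0 \<Longrightarrow> Y v n vac = 0"
  using fields_vac[OF Y_fields] by blast

lemma Y_product: "Y (Y v l w) = nth_product (Y v) l (Y w)"
  by (rule Y_eqI) (simp_all add: fields_nth nth_product_vac Y_regular Y_vac)

lemma Y_gen:
  assumes "a \<in> gens"
  shows "Y (a n v) = nth_product a n (Y v)"
  by (rule Y_eqI)
    (simp_all add: fields_nth fields.gen assms nth_product_vac Y_regular Y_vac gens_P gens_vfield gens_vac)

lemma Y_jacobi:
  "jacobi_lhs (Y u) (Y v) l m n w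
    = binsum (of_int m) (\<lambda>i. ((-1) ^ i) *s Y (Y u (l + int i) v) (m + n - int i) w)"
  by (simp add: field_jacobi_identity fields_local Y_product)

text \<open>Singletons are used because the universe type consists of sets of words; the unique
  representative in the range of \<open>P\<close> replaces the coset.\<close>

definition vertex_record :: "'v set vertex"
  where "vertex_record = \<lparr>carrier = range (\<lambda>v. {P v}), monoid.mult = (\<lambda>X Y. {}), one = {}, zero = {0},
    add = (\<lambda>X Y. {the_elem X + the_elem Y}), smult = (\<lambda>c X. {c *s the_elem X}),
    vacuum = {vac}, nprod = (\<lambda>X n Z. {Y (the_elem X) n (the_elem Z)})\<rparr>"

lemma vertex_record_simps [simp]:
  "carrier vertex_record = range (\<lambda>v. {P v})" "\<zero>\<^bsub>vertex_record\<^esub> = {0}"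
  "{v} \<oplus>\<^bsub>vertex_record\<^esub> {w} = {v + w}" "c \<odot>\<^bsub>vertex_record\<^esub> {v} = {c *s v}"
  "vacuum vertex_record = {vac}" "nprod vertex_record {v} n {w} = {Y v n w}"
  by (simp_all add: vertex_record_def)

lemma in_range_P: "P v = v \<Longrightarrow> {v} \<in> range (\<lambda>v. {P v})"
  by (rule range_eqI[of _ _ v]) simp

lemma vertex_record_carrier:
  assumes "X \<in> carrier vertex_record"
  obtains v where "X = {v}" "P v = v"
  using assms by auto

lemma module_vertex_record: "module complex_ring vertex_record"
  (is "module _ ?V")
proof (rule moduleI)
  show "cring complex_ring" by (rule cring_complex_ring)
  show "abelian_group ?V"
  proof (rule abelian_groupI)
    fix X assume "X \<in> carrier ?V"
    then obtain v where "X = {v}" "P v = v" by (rule vertex_record_carrier)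
    then show "\<exists>Z\<in>carrier ?V. Z \<oplus>\<^bsub>?V\<^esub> X = \<zero>\<^bsub>?V\<^esub>"
      using in_range_P[of "- v"] by (intro bexI[of _ "{- v}"]) (simp_all add: endo.linear_neg[OF P_lin])
  qed (auto simp: endo.linear_0[OF P_lin] endo.linear_add[OF P_lin] algebra_simps
      intro!: in_range_P elim!: vertex_record_carrier)
qed (auto simp: endo.linear_scale[OF P_lin] algebra_simps intro!: in_range_P)

sublocale vr: module complex_ring vertex_record
  by (rule module_vertex_record)

lemma finsum_vertex_record:
  assumes "\<And>i. P (g i) = g i"
  shows "finsum vertex_record (\<lambda>i. {g i}) A = {sum g A}"
proof (induction A rule: infinite_finite_induct)
  case (insert x F)
  then show ?case
    using in_range_P[OF assms] by (subst vr.finsum_insert) auto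
qed (simp_all add: vr.finsum_infinite)

lemma fsupp_sum_vertex_record:
  "(\<And>i. P (g i) = g i) \<Longrightarrow> fsupp_sum vertex_record (\<lambda>i. {g i}) = {Sum_any g}"
  by (simp add: fsupp_sum_def finsum_vertex_record Sum_any.expand_set)

lemma minus_vertex_record:
  assumes "P v = v" "P w = w"
  shows "{v} \<ominus>\<^bsub>vertex_record\<^esub> {w} = {v - w}"
proof -
  have "P (- w) = - w" by (simp add: endo.linear_neg[OF P_lin] assms)
  then have "\<ominus>\<^bsub>vertex_record\<^esub> {w} = {- w}"
    by (intro vr.minus_equality) (use in_range_P assms in auto)
  then show ?thesis by (simp add: a_minus_def)
qed

lemma Sum_any_half_jacobi:
  "Sum_any (\<lambda>i. ((-1) ^ i * (of_int l gchoose i)) *s Y a (m + l - int i) (Y b (n + int i) c))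
    = half_jacobi (Y a) (Y b) l m n c"
  by (simp add: half_jacobi_def binsum_def)

lemma Sum_any_half_jacobi_scale:
  "Sum_any (\<lambda>i. (k * (-1) ^ i * (of_int l gchoose i)) *s Y a (m + l - int i) (Y b (n + int i) c))
    = k *s half_jacobi (Y a) (Y b) l m n c"
proof -
  have "k *s half_jacobi (Y a) (Y b) l m n c
      = binsum (of_int l) (\<lambda>i. k *s Y a (m + l - int i) (Y b (n + int i) c))"
    unfolding half_jacobi_def by (rule binsum_scale[symmetric], rule half_jacobi_vanishing) simp_all
  then show ?thesis by (simp add: binsum_def mult.assoc mult.left_commute mult.commute)
qed

lemma Sum_any_iterate:
  "Sum_any (\<lambda>i. (of_int m gchoose i) *s Y (Y a (l + int i) b) (m + n - int i) c)
    = jacobi_lhs (Y a) (Y b) l m n c"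
proof -
  \<comment> \<open>Two alternating signs meet here, one from \<open>binsum\<close> and one from
    \<open>field_jacobi_identity\<close>.\<close>
  have "(-1) ^ i * ((-1) ^ i * x) = (x :: complex)" for i x
    by (simp flip: mult.assoc power_mult_distrib)
  then show ?thesis
    unfolding Y_jacobi binsum_def by (simp add: mult.commute mult.left_commute)
qed

theorem vertex_algebra_vertex_record: "vertex_algebra vertex_record"
proof (intro vertex_algebra.intro vertex_algebra_axioms.intro module_vertex_record)
  let ?V = vertex_record
  fix X Z assume "X \<in> carrier ?V" "Z \<in> carrier ?V"
  then obtain v w where X: "X = {v}" "P v = v" and Z: "Z = {w}" "P w = w"
    by (metis vertex_record_carrier)
  show "nprod ?V X n Z \<in> carrier ?V" for n
    by (simp add: X Z in_range_P)
  show "nprod ?V (k \<odot>\<^bsub>?V\<^esub> X) n Z = k \<odot>\<^bsub>?V\<^esub> nprod ?V X n Z" for k n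
    by (simp add: X Z Y_scale)
  show "nprod ?V X n (k \<odot>\<^bsub>?V\<^esub> Z) = k \<odot>\<^bsub>?V\<^esub> nprod ?V X n Z" for k n
    by (simp add: X Z vfield_simps[OF Y_vfield])
  show "\<exists>N. \<forall>n\<ge>N. nprod ?V X n Z = \<zero>\<^bsub>?V\<^esub>"
    using Y_vfield[of v] by (simp add: X Z vfield_def)
  show "nprod ?V (vacuum ?V) n X = (if n = -1 then X else \<zero>\<^bsub>?V\<^esub>)" for n
    by (simp add: X Y_vacuum one_field_def)
  show "nprod ?V X n (vacuum ?V) = \<zero>\<^bsub>?V\<^esub>" if "n \<ge> 0" for n
    using that by (simp add: X Y_regular)
  show "nprod ?V X (-1) (vacuum ?V) = X"
    by (simp add: X Y_vac)
  fix W assume "W \<in> carrier ?V"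
  then obtain u where W: "W = {u}" "P u = u" by (rule vertex_record_carrier)
  show "nprod ?V (X \<oplus>\<^bsub>?V\<^esub> Z) n W
      = nprod ?V X n W \<oplus>\<^bsub>?V\<^esub> nprod ?V Z n W" for n
    by (simp add: X Z W Y_add)
  show "nprod ?V X n (Z \<oplus>\<^bsub>?V\<^esub> W)
      = nprod ?V X n Z \<oplus>\<^bsub>?V\<^esub> nprod ?V X n W" for n
    by (simp add: X Z W vfield_simps[OF Y_vfield])
  have P: "P (c *s Y a n b) = c *s Y a n b" for c a n b
    by (simp add: endo.linear_scale[OF P_lin])
  have P': "P (half_jacobi (Y a) (Y b) l m n c) = half_jacobi (Y a) (Y b) l m n c" for a b l m n c
    by (simp add: half_jacobi_P)
  show "fsupp_sum ?V (\<lambda>i. ((-1) ^ i * (of_int l gchoose i)) \<odot>\<^bsub>?V\<^esub>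
            nprod ?V X (m + l - int i) (nprod ?V Z (n + int i) W))
        \<ominus>\<^bsub>?V\<^esub> fsupp_sum ?V (\<lambda>i. ((-1) powi l * (-1) ^ i * (of_int l gchoose i)) \<odot>\<^bsub>?V\<^esub>
            nprod ?V Z (n + l - int i) (nprod ?V X (m + int i) W))
        = fsupp_sum ?V (\<lambda>i. (of_int m gchoose i) \<odot>\<^bsub>?V\<^esub>
            nprod ?V (nprod ?V X (l + int i) Z) (m + n - int i) W)" for l m n
    by (simp add: X Z W fsupp_sum_vertex_record P P' Sum_any_half_jacobi Sum_any_half_jacobi_scale
        Sum_any_iterate minus_vertex_record endo.linear_scale[OF P_lin])
      (simp add: jacobi_lhs_def)
qed (simp add: in_range_P)

end

section \<open>The enveloping algebra of the negative loop algebra\<close>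

definition pm_scale :: "complex \<Rightarrow> ('k \<Rightarrow>\<^sub>0 complex) \<Rightarrow> ('k \<Rightarrow>\<^sub>0 complex)"  (infixr \<open>*c\<close> 75)
  where "c *c p = Poly_Mapping.map ((*) c) p"

lemma lookup_pm_scale [simp]: "Poly_Mapping.lookup (c *c p) k = c * Poly_Mapping.lookup p k"
  by (simp add: pm_scale_def Poly_Mapping.map.rep_eq when_def)

interpretation pm: complex_vector_space pm_scale
  by unfold_locales (auto intro!: poly_mapping_eqI simp: lookup_add algebra_simps)

abbreviation wd :: "'k \<Rightarrow> ('k \<Rightarrow>\<^sub>0 complex)"
  where "wd k \<equiv> Poly_Mapping.single k 1"

abbreviation plin :: "(('k \<Rightarrow>\<^sub>0 complex) \<Rightarrow> ('l \<Rightarrow>\<^sub>0 complex)) \<Rightarrow> bool"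
  where "plin f \<equiv> Vector_Spaces.linear pm_scale pm_scale f"

type_synonym 'a words = "('a \<times> int) list \<Rightarrow>\<^sub>0 complex"

definition lift :: "('k \<Rightarrow> ('l \<Rightarrow>\<^sub>0 complex)) \<Rightarrow> ('k \<Rightarrow>\<^sub>0 complex) \<Rightarrow> ('l \<Rightarrow>\<^sub>0 complex)"
  where "lift f p = (\<Sum>k\<in>Poly_Mapping.keys p. Poly_Mapping.lookup p k *c f k)"

interpretation pm2: vector_space_pair
  "pm_scale :: complex \<Rightarrow> ('k \<Rightarrow>\<^sub>0 complex) \<Rightarrow> ('k \<Rightarrow>\<^sub>0 complex)"
  "pm_scale :: complex \<Rightarrow> ('l \<Rightarrow>\<^sub>0 complex) \<Rightarrow> ('l \<Rightarrow>\<^sub>0 complex)"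
  by unfold_locales

lemma lift_superset:
  assumes "finite A" "Poly_Mapping.keys p \<subseteq> A"
  shows "lift f p = (\<Sum>k\<in>A. Poly_Mapping.lookup p k *c f k)"
  unfolding lift_def by (rule sum.mono_neutral_left) (use assms in \<open>auto simp: in_keys_iff\<close>)

lemma lift_lin: "plin (lift f)"
proof -
  have "lift f (p + q) = lift f p + lift f q" for p q
  proof -
    let ?A = "Poly_Mapping.keys p \<union> Poly_Mapping.keys q"
    have "lift f (p + q) = (\<Sum>k\<in>?A. Poly_Mapping.lookup (p + q) k *c f k)"
      by (rule lift_superset) (auto simp: keys_add)
    then show ?thesis
      by (simp add: lift_superset[of ?A p] lift_superset[of ?A q] lookup_add pm.scale_left_distrib sum.distrib)
  qed
  moreover have "lift f (c *c p) = c *c lift f p" for c p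
  proof -
    have "lift f (c *c p) = (\<Sum>k\<in>Poly_Mapping.keys p. Poly_Mapping.lookup (c *c p) k *c f k)"
      by (rule lift_superset) (auto simp: in_keys_iff)
    then show ?thesis by (simp add: lift_def pm.scale_sum_right)
  qed
  ultimately show ?thesis by (simp add: Vector_Spaces.linear_iff pm.vector_space_axioms)
qed

lemma lift_wd [simp]: "lift f (wd k) = f k"
  by (simp add: lift_def)

lemma pm_expand: "p = (\<Sum>k\<in>Poly_Mapping.keys p. Poly_Mapping.lookup p k *c wd k)"
proof (rule poly_mapping_eqI)
  fix k
  show "Poly_Mapping.lookup p k = Poly_Mapping.lookup (\<Sum>k\<in>Poly_Mapping.keys p. Poly_Mapping.lookup p k *c wd k) k"
    by (auto simp: lookup_sum lookup_single when_def in_keys_iff sum.delta if_distrib cong: if_cong)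
qed

text \<open>Only basis vectors occurring in \<open>p\<close> have to be tested, so a condition on
  the support of \<open>p\<close> stays usable.\<close>

lemma plin_memI:
  assumes f: "plin f" and W: "pm.subspace W" and k: "\<And>k. k \<in> Poly_Mapping.keys p \<Longrightarrow> f (wd k) \<in> W"
  shows "f p \<in> W"
proof -
  have "f p = (\<Sum>k\<in>Poly_Mapping.keys p. Poly_Mapping.lookup p k *c f (wd k))"
    by (subst pm_expand) (simp add: pm2.linear_sum[OF f] pm2.linear_scale[OF f])
  also have "\<dots> \<in> W"
    by (intro pm.subspace_sum pm.subspace_scale k W)
  finally show ?thesis .
qed

lemma plin_eqI:
  assumes "plin f" "plin g" "\<And>k. f (wd k) = g (wd k)"
  shows "f p = g p"
  using plin_memI[OF pm2.linear_compose_sub[OF assms(1,2)] pm.subspace_single_0] assms(3) by simp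

lemma plin_comp: "plin f \<Longrightarrow> plin g \<Longrightarrow> plin (\<lambda>x. f (g x))"
  by (auto simp: Vector_Spaces.linear_iff)

text \<open>A linear retraction g onto \<open>W\<close> comes from a choice of complement; x - g x
  then represents the coset of x without leaving the type.\<close>

lemma pm_projection:
  assumes "pm.subspace W"
  obtains f where "plin f" "\<And>x. x \<in> W \<Longrightarrow> f x = 0" "\<And>x. x - f x \<in> W"
proof -
  have "plin (\<lambda>x. x)" by (rule pm.linear_ident)
  then obtain g where g: "range g \<subseteq> W" "plin g" "\<forall>v\<in>W. g v = v"
    using pm2.linear_exists_left_inverse_on[of "\<lambda>x. x" W] assms by auto
  show thesis
  proof (rule that[of "\<lambda>x. x - g x"])
    show "plin (\<lambda>x. x - g x)" by (intro pm2.linear_compose_sub g pm.linear_ident)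
  qed (use g in auto)
qed

section \<open>Words in negative loop letters and the action of all modes on them\<close>

context lie_algebra begin

text \<open>The letter type also contains pairs that are no elements u t^n with u in
  \<open>L\<close> and n < 0. Words with such letters are sent to 0 by all operators and count as
  relators, which keeps every map total and linear.\<close>

definition good :: "('a \<times> int) list \<Rightarrow> bool"
  where "good w \<longleftrightarrow> (\<forall>x\<in>set w. fst x \<in> carrier L \<and> snd x < 0)"

lemma good_simps [simp]:
  "good []" "good (x # w) \<longleftrightarrow> fst x \<in> carrier L \<and> snd x < 0 \<and> good w"
  "good (w @ w') \<longleftrightarrow> good w \<and> good w'"
  by (auto simp: good_def)

definition prefix_word :: "'a \<times> int \<Rightarrow> 'a words \<Rightarrow> 'a words"
  where "prefix_word x = lift (\<lambda>w. if good (x # w) then wd (x # w) else 0)"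

text \<open>
  The action of \<open>u \<otimes> t\<^sup>n\<close>, \<open>n \<ge> 0\<close>, on the induced module: commute it to the right until it meets the
  vacuum.
\<close>

primrec act :: "('a \<times> int) list \<Rightarrow> 'a \<Rightarrow> int \<Rightarrow> 'a words"
  where
    "act [] u n = 0"
  | "act (y # w) u n = prefix_word y (act w u n) +
      (if n + snd y < 0 then prefix_word (\<lbrace>u, fst y\<rbrace>, n + snd y) (wd w)
       else act w \<lbrace>u, fst y\<rbrace> (n + snd y))"

definition loop_op :: "'a \<Rightarrow> int \<Rightarrow> 'a words \<Rightarrow> 'a words"
  where "loop_op u n = (if n < 0 then prefix_word (u, n) else lift (\<lambda>w. if good w then act w u n else 0))"

lemma loop_op_lin: "plin (loop_op u n)"
  by (simp add: loop_op_def prefix_word_def lift_lin)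

lemmas loop_op_simps = pm2.linear_add[OF loop_op_lin] pm2.linear_scale[OF loop_op_lin]
  pm2.linear_0[OF loop_op_lin] pm2.linear_diff[OF loop_op_lin] pm2.linear_neg[OF loop_op_lin]

lemma loop_op_bad: "\<not> good w \<Longrightarrow> loop_op u n (wd w) = 0"
  by (simp add: loop_op_def prefix_word_def)

lemma loop_op_neg: "n < 0 \<Longrightarrow> u \<in> carrier L \<Longrightarrow> good w \<Longrightarrow> loop_op u n (wd w) = wd ((u, n) # w)"
  by (simp add: loop_op_def prefix_word_def)

lemma wd_Cons: "good (x # w) \<Longrightarrow> wd (x # w) = loop_op (fst x) (snd x) (wd w)"
  by (simp add: loop_op_neg)

lemma loop_op_vac: "n \<ge> 0 \<Longrightarrow> loop_op u n (wd []) = 0"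
  by (simp add: loop_op_def)

text \<open>An equation rather than a congruence, because it is the recursion that defines
  \<open>act\<close>. The absence of a central term is level 0.\<close>

lemma loop_op_commute:
  assumes "n \<ge> 0" "m < 0" "v \<in> carrier L"
  shows "loop_op u n (loop_op v m p) = loop_op v m (loop_op u n p) + loop_op \<lbrace>u, v\<rbrace> (n + m) p"
proof -
  have lin: "plin (\<lambda>p. loop_op u n (loop_op v m p))"
    "plin (\<lambda>p. loop_op v m (loop_op u n p) + loop_op \<lbrace>u, v\<rbrace> (n + m) p)"
    by (intro plin_comp[OF loop_op_lin loop_op_lin] pm2.linear_compose_add loop_op_lin)+
  have "loop_op u n (loop_op v m (wd w)) = loop_op v m (loop_op u n (wd w)) + loop_op \<lbrace>u, v\<rbrace> (n + m) (wd w)"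
    for w
  proof (cases "good w")
    case True
    then show ?thesis using assms by (simp add: loop_op_neg) (simp add: loop_op_def)
  next
    case False
    then show ?thesis by (simp add: loop_op_bad loop_op_simps)
  qed
  then show ?thesis by (rule plin_eqI[OF lin])
qed

section \<open>The relations of the enveloping algebra\<close>

abbreviation "add_relator w u v n w' \<equiv>
  wd (w @ (u \<oplus> v, n) # w') - wd (w @ (u, n) # w') - wd (w @ (v, n) # w')"

abbreviation "smult_relator w c u n w' \<equiv> wd (w @ (c \<odot> u, n) # w') - c *c wd (w @ (u, n) # w')"

abbreviation "comm_relator w u m v n w' \<equiv>
  wd (w @ (u, m) # (v, n) # w') - wd (w @ (v, n) # (u, m) # w') - wd (w @ (\<lbrace>u, v\<rbrace>, m + n) # w')"

text \<open>Labels range over all of \<open>L\<close>, so linearity in the label has to be imposed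
  along with the commutators. The contexts \<open>w\<close> and \<open>w'\<close> on both sides make
  the span behave as a two-sided ideal.\<close>

definition relators :: "'a words set"
  where "relators =
    {add_relator w u v n w' | w u v n w'.
      u \<in> carrier L \<and> v \<in> carrier L \<and> n < 0 \<and> good w \<and> good w'} \<union>
    {smult_relator w c u n w' | w c u n w'.
      u \<in> carrier L \<and> n < 0 \<and> good w \<and> good w'} \<union>
    {comm_relator w u m v n w' | w u m v n w'.
      u \<in> carrier L \<and> v \<in> carrier L \<and> m < 0 \<and> n < 0 \<and> good w \<and> good w'} \<union>
    {wd w | w. \<not> good w}"

definition rel :: "'a words set"
  where "rel = pm.span relators"

lemma rel_subspace: "pm.subspace rel"
  by (simp add: rel_def pm.subspace_span)

lemmas rel_closed = pm.subspace_add[OF rel_subspace] pm.subspace_diff[OF rel_subspace]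
  pm.subspace_scale[OF rel_subspace] pm.subspace_neg[OF rel_subspace] pm.subspace_0[OF rel_subspace]

lemma rel_bad: "\<not> good w \<Longrightarrow> wd w \<in> rel"
  unfolding rel_def by (rule pm.span_base) (unfold relators_def, blast)

lemma rel_add:
  assumes "u \<in> carrier L" "v \<in> carrier L" "n < 0"
  shows "add_relator w u v n w' \<in> rel"
proof (cases "good w \<and> good w'")
  case True
  then show ?thesis unfolding rel_def
    by (intro pm.span_base) (use assms in \<open>unfold relators_def, blast\<close>)
next
  case False
  then show ?thesis by (intro rel_closed rel_bad) auto
qed

lemma rel_smult:
  assumes "u \<in> carrier L" "n < 0"
  shows "smult_relator w c u n w' \<in> rel"
proof (cases "good w \<and> good w'")
  case True
  then show ?thesis unfolding rel_def
    by (intro pm.span_base) (use assms in \<open>unfold relators_def, blast\<close>)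
next
  case False
  then show ?thesis by (intro rel_closed rel_bad) auto
qed

lemma rel_commute:
  assumes "u \<in> carrier L" "v \<in> carrier L" "m < 0" "n < 0"
  shows "comm_relator w u m v n w' \<in> rel"
proof (cases "good w \<and> good w'")
  case True
  then show ?thesis unfolding rel_def
    by (intro pm.span_base) (use assms in \<open>unfold relators_def, blast\<close>)
next
  case False
  then show ?thesis by (intro rel_closed rel_bad) auto
qed

lemma plin_rel:
  assumes f: "plin f"
    and add: "\<And>w u v n w'. \<lbrakk>u \<in> carrier L; v \<in> carrier L; n < 0; good w; good w'\<rbrakk> \<Longrightarrow>
      f (add_relator w u v n w') \<in> W"
    and smult: "\<And>w c u n w'. \<lbrakk>u \<in> carrier L; n < 0; good w; good w'\<rbrakk> \<Longrightarrow>
      f (smult_relator w c u n w') \<in> W"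
    and comm: "\<And>w u m v n w'. \<lbrakk>u \<in> carrier L; v \<in> carrier L; m < 0; n < 0; good w; good w'\<rbrakk> \<Longrightarrow>
      f (comm_relator w u m v n w') \<in> W"
    and bad: "\<And>w. \<not> good w \<Longrightarrow> f (wd w) \<in> W"
    and W: "pm.subspace W" and p: "p \<in> rel"
  shows "f p \<in> W"
proof -
  have "rel \<subseteq> {p. f p \<in> W}"
    unfolding rel_def
  proof (rule pm.span_minimal)
    show "relators \<subseteq> {p. f p \<in> W}"
    proof
      fix p assume "p \<in> relators"
      then show "p \<in> {p. f p \<in> W}"
        unfolding relators_def
        by (elim UnE CollectE exE conjE) (simp_all only: mem_Collect_eq add smult comm bad not_False_eq_True)
    qed
    show "pm.subspace {p. f p \<in> W}"
      by (rule pm.subspaceI)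
        (auto simp: pm2.linear_0[OF f] pm2.linear_add[OF f] pm2.linear_scale[OF f]
          intro: pm.subspace_0[OF W] pm.subspace_add[OF W] pm.subspace_scale[OF W])
  qed
  then show ?thesis using p by blast
qed

text \<open>A letter put in front merely lengthens the left context of a relator.\<close>

lemma prefix_word_rel:
  assumes "u \<in> carrier L" "n < 0" "p \<in> rel"
  shows "loop_op u n p \<in> rel"
proof (rule plin_rel[OF loop_op_lin])
  fix w w' a b and k :: int assume "a \<in> carrier L" "b \<in> carrier L" "k < 0" "good w" "good w'"
  then show "loop_op u n (add_relator w a b k w') \<in> rel"
    using rel_add[of a b k "(u, n) # w" w'] assms by (simp add: loop_op_simps loop_op_neg)
next
  fix w w' c a and k :: int assume "a \<in> carrier L" "k < 0" "good w" "good w'"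
  then show "loop_op u n (smult_relator w c a k w') \<in> rel"
    using rel_smult[of a k "(u, n) # w" c w'] assms by (simp add: loop_op_simps loop_op_neg)
next
  fix w w' a b and k l :: int assume "a \<in> carrier L" "b \<in> carrier L" "k < 0" "l < 0" "good w" "good w'"
  then show "loop_op u n (comm_relator w a k b l w') \<in> rel"
    using rel_commute[of a b k l "(u, n) # w" w'] assms by (simp add: loop_op_simps loop_op_neg)
qed (simp_all add: loop_op_bad rel_closed rel_subspace assms)

text \<open>For n < 0 this is a relator. For n >= 0, commuting past the first letter replaces u and
  v by their brackets with that letter and lowers n, which is why the induction is over all u, v,
  n.\<close>

lemma loop_op_add_rel:
  assumes "u \<in> carrier L" "v \<in> carrier L"
  shows "loop_op (u \<oplus> v) n p - loop_op u n p - loop_op v n p \<in> rel"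
proof -
  have *: "loop_op (u \<oplus> v) n (wd w) - loop_op u n (wd w) - loop_op v n (wd w) \<in> rel" for w
    using assms
  proof (induction w arbitrary: u v n)
    case Nil
    then show ?case using rel_add[of u v n "[]" "[]"]
      by (cases "n < 0") (simp_all add: loop_op_neg loop_op_vac rel_closed)
  next
    case (Cons y w)
    show ?case
    proof (cases "good (y # w)")
      case False
      then show ?thesis by (simp add: loop_op_bad rel_closed del: good_simps)
    next
      case True
      show ?thesis
      proof (cases "n < 0")
        case True
        then show ?thesis using rel_add[of u v n "[]" "y # w"] Cons.prems \<open>good (y # w)\<close>
          by (simp add: loop_op_neg)
      next
        case False
        have "loop_op (u \<oplus> v) n (wd (y # w)) - loop_op u n (wd (y # w)) - loop_op v n (wd (y # w)) =
          loop_op (fst y) (snd y) (loop_op (u \<oplus> v) n (wd w) - loop_op u n (wd w) - loop_op v n (wd w)) +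
          (loop_op (\<lbrace>u, fst y\<rbrace> \<oplus> \<lbrace>v, fst y\<rbrace>) (n + snd y) (wd w) - loop_op \<lbrace>u, fst y\<rbrace> (n + snd y) (wd w)
            - loop_op \<lbrace>v, fst y\<rbrace> (n + snd y) (wd w))"
          unfolding wd_Cons[OF True] using False True Cons.prems
          by (simp add: loop_op_commute bracket_add_left loop_op_simps algebra_simps)
        then show ?thesis
          using Cons.IH[OF Cons.prems] True Cons.prems
          by (simp only:) (intro rel_closed prefix_word_rel Cons.IH bracket_closed; simp)
      qed
    qed
  qed
  have "plin (\<lambda>p. loop_op (u \<oplus> v) n p - loop_op u n p - loop_op v n p)"
    by (intro pm2.linear_compose_sub loop_op_lin)
  from plin_memI[OF this rel_subspace] * show ?thesis .
qed

lemma loop_op_smult_rel: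
  assumes "u \<in> carrier L"
  shows "loop_op (c \<odot> u) n p - c *c loop_op u n p \<in> rel"
proof -
  have *: "loop_op (c \<odot> u) n (wd w) - c *c loop_op u n (wd w) \<in> rel" for w
    using assms
  proof (induction w arbitrary: u n)
    case Nil
    then show ?case using rel_smult[of u n "[]" c "[]"]
      by (cases "n < 0") (simp_all add: loop_op_neg loop_op_vac rel_closed)
  next
    case (Cons y w)
    show ?case
    proof (cases "good (y # w)")
      case False
      then show ?thesis by (simp add: loop_op_bad rel_closed del: good_simps)
    next
      case True
      show ?thesis
      proof (cases "n < 0")
        case True
        then show ?thesis using rel_smult[of u n "[]" c "y # w"] Cons.prems \<open>good (y # w)\<close>
          by (simp add: loop_op_neg)
      next
        case False
        have "loop_op (c \<odot> u) n (wd (y # w)) - c *c loop_op u n (wd (y # w)) =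
          loop_op (fst y) (snd y) (loop_op (c \<odot> u) n (wd w) - c *c loop_op u n (wd w)) +
          (loop_op (c \<odot> \<lbrace>u, fst y\<rbrace>) (n + snd y) (wd w) - c *c loop_op \<lbrace>u, fst y\<rbrace> (n + snd y) (wd w))"
          unfolding wd_Cons[OF True] using False True Cons.prems
          by (simp add: loop_op_commute bracket_smult_left loop_op_simps algebra_simps)
        then show ?thesis
          using Cons.IH[OF Cons.prems] True Cons.prems
          by (simp only:) (intro rel_closed prefix_word_rel Cons.IH bracket_closed; simp)
      qed
    qed
  qed
  have "plin (\<lambda>p. loop_op (c \<odot> u) n p - c *c loop_op u n p)"
    by (intro pm2.linear_compose_sub pm2.linear_compose_scale_right loop_op_lin)
  from plin_memI[OF this rel_subspace] * show ?thesis .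
qed

text \<open>A relator for m < 0, the exact rule \<open>loop_op_commute\<close> otherwise.\<close>

lemma loop_op_commute_neg_rel:
  assumes "u \<in> carrier L" "v \<in> carrier L" "n < 0"
  shows "loop_op u m (loop_op v n p) - loop_op v n (loop_op u m p) - loop_op \<lbrace>u, v\<rbrace> (m + n) p \<in> rel"
proof (cases "m < 0")
  case False
  then show ?thesis using assms by (simp add: loop_op_commute rel_closed)
next
  case True
  have *: "loop_op u m (loop_op v n (wd w)) - loop_op v n (loop_op u m (wd w)) - loop_op \<lbrace>u, v\<rbrace> (m + n) (wd w) \<in> rel"
    for w
    using rel_commute[of u v m n "[]" w] True assms
    by (cases "good w") (simp_all add: loop_op_neg loop_op_bad loop_op_simps rel_closed)
  have "plin (\<lambda>p. loop_op u m (loop_op v n p) - loop_op v n (loop_op u m p) - loop_op \<lbrace>u, v\<rbrace> (m + n) p)"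
    by (intro pm2.linear_compose_sub plin_comp[OF loop_op_lin loop_op_lin] loop_op_lin)
  from plin_memI[OF this rel_subspace] * show ?thesis .
qed

lemma minus_one_smult: "x \<in> carrier L \<Longrightarrow> (- 1) \<odot> x = \<ominus> x"
proof -
  assume x: "x \<in> carrier L"
  have "(- 1) \<odot> x \<oplus> 1 \<odot> x = (- 1 + 1) \<odot> x"
    using smult_l_distr[of "- 1" 1 x] x by simp
  then have "(- 1) \<odot> x \<oplus> x = \<zero>"
    using smult_one[OF x] smult_l_null[OF x] by simp
  then show ?thesis using minus_equality[of "(- 1) \<odot> x" x] x by simp
qed

lemma bracket_anticomm:
  assumes "u \<in> carrier L" "v \<in> carrier L"
  shows "\<lbrace>v, u\<rbrace> = (- 1) \<odot> \<lbrace>u, v\<rbrace>"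
proof -
  have "\<lbrace>u \<oplus> v, u \<oplus> v\<rbrace> = (\<lbrace>u, u\<rbrace> \<oplus> \<lbrace>v, u\<rbrace>) \<oplus> (\<lbrace>u, v\<rbrace> \<oplus> \<lbrace>v, v\<rbrace>)"
    using assms by (simp add: bracket_add_left bracket_add_right)
  then have "\<lbrace>v, u\<rbrace> \<oplus> \<lbrace>u, v\<rbrace> = \<zero>"
    using assms by (simp add: bracket_alternating a_comm)
  then have "\<ominus> \<lbrace>u, v\<rbrace> = \<lbrace>v, u\<rbrace>"
    using assms by (intro minus_equality) simp_all
  then show ?thesis using assms by (simp add: minus_one_smult)
qed

lemma bracket_derivation:
  assumes "u \<in> carrier L" "v \<in> carrier L" "w \<in> carrier L"
  shows "\<lbrace>u, \<lbrace>v, w\<rbrace>\<rbrace> = \<lbrace>\<lbrace>u, v\<rbrace>, w\<rbrace> \<oplus> \<lbrace>v, \<lbrace>u, w\<rbrace>\<rbrace>"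
proof -
  have "\<lbrace>v, \<lbrace>w, u\<rbrace>\<rbrace> = \<ominus> \<lbrace>v, \<lbrace>u, w\<rbrace>\<rbrace>" "\<lbrace>w, \<lbrace>u, v\<rbrace>\<rbrace> = \<ominus> \<lbrace>\<lbrace>u, v\<rbrace>, w\<rbrace>"
    using assms
    by (simp_all add: bracket_anticomm[of u w] bracket_anticomm[of "\<lbrace>u, v\<rbrace>" w] bracket_smult_right
        flip: minus_one_smult)
  then have "\<lbrace>u, \<lbrace>v, w\<rbrace>\<rbrace> \<oplus> \<ominus> (\<lbrace>\<lbrace>u, v\<rbrace>, w\<rbrace> \<oplus> \<lbrace>v, \<lbrace>u, w\<rbrace>\<rbrace>) = \<zero>"
    using bracket_Jacobi[OF assms] assms by (simp add: minus_add a_ac)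
  then have "\<ominus> (\<ominus> (\<lbrace>\<lbrace>u, v\<rbrace>, w\<rbrace> \<oplus> \<lbrace>v, \<lbrace>u, w\<rbrace>\<rbrace>)) = \<lbrace>u, \<lbrace>v, w\<rbrace>\<rbrace>"
    using assms by (intro minus_equality) auto
  then show ?thesis
    using assms by (simp add: minus_minus)
qed

lemma loop_op_bracket_swap_rel:
  assumes "u \<in> carrier L" "v \<in> carrier L"
  shows "loop_op \<lbrace>u, v\<rbrace> n p + loop_op \<lbrace>v, u\<rbrace> n p \<in> rel"
  using loop_op_smult_rel[of "\<lbrace>u, v\<rbrace>" "- 1" n p] assms
  by (simp add: bracket_anticomm[of u v] add.commute)

lemma loop_op_Jacobi_rel:
  assumes "u \<in> carrier L" "v \<in> carrier L" "w \<in> carrier L"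
  shows "loop_op \<lbrace>u, \<lbrace>v, w\<rbrace>\<rbrace> n p - loop_op \<lbrace>\<lbrace>u, v\<rbrace>, w\<rbrace> n p - loop_op \<lbrace>v, \<lbrace>u, w\<rbrace>\<rbrace> n p \<in> rel"
  unfolding bracket_derivation[OF assms] by (rule loop_op_add_rel) (use assms in auto)

text \<open>A nonnegative mode moves past the left context of a relator by \<open>step\<close>.
  Where that context is empty, it turns the relator into combinations of congruences already
  established, with the Jacobi identity of \<open>L\<close> closing the commutator case.\<close>

lemma loop_op_rel:
  assumes "u \<in> carrier L" "p \<in> rel"
  shows "loop_op u n p \<in> rel"
proof (cases "n < 0")
  case True
  then show ?thesis using assms by (intro prefix_word_rel)
next
  case False
  \<comment> \<open>The bracket term carries the mode n + m: a letter if this is negative, an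
    instance of the hypothesis on \<open>q\<close> if not.\<close>
  have step: "(\<forall>u\<in>carrier L. \<forall>n\<ge>0. loop_op u n q \<in> rel) \<Longrightarrow> q \<in> rel \<Longrightarrow> v \<in> carrier L \<Longrightarrow> m < 0 \<Longrightarrow>
      (\<forall>u\<in>carrier L. \<forall>n\<ge>0. loop_op u n (loop_op v m q) \<in> rel)" for q v m
  proof (intro ballI allI impI)
    fix u and n :: int
    assume *: "\<forall>u\<in>carrier L. \<forall>n\<ge>0. loop_op u n q \<in> rel" "q \<in> rel" "v \<in> carrier L" "m < 0" "u \<in> carrier L" "0 \<le> n"
    have "loop_op \<lbrace>u, v\<rbrace> (n + m) q \<in> rel"
      using * by (cases "n + m < 0") (auto intro: prefix_word_rel)
    then show "loop_op u n (loop_op v m q) \<in> rel"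
      using * by (simp add: loop_op_commute rel_closed(1) prefix_word_rel)
  qed
  have A: "\<forall>u\<in>carrier L. \<forall>n\<ge>0. loop_op u n (add_relator w a b k w') \<in> rel"
    if "a \<in> carrier L" "b \<in> carrier L" "k < 0" "good w" "good w'" for w w' a b and k :: int
    using \<open>good w\<close>
  proof (induction w)
    case Nil
    show ?case
    proof (intro ballI allI impI)
      fix u and n :: int assume u: "u \<in> carrier L" "0 \<le> n"
      have "loop_op u n (add_relator [] a b k w') =
        (loop_op (a \<oplus> b) k (loop_op u n (wd w')) - loop_op a k (loop_op u n (wd w')) - loop_op b k (loop_op u n (wd w'))) +
        (loop_op (\<lbrace>u, a\<rbrace> \<oplus> \<lbrace>u, b\<rbrace>) (n + k) (wd w') - loop_op \<lbrace>u, a\<rbrace> (n + k) (wd w') - loop_op \<lbrace>u, b\<rbrace> (n + k) (wd w'))"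
        using that u by (simp add: wd_Cons loop_op_simps loop_op_commute bracket_add_right)
      also have "\<dots> \<in> rel"
        using that u by (intro rel_closed loop_op_add_rel) auto
      finally show "loop_op u n (add_relator [] a b k w') \<in> rel" .
    qed
  next
    case (Cons y w)
    then show ?case
      using step[OF Cons.IH rel_add, of "fst y" "snd y"] that
      by (simp add: wd_Cons[of y] loop_op_simps)
  qed
  have B: "\<forall>u\<in>carrier L. \<forall>n\<ge>0. loop_op u n (smult_relator w c a k w') \<in> rel"
    if "a \<in> carrier L" "k < 0" "good w" "good w'" for w w' a c and k :: int
    using \<open>good w\<close>
  proof (induction w)
    case Nil
    show ?case
    proof (intro ballI allI impI)
      fix u and n :: int assume u: "u \<in> carrier L" "0 \<le> n"
      have "loop_op u n (smult_relator [] c a k w') =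
        (loop_op (c \<odot> a) k (loop_op u n (wd w')) - c *c loop_op a k (loop_op u n (wd w'))) +
        (loop_op (c \<odot> \<lbrace>u, a\<rbrace>) (n + k) (wd w') - c *c loop_op \<lbrace>u, a\<rbrace> (n + k) (wd w'))"
        using that u by (simp add: wd_Cons loop_op_simps loop_op_commute bracket_smult_right pm.scale_right_distrib)
      also have "\<dots> \<in> rel"
        using that u by (intro rel_closed(1) loop_op_smult_rel) auto
      finally show "loop_op u n (smult_relator [] c a k w') \<in> rel" .
    qed
  next
    case (Cons y w)
    then show ?case
      using step[OF Cons.IH rel_smult, of "fst y" "snd y"] that
      by (simp add: wd_Cons[of y] loop_op_simps)
  qed
  have C: "\<forall>u\<in>carrier L. \<forall>n\<ge>0. loop_op u n (comm_relator w a k b l w') \<in> rel"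
    if "a \<in> carrier L" "b \<in> carrier L" "k < 0" "l < 0" "good w" "good w'" for w w' a b and k l :: int
    using \<open>good w\<close>
  proof (induction w)
    case Nil
    show ?case
    proof (intro ballI allI impI)
      fix u and n :: int assume u: "u \<in> carrier L" "0 \<le> n"
      let ?X = "wd w'"
      let ?C = "\<lambda>a k b l X. loop_op a k (loop_op b l X) - loop_op b l (loop_op a k X) - loop_op \<lbrace>a, b\<rbrace> (k + l) X"
      \<comment> \<open>The mode acts as a derivation on the entries of the commutator. In the third
        \<open>?C\<close> they are exchanged, so that the exponent known to be negative stands
        second as \<open>loop_op_commute_neg_rel\<close> requires; the last line undoes the exchange
        by antisymmetry.\<close>
      have "loop_op u n (comm_relator [] a k b l w') =
        ?C a k b l (loop_op u n ?X) + ?C \<lbrace>u, a\<rbrace> (n + k) b l ?X - ?C \<lbrace>u, b\<rbrace> (n + l) a k ?X -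
        (loop_op \<lbrace>u, \<lbrace>a, b\<rbrace>\<rbrace> (n + k + l) ?X - loop_op \<lbrace>\<lbrace>u, a\<rbrace>, b\<rbrace> (n + k + l) ?X - loop_op \<lbrace>a, \<lbrace>u, b\<rbrace>\<rbrace> (n + k + l) ?X) -
        (loop_op \<lbrace>a, \<lbrace>u, b\<rbrace>\<rbrace> (n + k + l) ?X + loop_op \<lbrace>\<lbrace>u, b\<rbrace>, a\<rbrace> (n + k + l) ?X)"
        using that u by (simp add: wd_Cons loop_op_simps loop_op_commute algebra_simps)
      also have "\<dots> \<in> rel"
        using that u by (intro rel_closed(1,2) loop_op_commute_neg_rel loop_op_Jacobi_rel loop_op_bracket_swap_rel) auto
      finally show "loop_op u n (comm_relator [] a k b l w') \<in> rel" .
    qed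
  next
    case (Cons y w)
    then show ?case
      using step[OF Cons.IH rel_commute, of "fst y" "snd y"] that
      by (simp add: wd_Cons[of y] loop_op_simps)
  qed
  show ?thesis
    by (rule plin_rel[OF loop_op_lin _ _ _ _ rel_subspace assms(2)])
      (use assms(1) False in \<open>simp_all add: A B C loop_op_bad rel_closed\<close>)
qed

text \<open>For n >= 0 the roles of u and v are exchanged, at the cost of antisymmetry of the
  bracket.\<close>

lemma loop_op_commute_mixed_rel:
  assumes "u \<in> carrier L" "v \<in> carrier L" "m < 0 \<or> n < 0"
  shows "loop_op u m (loop_op v n p) - loop_op v n (loop_op u m p) - loop_op \<lbrace>u, v\<rbrace> (m + n) p \<in> rel"
proof (cases "n < 0")
  case True
  then show ?thesis using assms by (intro loop_op_commute_neg_rel)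
next
  case False
  have "- (loop_op v n (loop_op u m p) - loop_op u m (loop_op v n p) - loop_op \<lbrace>v, u\<rbrace> (n + m) p)
      - (loop_op \<lbrace>u, v\<rbrace> (n + m) p + loop_op \<lbrace>v, u\<rbrace> (n + m) p) \<in> rel"
    using assms False by (intro rel_closed(2,4) loop_op_commute_neg_rel loop_op_bracket_swap_rel) auto
  then show ?thesis by (simp add: algebra_simps)
qed

text \<open>What is new is the case of two nonnegative modes: both are commuted past the first
  letter, and the vacuum kills them in the end. Indices may become negative on the way, so the
  induction runs over all m and n; \<open>loop_op_rel\<close> keeps the congruence intact under the
  letter left in front.\<close>

lemma loop_op_commute_rel:
  assumes "u \<in> carrier L" "v \<in> carrier L"
  shows "loop_op u m (loop_op v n p) - loop_op v n (loop_op u m p) - loop_op \<lbrace>u, v\<rbrace> (m + n) p \<in> rel"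
proof -
  let ?C = "\<lambda>u m v n p. loop_op u m (loop_op v n p) - loop_op v n (loop_op u m p) - loop_op \<lbrace>u, v\<rbrace> (m + n) p"
  have *: "?C u m v n (wd w) \<in> rel" for w
    using assms
  proof (induction w arbitrary: u v m n)
    case Nil
    then show ?case
      by (cases "m < 0 \<or> n < 0") (auto simp: loop_op_commute_mixed_rel loop_op_vac loop_op_simps rel_closed)
  next
    case (Cons y w)
    show ?case
    proof (cases "m < 0 \<or> n < 0 \<or> \<not> good (y # w)")
      case True
      then show ?thesis
        using Cons.prems by (auto simp: loop_op_commute_mixed_rel loop_op_bad loop_op_simps rel_closed)
    next
      case False
      obtain z k where y: "y = (z, k)" by fastforce
      let ?X = "wd w"
      have "?C u m v n (wd (y # w)) = loop_op z k (?C u m v n ?X) + ?C u m \<lbrace>v, z\<rbrace> (n + k) ?X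
          - ?C v n \<lbrace>u, z\<rbrace> (m + k) ?X
          + (loop_op \<lbrace>u, \<lbrace>v, z\<rbrace>\<rbrace> (m + n + k) ?X - loop_op \<lbrace>\<lbrace>u, v\<rbrace>, z\<rbrace> (m + n + k) ?X
             - loop_op \<lbrace>v, \<lbrace>u, z\<rbrace>\<rbrace> (m + n + k) ?X)"
        using False Cons.prems
        by (simp add: wd_Cons y loop_op_simps loop_op_commute algebra_simps)
      also have "\<dots> \<in> rel"
        using False Cons.prems y
        by (intro rel_closed(1,2) loop_op_rel[of z] loop_op_Jacobi_rel Cons.IH[OF _ bracket_closed] Cons.IH) auto
      finally show ?thesis .
    qed
  qed
  have "plin (?C u m v n)"
    by (intro pm2.linear_compose_sub plin_comp[OF loop_op_lin loop_op_lin] loop_op_lin)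
  from plin_memI[OF this rel_subspace] * show ?thesis .
qed

text \<open>A mode moving down a word collects the negative exponents of some letters. If n is at
  least the total depth, every mode arriving at the vacuum is still nonnegative, whatever label the
  brackets have produced.\<close>

lemma loop_op_truncation: "\<exists>N. \<forall>n\<ge>N. \<forall>u. loop_op u n p = 0"
proof -
  have word: "n \<ge> 0 \<Longrightarrow> n + (\<Sum>y\<leftarrow>w. snd y) \<ge> 0 \<Longrightarrow> good w \<Longrightarrow> loop_op u n (wd w) = 0" for n u w
  proof (induction w arbitrary: u n)
    case Nil
    then show ?case by (simp add: loop_op_vac)
  next
    case (Cons y w)
    have neg: "(\<Sum>y\<leftarrow>w. snd y) \<le> 0"
      using Cons.prems by (intro sum_list_nonpos) (auto simp: good_def)
    then have "loop_op u n (wd w) = 0" "loop_op \<lbrace>u, fst y\<rbrace> (n + snd y) (wd w) = 0"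
      using Cons.prems by (auto intro!: Cons.IH)
    then show ?case
      using Cons.prems by (simp add: wd_Cons loop_op_commute loop_op_simps)
  qed
  have "\<exists>N. \<forall>n\<ge>N. \<forall>u. loop_op u n (wd w) = 0" for w
  proof (cases "good w")
    case True
    then show ?thesis
      by (intro exI[of _ "max 0 (- (\<Sum>y\<leftarrow>w. snd y))"]) (auto intro!: word)
  qed (simp add: loop_op_bad)
  then obtain N where N: "\<And>w n u. n \<ge> N w \<Longrightarrow> loop_op u n (wd w) = 0" by metis
  show ?thesis
  proof (intro exI[of _ "Max (insert 0 (N ` Poly_Mapping.keys p))"] allI impI)
    fix n u assume "Max (insert 0 (N ` Poly_Mapping.keys p)) \<le> n"
    then have "n \<ge> N w" if "w \<in> Poly_Mapping.keys p" for w using that by simp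
    then show "loop_op u n p = 0"
      using plin_memI[OF loop_op_lin pm.subspace_single_0, of p u n] N by simp
  qed
qed

section \<open>The translation operator: the derivation extending -d/dt and killing the
  vacuum\<close>

primrec deriv_word :: "('a \<times> int) list \<Rightarrow> 'a words"
  where
    "deriv_word [] = 0"
  | "deriv_word (y # w) = loop_op (fst y) (snd y) (deriv_word w)
      - of_int (snd y) *c loop_op (fst y) (snd y - 1) (wd w)"

definition translation :: "'a words \<Rightarrow> 'a words"
  where "translation = lift (\<lambda>w. if good w then deriv_word w else 0)"

lemma translation_lin: "plin translation"
  by (simp add: translation_def lift_lin)

lemmas translation_simps = pm2.linear_add[OF translation_lin] pm2.linear_scale[OF translation_lin]
  pm2.linear_0[OF translation_lin] pm2.linear_diff[OF translation_lin]

lemma translation_bad: "\<not> good w \<Longrightarrow> translation (wd w) = 0"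
  by (simp add: translation_def)

lemma translation_vac: "translation (wd []) = 0"
  by (simp add: translation_def)

lemma translation_prefix:
  assumes "u \<in> carrier L" "n < 0"
  shows "translation (loop_op u n p) = loop_op u n (translation p) - of_int n *c loop_op u (n - 1) p"
proof -
  have lin: "plin (\<lambda>p. translation (loop_op u n p))"
    "plin (\<lambda>p. loop_op u n (translation p) - of_int n *c loop_op u (n - 1) p)"
    by (intro plin_comp[OF translation_lin loop_op_lin] plin_comp[OF loop_op_lin translation_lin]
        pm2.linear_compose_sub pm2.linear_compose_scale_right loop_op_lin)+
  have "translation (loop_op u n (wd w)) = loop_op u n (translation (wd w)) - of_int n *c loop_op u (n - 1) (wd w)"
    for w
    using assms by (cases "good w")
      (simp add: loop_op_neg translation_def, simp add: loop_op_bad translation_bad loop_op_simps translation_simps)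
  then show ?thesis by (rule plin_eqI[OF lin])
qed

text \<open>Negative modes satisfy this by definition of \<open>deriv_word\<close>; nonnegative ones
  inherit it by being commuted towards the vacuum.\<close>

lemma translation_loop_op:
  assumes "u \<in> carrier L"
  shows "translation (loop_op u n p) = loop_op u n (translation p) - of_int n *c loop_op u (n - 1) p"
proof -
  have lin: "plin (\<lambda>p. translation (loop_op u n p))"
    "plin (\<lambda>p. loop_op u n (translation p) - of_int n *c loop_op u (n - 1) p)"
    by (intro plin_comp[OF translation_lin loop_op_lin] plin_comp[OF loop_op_lin translation_lin]
        pm2.linear_compose_sub pm2.linear_compose_scale_right loop_op_lin)+
  have "translation (loop_op u n (wd w)) = loop_op u n (translation (wd w)) - of_int n *c loop_op u (n - 1) (wd w)"
    for w
    using assms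
  proof (induction w arbitrary: u n)
    case Nil
    then show ?case
      by (cases "n < 0"; cases "n = 0")
        (simp_all add: translation_prefix loop_op_vac translation_vac translation_simps loop_op_simps)
  next
    case (Cons y w)
    show ?case
    proof (cases "n < 0 \<or> \<not> good (y # w)")
      case True
      then show ?thesis using Cons.prems
        by (auto simp: translation_prefix loop_op_bad translation_bad loop_op_simps translation_simps)
    next
      case False
      obtain z k where y: "y = (z, k)" by fastforce
      have n1: "of_int n *c loop_op u (n - 1) (loop_op z k (wd w))
         = of_int n *c (loop_op z k (loop_op u (n - 1) (wd w)) + loop_op \<lbrace>u, z\<rbrace> (n - 1 + k) (wd w))"
        using False y by (cases "n = 0") (simp_all add: loop_op_commute)
      have n2: "loop_op u n (loop_op z (k - 1) (wd w))
         = loop_op z (k - 1) (loop_op u n (wd w)) + loop_op \<lbrace>u, z\<rbrace> (n + k - 1) (wd w)"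
        using False y by (subst loop_op_commute) (simp_all add: algebra_simps)
      have "translation (loop_op u n (wd (y # w))) = translation (loop_op z k (loop_op u n (wd w)))
          + translation (loop_op \<lbrace>u, z\<rbrace> (n + k) (wd w))"
        using False y Cons.prems by (simp add: wd_Cons loop_op_commute translation_simps)
      also have "\<dots> = loop_op z k (loop_op u n (translation (wd w)) - of_int n *c loop_op u (n - 1) (wd w))
          - of_int k *c loop_op z (k - 1) (loop_op u n (wd w))
          + (loop_op \<lbrace>u, z\<rbrace> (n + k) (translation (wd w)) - of_int (n + k) *c loop_op \<lbrace>u, z\<rbrace> (n + k - 1) (wd w))"
        using False y Cons.prems by (simp add: translation_prefix Cons.IH)
      also have "\<dots> = loop_op u n (translation (wd (y # w))) - of_int n *c loop_op u (n - 1) (wd (y # w))"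
        using False y Cons.prems n1
        by (simp add: wd_Cons translation_prefix loop_op_simps n2 loop_op_commute[of n k] algebra_simps)
      finally show ?thesis .
    qed
  qed
  then show ?thesis by (rule plin_eqI[OF lin])
qed

text \<open>The scheme of \<open>loop_op_rel\<close> again: -d/dt is a derivation of the loop
  algebra and so carries relators into the span of relators.\<close>

lemma translation_rel:
  assumes "p \<in> rel"
  shows "translation p \<in> rel"
proof -
  have step: "translation q \<in> rel \<Longrightarrow> q \<in> rel \<Longrightarrow> v \<in> carrier L \<Longrightarrow> m < 0 \<Longrightarrow> translation (loop_op v m q) \<in> rel"
    for q v m
    by (simp add: translation_prefix rel_closed loop_op_rel)
  have A: "translation (add_relator w a b k w') \<in> rel"
    if "a \<in> carrier L" "b \<in> carrier L" "k < 0" "good w" "good w'" for w w' a b and k :: int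
    using \<open>good w\<close>
  proof (induction w)
    case Nil
    have "translation (add_relator [] a b k w') =
        (loop_op (a \<oplus> b) k (translation (wd w')) - loop_op a k (translation (wd w')) - loop_op b k (translation (wd w'))) -
        of_int k *c (loop_op (a \<oplus> b) (k - 1) (wd w') - loop_op a (k - 1) (wd w') - loop_op b (k - 1) (wd w'))"
      using that by (simp add: wd_Cons translation_simps translation_prefix pm.scale_right_diff_distrib)
    also have "\<dots> \<in> rel"
      using that by (intro rel_closed loop_op_add_rel)
    finally show ?case .
  next
    case (Cons y w)
    then show ?case
      using step[OF Cons.IH rel_add, of "fst y" "snd y"] that
      by (simp add: wd_Cons[of y] loop_op_simps)
  qed
  have B: "translation (smult_relator w c a k w') \<in> rel"
    if "a \<in> carrier L" "k < 0" "good w" "good w'" for w w' a c and k :: int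
    using \<open>good w\<close>
  proof (induction w)
    case Nil
    have "translation (smult_relator [] c a k w') =
        (loop_op (c \<odot> a) k (translation (wd w')) - c *c loop_op a k (translation (wd w'))) -
        of_int k *c (loop_op (c \<odot> a) (k - 1) (wd w') - c *c loop_op a (k - 1) (wd w'))"
      using that by (simp add: wd_Cons translation_simps translation_prefix pm.scale_right_diff_distrib mult.commute)
    also have "\<dots> \<in> rel"
      using that by (intro rel_closed(2,3) loop_op_smult_rel)
    finally show ?case .
  next
    case (Cons y w)
    then show ?case
      using step[OF Cons.IH rel_smult, of "fst y" "snd y"] that
      by (simp add: wd_Cons[of y] loop_op_simps)
  qed
  have C: "translation (comm_relator w a k b l w') \<in> rel"
    if "a \<in> carrier L" "b \<in> carrier L" "k < 0" "l < 0" "good w" "good w'" for w w' a b and k l :: int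
    using \<open>good w\<close>
  proof (induction w)
    case Nil
    let ?C = "\<lambda>k l X. loop_op a k (loop_op b l X) - loop_op b l (loop_op a k X) - loop_op \<lbrace>a, b\<rbrace> (k + l) X"
    have "translation (comm_relator [] a k b l w') =
        ?C k l (translation (wd w')) - of_int k *c ?C (k - 1) l (wd w') - of_int l *c ?C k (l - 1) (wd w')"
      using that by (simp add: wd_Cons translation_simps translation_prefix loop_op_simps algebra_simps)
    also have "\<dots> \<in> rel"
      using that by (intro rel_closed(2,3) loop_op_commute_rel)
    finally show ?case .
  next
    case (Cons y w)
    then show ?case
      using step[OF Cons.IH rel_commute, of "fst y" "snd y"] that
      by (simp add: wd_Cons[of y] loop_op_simps)
  qed
  show ?thesis
    by (rule plin_rel[OF translation_lin A B C _ rel_subspace assms]) (simp_all add: translation_bad rel_closed)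
qed

section \<open>The quotient, realised on a complement of the relations\<close>

definition proj :: "'a words \<Rightarrow> 'a words"
  where "proj = (SOME f. plin f \<and> (\<forall>x\<in>rel. f x = 0) \<and> (\<forall>x. x - f x \<in> rel))"

lemma proj: "plin proj \<and> (\<forall>x\<in>rel. proj x = 0) \<and> (\<forall>x. x - proj x \<in> rel)"
proof -
  obtain f where "plin f" "\<And>x. x \<in> rel \<Longrightarrow> f x = 0" "\<And>x. x - f x \<in> rel"
    using pm_projection[OF rel_subspace] by blast
  then have "\<exists>f. plin f \<and> (\<forall>x\<in>rel. f x = 0) \<and> (\<forall>x. x - f x \<in> rel)" by blast
  then show ?thesis unfolding proj_def by (rule someI_ex)
qed

lemma proj_lin: "plin proj" and proj_rel: "x \<in> rel \<Longrightarrow> proj x = 0" and proj_diff: "x - proj x \<in> rel"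
  using proj by blast+

lemmas proj_simps = pm2.linear_add[OF proj_lin] pm2.linear_scale[OF proj_lin]
  pm2.linear_0[OF proj_lin] pm2.linear_diff[OF proj_lin]

lemma proj_eqI: "x - y \<in> rel \<Longrightarrow> proj x = proj y"
  using proj_rel[of "x - y"] by (simp add: proj_simps)

lemma proj_idem: "proj (proj x) = proj x"
  by (rule proj_eqI) (use rel_closed(4)[OF proj_diff[of x]] in simp)

text \<open>This is how an operator preserving \<open>rel\<close> descends to the quotient.\<close>

lemma proj_commute:
  assumes "plin f" "\<And>x. x \<in> rel \<Longrightarrow> f x \<in> rel"
  shows "proj (f (proj x)) = proj (f x)"
proof (rule proj_eqI)
  have "f (proj x - x) \<in> rel"
    using rel_closed(4)[OF proj_diff[of x]] by (intro assms(2)) simp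
  then show "f (proj x) - f x \<in> rel" by (simp add: pm2.linear_diff[OF assms(1)])
qed

definition mode :: "'a \<Rightarrow> int \<Rightarrow> 'a words \<Rightarrow> 'a words"
  where "mode u n p = proj (loop_op u n p)"

lemma mode_proj:
  assumes "u \<in> carrier L"
  shows "mode u n (proj p) = mode u n p" "proj (mode u n p) = mode u n p"
  using proj_commute[OF loop_op_lin loop_op_rel[OF assms]] by (simp_all add: mode_def proj_idem)

lemma mode_commute:
  assumes "u \<in> carrier L" "v \<in> carrier L"
  shows "mode u m (mode v n p) - mode v n (mode u m p) = mode \<lbrace>u, v\<rbrace> (m + n) p"
proof -
  have "proj (loop_op u m (loop_op v n p) - loop_op v n (loop_op u m p) - loop_op \<lbrace>u, v\<rbrace> (m + n) p) = 0"
    by (intro proj_rel loop_op_commute_rel assms)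
  moreover have "mode u m (mode v n p) = proj (loop_op u m (loop_op v n p))"
    "mode v n (mode u m p) = proj (loop_op v n (loop_op u m p))"
    using assms mode_proj(1) by (simp_all only: mode_def)
  ultimately show ?thesis by (simp add: mode_def proj_simps)
qed

lemma mode_vfield: "pm.vfield (mode u)"
  unfolding pm.vfield_def mode_def
proof (intro conjI allI)
  show "plin (\<lambda>p. proj (loop_op u n p))" for n by (rule plin_comp[OF proj_lin loop_op_lin])
  show "\<exists>N. \<forall>n\<ge>N. proj (loop_op u n p) = 0" for p
    using loop_op_truncation[of p] proj_simps(3) by metis
qed

text \<open>The commutator of the modes m and n depends on m + n only, so one factor x1 - x2
  annihilates it. The order 1 is written \<open>0 + 1\<close> to match the recursion.\<close>

lemma mode_local:
  assumes "u \<in> carrier L" "v \<in> carrier L"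
  shows "pm.local_pair (mode u) (mode v)"
proof (rule pm.local_pairI[OF mode_vfield mode_vfield])
  show "pm.jacobi_lhs (mode u) (mode v) (0 + 1) m n p = 0" for m n p
    unfolding pm.jacobi_lhs_rec[OF mode_vfield mode_vfield] pm.jacobi_lhs_0
    using assms by (simp add: mode_commute algebra_simps)
qed

sublocale va: vertex_generators pm_scale proj "\<lambda>p. proj (translation p)" "proj (wd [])" "mode ` carrier L"
proof (intro vertex_generators.intro vertex_generators_axioms.intro)
  show "complex_vector_space pm_scale" by (rule pm.complex_vector_space_axioms)
  have proj_translation: "proj (translation (proj p)) = proj (translation p)" for p
    by (rule proj_commute[OF translation_lin translation_rel])
  show "plin proj" by (rule proj_lin)
  show "proj (proj v) = proj v" for v by (rule proj_idem)
  show "proj (proj (wd [])) = proj (wd [])" by (rule proj_idem)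
  show "plin (\<lambda>p. proj (translation p))" by (rule plin_comp[OF proj_lin translation_lin])
  show "proj (translation (proj v)) = proj (proj (translation v))" for v
    by (simp add: proj_translation proj_idem)
  show "proj (translation (proj (wd []))) = 0"
    by (simp add: proj_translation translation_vac proj_simps)
  fix a assume "a \<in> mode ` carrier L"
  then obtain u where a: "a = mode u" "u \<in> carrier L" by blast
  show "pm.vfield a" by (simp add: a mode_vfield)
  show "proj (a n v) = a n v" "a n (proj v) = a n v" for n v by (simp_all add: a mode_proj)
  show "proj (translation (a n v)) = a n (proj (translation v)) - of_int n *c a (n - 1) v" for n v
    using mode_proj(1)[OF a(2)]
    by (simp add: a mode_def proj_translation translation_loop_op proj_simps)
  show "a n (proj (wd [])) = 0" if "0 \<le> n" for n
    using that a(2) by (simp add: a(1) mode_proj) (simp add: mode_def loop_op_vac proj_simps)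
  show "pm.local_pair a b" if "b \<in> mode ` carrier L" for b
    using that a by (auto intro: mode_local)
next
  fix W v assume W: "pm.subspace W" "proj (wd []) \<in> W" "\<And>a n w. a \<in> mode ` carrier L \<Longrightarrow> w \<in> W \<Longrightarrow> a n w \<in> W"
  \<comment> \<open>A good word arises from the vacuum by applying the modes of its letters from
    right to left.\<close>
  have *: "proj (wd w) \<in> W" for w
  proof (induction w)
    case (Cons x w)
    show ?case
    proof (cases "good (x # w)")
      case True
      then have "proj (wd (x # w)) = mode (fst x) (snd x) (proj (wd w))"
        by (simp add: wd_Cons mode_proj mode_def[symmetric])
      then show ?thesis using W(3)[OF _ Cons] True by auto
    next
      case False
      then show ?thesis using pm.subspace_0[OF W(1)] by (simp add: proj_rel[OF rel_bad[OF False]])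
    qed
  qed (rule W)
  show "proj v \<in> W" by (rule plin_memI[OF proj_lin W(1) *])
qed

end

section \<open>The polynomial algebra and its bracket\<close>

lemma pm_scale_single [simp]: "c *c Poly_Mapping.single k d = Poly_Mapping.single k (c * d)"
  by (rule poly_mapping_eqI) (simp add: lookup_single when_def)

lemma pconst_mult: "pconst c * p = c *c (p :: 'a polynomial)"
  by (simp add: pconst_def pm_scale_def mult_map_scale_conv_mult)

lemma mult_pm_scale: "(c *c p) * q = c *c (p * q)" "p * (c *c q) = c *c (p * q)"
  for p q :: "'a polynomial"
  by (simp_all add: mult.left_commute mult.assoc flip: pconst_mult)

lemma plin_mult: "plin (\<lambda>p. q * p)" "plin (\<lambda>p. p * q)" for q :: "'a polynomial"
  by (rule pm.linI; simp add: algebra_simps mult_pm_scale)+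

lemma wd_mult: "wd m * wd m' = (wd (m + m') :: 'a polynomial)"
  by (simp add: mult_single)

lemma one_eq_wd: "(1 :: 'a polynomial) = wd 0"
  by simp

lemma pvar_eq_wd: "pvar a = wd (Poly_Mapping.single a 1)"
  by (simp add: pvar_def)

definition polys :: "'a set \<Rightarrow> 'a polynomial set"
  where "polys X = {p. pvars p \<subseteq> X}"

lemma polys_iff: "p \<in> polys X \<longleftrightarrow> (\<forall>m\<in>Poly_Mapping.keys p. Poly_Mapping.keys m \<subseteq> X)"
  by (auto simp: polys_def pvars_def)

lemma polys_subspace: "pm.subspace (polys X)"
proof (rule pm.subspaceI)
  show "0 \<in> polys X" by (simp add: polys_iff)
  show "p + q \<in> polys X" if "p \<in> polys X" "q \<in> polys X" for p q
    using that keys_add[of p q] unfolding polys_iff by blast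
  show "c *c p \<in> polys X" if "p \<in> polys X" for c p
    using that unfolding polys_iff by (simp add: in_keys_iff)
qed

lemmas polys_closed = pm.subspace_add[OF polys_subspace] pm.subspace_diff[OF polys_subspace]
  pm.subspace_scale[OF polys_subspace] pm.subspace_neg[OF polys_subspace] pm.subspace_0[OF polys_subspace]

lemma polys_mult: "p \<in> polys X \<Longrightarrow> q \<in> polys X \<Longrightarrow> p * q \<in> polys X"
  unfolding polys_iff
proof (intro ballI)
  fix m assume *: "\<forall>m\<in>Poly_Mapping.keys p. Poly_Mapping.keys m \<subseteq> X" "\<forall>m\<in>Poly_Mapping.keys q. Poly_Mapping.keys m \<subseteq> X"
    and "m \<in> Poly_Mapping.keys (p * q)"
  then obtain a b where "a \<in> Poly_Mapping.keys p" "b \<in> Poly_Mapping.keys q" "m = a + b"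
    using keys_mult[of p q] by blast
  then show "Poly_Mapping.keys m \<subseteq> X"
    using * keys_add[of a b] by blast
qed

lemma polys_wd: "wd m \<in> polys X \<longleftrightarrow> Poly_Mapping.keys m \<subseteq> X"
  by (simp add: polys_iff)

lemma polys_one: "1 \<in> polys X"
  unfolding one_eq_wd polys_wd by simp

lemma polys_pvar: "pvar a \<in> polys X \<longleftrightarrow> a \<in> X"
  by (simp add: pvar_eq_wd polys_wd)

lemma polys_pconst: "pconst c \<in> polys X"
  by (simp add: polys_iff pconst_def)

lemma poly_algebra_simps [simp]:
  "carrier (poly_algebra X) = polys X" "p \<otimes>\<^bsub>poly_algebra X\<^esub> q = p * q"
  "p \<oplus>\<^bsub>poly_algebra X\<^esub> q = p + q" "\<one>\<^bsub>poly_algebra X\<^esub> = 1" "\<zero>\<^bsub>poly_algebra X\<^esub> = 0"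
  "c \<odot>\<^bsub>poly_algebra X\<^esub> p = c *c p"
  by (simp_all add: poly_algebra_def polys_def pconst_mult)

lemma cring_poly_algebra: "cring (poly_algebra X)"
proof (rule cringI)
  show "abelian_group (poly_algebra X)"
  proof (rule abelian_groupI)
    show "\<exists>q\<in>carrier (poly_algebra X). q \<oplus>\<^bsub>poly_algebra X\<^esub> p = \<zero>\<^bsub>poly_algebra X\<^esub>"
      if "p \<in> carrier (poly_algebra X)" for p
      using that by (intro bexI[of _ "- p"]) (simp_all add: polys_closed)
  qed (simp_all add: polys_closed algebra_simps)
  show "Group.comm_monoid (poly_algebra X)"
    by (rule comm_monoidI) (simp_all add: polys_mult polys_one algebra_simps)
qed (simp add: algebra_simps)

lemma a_inv_poly_algebra: "p \<in> polys X \<Longrightarrow> \<ominus>\<^bsub>poly_algebra X\<^esub> p = - p"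
proof -
  interpret cring "poly_algebra X" by (rule cring_poly_algebra)
  show "p \<in> polys X \<Longrightarrow> \<ominus>\<^bsub>poly_algebra X\<^esub> p = - p"
    by (rule minus_equality) (simp_all add: polys_closed)
qed

lemma algebra_poly_algebra: "algebra complex_ring (poly_algebra X)"
proof (rule algebraI)
  show "cring complex_ring" by (rule cring_complex_ring)
  show "cring (poly_algebra X)" by (rule cring_poly_algebra)
qed (simp_all add: polys_closed algebra_simps mult_pm_scale)

lemma partial_deriv_eq_lift:
  "partial_deriv a = lift (\<lambda>m. of_nat (Poly_Mapping.lookup m a) *c wd (m - Poly_Mapping.single a 1))"
  by (simp add: fun_eq_iff partial_deriv_def lift_def mult.commute)

lemma partial_deriv_lin: "plin (partial_deriv a)"
  by (simp add: partial_deriv_eq_lift lift_lin)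

lemmas partial_deriv_simps = pm2.linear_add[OF partial_deriv_lin] pm2.linear_scale[OF partial_deriv_lin]
  pm2.linear_0[OF partial_deriv_lin]

lemma partial_deriv_wd:
  "partial_deriv a (wd m) = of_nat (Poly_Mapping.lookup m a) *c wd (m - Poly_Mapping.single a 1)"
  by (simp add: partial_deriv_eq_lift del: pm_scale_single)

lemma minus_single_add:
  fixes m m' :: "'a \<Rightarrow>\<^sub>0 nat"
  assumes "Poly_Mapping.lookup m a > 0"
  shows "m - Poly_Mapping.single a 1 + m' = m + m' - Poly_Mapping.single a 1"
  by (rule poly_mapping_eqI) (use assms in \<open>auto simp: lookup_add lookup_minus lookup_single when_def\<close>)

lemma partial_deriv_mult_wd:
  "partial_deriv a (wd m * wd m') = partial_deriv a (wd m) * wd m' + wd m * partial_deriv a (wd m')"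
proof -
  \<comment> \<open>If the exponent of \<open>a\<close> in \<open>m\<close> is 0, truncated
    subtraction would spoil the exponent, but the coefficient is then 0 on both sides.\<close>
  have 1: "partial_deriv a (wd m) * wd m' = of_nat (Poly_Mapping.lookup m a) *c wd (m + m' - Poly_Mapping.single a 1)" for m m'
    by (cases "Poly_Mapping.lookup m a = 0")
      (simp_all add: partial_deriv_wd mult_pm_scale wd_mult minus_single_add del: pm_scale_single One_nat_def)
  show ?thesis
    using 1[of m m'] 1[of m' m] unfolding wd_mult mult.commute[of "wd m" "partial_deriv a (wd m')"]
    by (simp add: partial_deriv_wd lookup_add pm.scale_left_distrib add.commute del: pm_scale_single)
qed

lemma partial_deriv_mult: "partial_deriv a (p * q) = partial_deriv a p * q + p * partial_deriv a q"
proof -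
  have 1: "partial_deriv a (wd m * q) = partial_deriv a (wd m) * q + wd m * partial_deriv a q" for m
  proof (rule plin_eqI[where p = q])
    show "plin (\<lambda>q. partial_deriv a (wd m * q))"
      by (rule plin_comp[OF partial_deriv_lin plin_mult(1)])
    show "plin (\<lambda>q. partial_deriv a (wd m) * q + wd m * partial_deriv a q)"
      by (intro pm2.linear_compose_add plin_mult(1) plin_comp[OF plin_mult(1) partial_deriv_lin])
  qed (rule partial_deriv_mult_wd)
  show ?thesis
  proof (rule plin_eqI[where p = p])
    show "plin (\<lambda>p. partial_deriv a (p * q))"
      by (rule plin_comp[OF partial_deriv_lin plin_mult(2)])
    show "plin (\<lambda>p. partial_deriv a p * q + p * partial_deriv a q)"
      by (intro pm2.linear_compose_add plin_mult(2) plin_comp[OF plin_mult(2) partial_deriv_lin])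
  qed (rule 1)
qed

lemma finite_pvars [simp]: "finite (pvars p)"
  by (simp add: pvars_def)

lemma partial_deriv_eq_0: "a \<notin> pvars p \<Longrightarrow> partial_deriv a p = 0"
  unfolding partial_deriv_def by (rule sum.neutral) (auto simp: pvars_def in_keys_iff)

lemma partial_deriv_polys:
  assumes "p \<in> polys X"
  shows "partial_deriv a p \<in> polys X"
proof (rule plin_memI[OF partial_deriv_lin polys_subspace])
  fix m assume "m \<in> Poly_Mapping.keys p"
  then have "Poly_Mapping.keys m \<subseteq> X" using assms by (auto simp: polys_iff)
  moreover have "Poly_Mapping.keys (m - Poly_Mapping.single a 1) \<subseteq> Poly_Mapping.keys m"
    by (auto simp: in_keys_iff lookup_minus)
  ultimately have "wd (m - Poly_Mapping.single a 1) \<in> polys X" by (auto simp: polys_wd)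
  then show "partial_deriv a (wd m) \<in> polys X"
    unfolding partial_deriv_wd by (rule polys_closed)
qed

lemma partial_deriv_pvar: "partial_deriv a (pvar b) = (if a = b then 1 else 0)"
  by (simp add: pvar_eq_wd partial_deriv_wd lookup_single)

text \<open>The index sets of the defining sum depend on the arguments. Enlarging them to a common
  set is what allows brackets of different polynomials to be added.\<close>

lemma poly_bracket_superset:
  assumes "finite A" "finite B" "pvars p \<subseteq> A" "pvars q \<subseteq> B"
  shows "poly_bracket L p q = (\<Sum>a\<in>A. \<Sum>b\<in>B. partial_deriv a p * partial_deriv b q * pvar \<lbrace>a, b\<rbrace>\<^bsub>L\<^esub>)"
proof -
  have "(\<Sum>a\<in>A. \<Sum>b\<in>B. partial_deriv a p * partial_deriv b q * pvar \<lbrace>a, b\<rbrace>\<^bsub>L\<^esub>)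
      = (\<Sum>a\<in>A. \<Sum>b\<in>pvars q. partial_deriv a p * partial_deriv b q * pvar \<lbrace>a, b\<rbrace>\<^bsub>L\<^esub>)"
    by (intro sum.cong refl sum.mono_neutral_right) (use assms in \<open>auto simp: partial_deriv_eq_0\<close>)
  also have "\<dots> = poly_bracket L p q"
    unfolding poly_bracket_def
    by (rule sum.mono_neutral_right) (use assms in \<open>auto simp: partial_deriv_eq_0\<close>)
  finally show ?thesis by simp
qed

lemma poly_bracket_add_left: "poly_bracket L (p + p') q = poly_bracket L p q + poly_bracket L p' q"
proof -
  let ?A = "pvars p \<union> pvars p' \<union> pvars (p + p')"
  show ?thesis
    by (simp add: le_supI1 le_supI2 poly_bracket_superset[of ?A "pvars q"] partial_deriv_simps distrib_right sum.distrib)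
qed

lemma poly_bracket_add_right: "poly_bracket L p (q + q') = poly_bracket L p q + poly_bracket L p q'"
proof -
  let ?A = "pvars q \<union> pvars q' \<union> pvars (q + q')"
  show ?thesis
    by (simp add: le_supI1 le_supI2 poly_bracket_superset[of "pvars p" ?A] partial_deriv_simps distrib_right distrib_left sum.distrib)
qed

lemma poly_bracket_scale_left: "poly_bracket L (c *c p) q = c *c poly_bracket L p q"
proof -
  let ?A = "pvars p \<union> pvars (c *c p)"
  show ?thesis
    by (simp add: le_supI1 le_supI2 poly_bracket_superset[of ?A "pvars q"] partial_deriv_simps mult_pm_scale pm.scale_sum_right)
qed

lemma poly_bracket_scale_right: "poly_bracket L p (c *c q) = c *c poly_bracket L p q"
proof -
  let ?A = "pvars q \<union> pvars (c *c q)"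
  show ?thesis
    by (simp add: le_supI1 le_supI2 poly_bracket_superset[of "pvars p" ?A] partial_deriv_simps mult_pm_scale pm.scale_sum_right)
qed

lemma poly_bracket_lin: "plin (\<lambda>p. poly_bracket L p q)" "plin (poly_bracket L p)"
  by (rule pm.linI; simp add: poly_bracket_add_left poly_bracket_add_right
      poly_bracket_scale_left poly_bracket_scale_right)+

lemmas poly_bracket_simps = poly_bracket_add_left poly_bracket_add_right poly_bracket_scale_left
  poly_bracket_scale_right pm2.linear_0[OF poly_bracket_lin(1)] pm2.linear_0[OF poly_bracket_lin(2)]
  pm2.linear_diff[OF poly_bracket_lin(1)] pm2.linear_diff[OF poly_bracket_lin(2)]

lemma poly_bracket_mult_left: "poly_bracket L (p * q) r = p * poly_bracket L q r + q * poly_bracket L p r"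
proof -
  let ?A = "pvars p \<union> pvars q \<union> pvars (p * q)"
  show ?thesis
    by (simp add: le_supI1 le_supI2 poly_bracket_superset[of ?A "pvars r"] partial_deriv_mult algebra_simps
        sum.distrib sum_distrib_left)
qed

lemma poly_bracket_mult_right: "poly_bracket L p (q * r) = q * poly_bracket L p r + r * poly_bracket L p q"
proof -
  let ?A = "pvars q \<union> pvars r \<union> pvars (q * r)"
  show ?thesis
    by (simp add: le_supI1 le_supI2 poly_bracket_superset[of "pvars p" ?A] partial_deriv_mult algebra_simps
        sum.distrib sum_distrib_left)
qed

lemma pvars_pvar [simp]: "pvars (pvar a) = {a}"
  by (simp add: pvars_def pvar_def)

lemma poly_bracket_pvar: "poly_bracket L (pvar a) (pvar b) = pvar \<lbrace>a, b\<rbrace>\<^bsub>L\<^esub>"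
  by (simp add: poly_bracket_def partial_deriv_pvar)

lemma poly_bracket_one: "poly_bracket L p 1 = 0" "poly_bracket L 1 p = 0"
  by (simp_all add: poly_bracket_def pvars_def)

lemma poly_bracket_pvar_left:
  "poly_bracket L (pvar a) q = (\<Sum>b\<in>pvars q. partial_deriv b q * pvar \<lbrace>a, b\<rbrace>\<^bsub>L\<^esub>)"
  by (simp add: poly_bracket_def partial_deriv_pvar)

lemma poly_bracket_polys:
  assumes "lie_algebra L" "p \<in> polys (carrier L)" "q \<in> polys (carrier L)"
  shows "poly_bracket L p q \<in> polys (carrier L)"
proof -
  interpret lie_algebra L by fact
  show ?thesis
    unfolding poly_bracket_def
    by (intro pm.subspace_sum[OF polys_subspace] polys_mult partial_deriv_polys assms(2,3))
      (use assms(2,3) in \<open>auto simp: polys_pvar polys_def\<close>)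
qed

section \<open>The linearity ideal and its stability under the bracket\<close>

context lie_algebra begin

abbreviation lpolys :: "'a polynomial set"
  where "lpolys \<equiv> polys (carrier L)"

abbreviation lin_ideal :: "'a polynomial set"
  where "lin_ideal \<equiv> linearity_ideal L"

definition linearity_relations :: "'a polynomial set"
  where "linearity_relations =
    {pvar (x \<oplus> y) - (pvar x + pvar y) | x y. x \<in> carrier L \<and> y \<in> carrier L} \<union>
    {pvar (c \<odot> x) - pconst c * pvar x | c x. x \<in> carrier L}"

lemma linearity_relations_polys: "linearity_relations \<subseteq> lpolys"
  by (auto simp: linearity_relations_def polys_pvar intro!: polys_closed polys_mult polys_pconst)

lemma linearity_ideal_ideal: "ideal lin_ideal (poly_algebra (carrier L))"
proof -
  interpret cring "poly_algebra (carrier L)" by (rule cring_poly_algebra)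
  show ?thesis
    unfolding linearity_ideal_def linearity_relations_def[symmetric]
    by (rule genideal_ideal) (simp add: linearity_relations_polys)
qed

lemma lin_ideal_polys: "p \<in> lin_ideal \<Longrightarrow> p \<in> lpolys"
  using ideal.Icarr[OF linearity_ideal_ideal] by simp

lemma lin_ideal_mult: "p \<in> lpolys \<Longrightarrow> q \<in> lin_ideal \<Longrightarrow> p * q \<in> lin_ideal"
  using ideal.I_l_closed[OF linearity_ideal_ideal] by simp

lemma lin_ideal_subspace: "pm.subspace lin_ideal"
proof -
  interpret ideal lin_ideal "poly_algebra (carrier L)" by (rule linearity_ideal_ideal)
  show ?thesis
  proof (rule pm.subspaceI)
    show "0 \<in> lin_ideal" using additive_subgroup.zero_closed[OF is_additive_subgroup] by simp
    show "p + q \<in> lin_ideal" if "p \<in> lin_ideal" "q \<in> lin_ideal" for p q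
      using additive_subgroup.a_closed[OF is_additive_subgroup that] by simp
    show "c *c p \<in> lin_ideal" if "p \<in> lin_ideal" for c p
      using lin_ideal_mult[OF polys_pconst that] by (simp add: pconst_mult)
  qed
qed

lemmas lin_ideal_closed = pm.subspace_add[OF lin_ideal_subspace] pm.subspace_diff[OF lin_ideal_subspace]
  pm.subspace_scale[OF lin_ideal_subspace] pm.subspace_neg[OF lin_ideal_subspace]
  pm.subspace_0[OF lin_ideal_subspace]

lemma linearity_relations_ideal: "linearity_relations \<subseteq> lin_ideal"
proof -
  interpret cring "poly_algebra (carrier L)" by (rule cring_poly_algebra)
  show ?thesis
    unfolding linearity_ideal_def linearity_relations_def[symmetric]
    by (rule genideal_self) (simp add: linearity_relations_polys)
qed

lemma lin_ideal_add:
  assumes "x \<in> carrier L" "y \<in> carrier L"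
  shows "pvar (x \<oplus> y) - pvar x - pvar y \<in> lin_ideal"
proof -
  have "pvar (x \<oplus> y) - (pvar x + pvar y) \<in> lin_ideal"
    using assms linearity_relations_ideal unfolding linearity_relations_def by blast
  then show ?thesis by (simp add: diff_diff_eq)
qed

lemma lin_ideal_smult: "x \<in> carrier L \<Longrightarrow> pvar (c \<odot> x) - c *c pvar x \<in> lin_ideal"
  unfolding pconst_mult[symmetric] using linearity_relations_ideal unfolding linearity_relations_def by blast

text \<open>An induction principle for the ideal. \<open>J\<close> may contain polynomials in
  foreign variables; the ideal that is compared is its intersection with
  \<open>lpolys\<close>.\<close>

lemma lin_ideal_minimal:
  assumes J: "pm.subspace J" and mult: "\<And>p q. p \<in> lpolys \<Longrightarrow> q \<in> J \<Longrightarrow> q \<in> lpolys \<Longrightarrow> p * q \<in> J"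
    and add: "\<And>x y. x \<in> carrier L \<Longrightarrow> y \<in> carrier L \<Longrightarrow> pvar (x \<oplus> y) - pvar x - pvar y \<in> J"
    and smult: "\<And>c x. x \<in> carrier L \<Longrightarrow> pvar (c \<odot> x) - c *c pvar x \<in> J"
  shows "lin_ideal \<subseteq> J"
proof -
  interpret cring "poly_algebra (carrier L)" by (rule cring_poly_algebra)
  have "ideal (J \<inter> lpolys) (poly_algebra (carrier L))"
  proof (rule idealI)
    show "subgroup (J \<inter> lpolys) (add_monoid (poly_algebra (carrier L)))"
    proof (rule group.subgroupI)
      show "Group.group (add_monoid (poly_algebra (carrier L)))" by (rule a_group)
      show "J \<inter> lpolys \<noteq> {}" using pm.subspace_0[OF J] polys_closed(5) by blast
      fix a assume a: "a \<in> J \<inter> lpolys"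
      then have "inv\<^bsub>add_monoid (poly_algebra (carrier L))\<^esub> a = - a"
        using a_inv_poly_algebra[of a "carrier L"] by (simp add: a_inv_def)
      then show "inv\<^bsub>add_monoid (poly_algebra (carrier L))\<^esub> a \<in> J \<inter> lpolys"
        using a by (simp add: pm.subspace_neg[OF J] polys_closed)
    qed (auto simp: pm.subspace_add[OF J] polys_closed)
    show "x \<otimes>\<^bsub>poly_algebra (carrier L)\<^esub> a \<in> J \<inter> lpolys"
      if "a \<in> J \<inter> lpolys" "x \<in> carrier (poly_algebra (carrier L))" for a x
      using that mult by (simp add: polys_mult)
    show "a \<otimes>\<^bsub>poly_algebra (carrier L)\<^esub> x \<in> J \<inter> lpolys"
      if "a \<in> J \<inter> lpolys" "x \<in> carrier (poly_algebra (carrier L))" for a x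
      using that mult[of x a] by (simp add: polys_mult mult.commute)
  qed (rule ring_axioms)
  moreover have "linearity_relations \<subseteq> J \<inter> lpolys"
  proof -
    have "linearity_relations \<subseteq> J"
      using add smult by (auto simp: linearity_relations_def pconst_mult diff_diff_eq)
    then show ?thesis using linearity_relations_polys by blast
  qed
  ultimately have "lin_ideal \<subseteq> J \<inter> lpolys"
    unfolding linearity_ideal_def linearity_relations_def[symmetric] by (rule genideal_minimal)
  then show ?thesis by blast
qed

lemma poly_bracket_lpolys: "p \<in> lpolys \<Longrightarrow> q \<in> lpolys \<Longrightarrow> poly_bracket L p q \<in> lpolys"
  using poly_bracket_polys lie_algebra_axioms .

lemma lin_ideal_sum: "(\<And>a. a \<in> A \<Longrightarrow> f a \<in> lin_ideal) \<Longrightarrow> sum f A \<in> lin_ideal"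
  by (rule pm.subspace_sum[OF lin_ideal_subspace])

text \<open>Only a congruence: the variables of the brackets of (a, b) and of (b, a) are distinct
  variables in general, related by the linearity relations alone.\<close>

lemma poly_bracket_skew:
  assumes "p \<in> lpolys" "q \<in> lpolys"
  shows "poly_bracket L p q + poly_bracket L q p \<in> lin_ideal"
proof -
  have v: "a \<in> carrier L" if "a \<in> pvars p" for a using that assms by (auto simp: polys_def)
  have w: "b \<in> carrier L" if "b \<in> pvars q" for b using that assms by (auto simp: polys_def)
  have "poly_bracket L q p = (\<Sum>a\<in>pvars p. \<Sum>b\<in>pvars q. partial_deriv a p * partial_deriv b q * pvar \<lbrace>b, a\<rbrace>)"
    unfolding poly_bracket_def by (subst sum.swap) (simp add: mult.commute)
  then have "poly_bracket L p q + poly_bracket L q p = (\<Sum>a\<in>pvars p. \<Sum>b\<in>pvars q.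
      partial_deriv a p * partial_deriv b q * (pvar \<lbrace>a, b\<rbrace> + pvar \<lbrace>b, a\<rbrace>))"
    by (simp add: poly_bracket_def sum.distrib distrib_left)
  also have "\<dots> \<in> lin_ideal"
  proof (intro lin_ideal_sum lin_ideal_mult polys_mult partial_deriv_polys assms)
    fix a b assume "a \<in> pvars p" "b \<in> pvars q"
    then show "pvar \<lbrace>a, b\<rbrace> + pvar \<lbrace>b, a\<rbrace> \<in> lin_ideal"
      using lin_ideal_smult[of "\<lbrace>a, b\<rbrace>" "- 1"] v w by (simp add: bracket_anticomm[of a b] add.commute)
  qed
  finally show ?thesis .
qed

lemma poly_bracket_ideal_left:
  assumes "p \<in> lin_ideal" "q \<in> lpolys"
  shows "poly_bracket L p q \<in> lin_ideal"
proof -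
  have lin: "poly_bracket L (pvar x) q = (\<Sum>b\<in>pvars q. partial_deriv b q * pvar \<lbrace>x, b\<rbrace>)" for x q
    by (rule poly_bracket_pvar_left)
  \<comment> \<open>Membership in the ideal is carried along because the Leibniz rule leaves a term
    r {p, q}, which lies in the ideal only since r does.\<close>
  have "lin_ideal \<subseteq> {p \<in> lin_ideal. \<forall>q\<in>lpolys. poly_bracket L p q \<in> lin_ideal}"
  proof (rule lin_ideal_minimal)
    show "pm.subspace {p \<in> lin_ideal. \<forall>q\<in>lpolys. poly_bracket L p q \<in> lin_ideal}"
      by (rule pm.subspaceI) (auto simp: lin_ideal_closed poly_bracket_simps)
    show "p * r \<in> {p \<in> lin_ideal. \<forall>q\<in>lpolys. poly_bracket L p q \<in> lin_ideal}"
      if "p \<in> lpolys" "r \<in> {p \<in> lin_ideal. \<forall>q\<in>lpolys. poly_bracket L p q \<in> lin_ideal}" for p r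
    proof -
      have *: "r * poly_bracket L p q \<in> lin_ideal" if "q \<in> lpolys" for q
        using lin_ideal_mult[OF poly_bracket_lpolys[OF \<open>p \<in> lpolys\<close> that], of r]
          \<open>r \<in> _\<close> by (simp add: mult.commute)
      then show ?thesis
        using that by (auto simp: poly_bracket_mult_left lin_ideal_mult lin_ideal_polys *
            intro!: lin_ideal_closed(1))
    qed
  next
    fix x y assume xy: "x \<in> carrier L" "y \<in> carrier L"
    have "poly_bracket L (pvar (x \<oplus> y) - pvar x - pvar y) q \<in> lin_ideal" if q: "q \<in> lpolys" for q
    proof -
      have "poly_bracket L (pvar (x \<oplus> y) - pvar x - pvar y) q
          = (\<Sum>b\<in>pvars q. partial_deriv b q * (pvar (\<lbrace>x, b\<rbrace> \<oplus> \<lbrace>y, b\<rbrace>) - pvar \<lbrace>x, b\<rbrace> - pvar \<lbrace>y, b\<rbrace>))"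
        unfolding poly_bracket_simps lin sum_subtractf[symmetric]
        by (intro sum.cong refl) (use xy q in \<open>auto simp: polys_def bracket_add_left algebra_simps\<close>)
      also have "\<dots> \<in> lin_ideal"
        using xy q by (intro lin_ideal_sum lin_ideal_mult partial_deriv_polys lin_ideal_add) (auto simp: polys_def)
      finally show ?thesis .
    qed
    then show "pvar (x \<oplus> y) - pvar x - pvar y \<in> {p \<in> lin_ideal. \<forall>q\<in>lpolys. poly_bracket L p q \<in> lin_ideal}"
      by (simp add: lin_ideal_add xy)
  next
    fix c x assume x: "x \<in> carrier L"
    have "poly_bracket L (pvar (c \<odot> x) - c *c pvar x) q \<in> lin_ideal" if q: "q \<in> lpolys" for q
    proof -
      have "poly_bracket L (pvar (c \<odot> x) - c *c pvar x) q
          = (\<Sum>b\<in>pvars q. partial_deriv b q * (pvar (c \<odot> \<lbrace>x, b\<rbrace>) - c *c pvar \<lbrace>x, b\<rbrace>))"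
        unfolding poly_bracket_simps lin pm.scale_sum_right sum_subtractf[symmetric]
        by (intro sum.cong refl) (use x q in \<open>auto simp: polys_def bracket_smult_left algebra_simps mult_pm_scale\<close>)
      also have "\<dots> \<in> lin_ideal"
        using x q by (intro lin_ideal_sum lin_ideal_mult partial_deriv_polys lin_ideal_smult) (auto simp: polys_def)
      finally show ?thesis .
    qed
    then show "pvar (c \<odot> x) - c *c pvar x \<in> {p \<in> lin_ideal. \<forall>q\<in>lpolys. poly_bracket L p q \<in> lin_ideal}"
      by (simp add: lin_ideal_smult x)
  qed
  then show ?thesis using assms by blast
qed

lemma poly_bracket_ideal_right:
  assumes "p \<in> lpolys" "q \<in> lin_ideal"
  shows "poly_bracket L p q \<in> lin_ideal"
proof -
  have "(poly_bracket L p q + poly_bracket L q p) - poly_bracket L q p \<in> lin_ideal"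
    by (intro lin_ideal_closed(2) poly_bracket_skew poly_bracket_ideal_left assms lin_ideal_polys[OF assms(2)])
  then show ?thesis by simp
qed

section \<open>The symbol map\<close>

definition letters_monomial :: "('a \<times> int) list \<Rightarrow> ('a \<Rightarrow>\<^sub>0 nat)"
  where "letters_monomial w = (\<Sum>x\<leftarrow>w. Poly_Mapping.single (fst x) 1)"

definition word_symbol :: "('a \<times> int) list \<Rightarrow> 'a polynomial"
  where "word_symbol w = (if good w \<and> (\<forall>x\<in>set w. snd x = -1) then wd (letters_monomial w) else 0)"

definition symbol :: "'a words \<Rightarrow> 'a polynomial"
  where "symbol = lift word_symbol"

lemma symbol_lin: "plin symbol"
  by (simp add: symbol_def lift_lin)

lemma symbol_wd: "symbol (wd w) = word_symbol w"
  by (simp add: symbol_def)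

lemmas symbol_simps = pm2.linear_add[OF symbol_lin] pm2.linear_scale[OF symbol_lin]
  pm2.linear_0[OF symbol_lin] pm2.linear_diff[OF symbol_lin] pm2.linear_neg[OF symbol_lin]

lemma word_symbol_Nil [simp]: "word_symbol [] = 1"
  by (simp add: word_symbol_def letters_monomial_def)

lemma word_symbol_bad: "\<not> good w \<Longrightarrow> word_symbol w = 0"
  by (simp add: word_symbol_def)

lemma word_symbol_append: "word_symbol (w @ w') = word_symbol w * word_symbol w'"
  by (auto simp: word_symbol_def wd_mult letters_monomial_def)

lemma word_symbol_Cons:
  "fst x \<in> carrier L \<Longrightarrow> snd x < 0 \<Longrightarrow>
    word_symbol (x # w) = (if snd x = -1 then pvar (fst x) * word_symbol w else 0)"
  by (simp add: word_symbol_def pvar_eq_wd wd_mult letters_monomial_def)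

lemma word_symbol_polys: "word_symbol w \<in> lpolys"
proof (induction w)
  case (Cons x w)
  then show ?case
    by (cases "good (x # w)") (auto simp: word_symbol_Cons word_symbol_bad polys_closed polys_mult polys_pvar)
qed (simp add: polys_one)

lemma symbol_polys: "symbol p \<in> lpolys"
  by (rule plin_memI[OF symbol_lin polys_subspace]) (simp add: symbol_wd word_symbol_polys)

lemma symbol_loop_op_neg:
  assumes "u \<in> carrier L" "n < 0"
  shows "symbol (loop_op u n p) = (if n = -1 then pvar u * symbol p else 0)"
proof -
  have lin: "plin (\<lambda>p. symbol (loop_op u n p))" "plin (\<lambda>p. if n = -1 then pvar u * symbol p else 0)"
    using plin_comp[OF symbol_lin loop_op_lin, of u n] plin_comp[OF plin_mult(1) symbol_lin, of "pvar u"]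
    by (cases "n = -1"; simp add: pm2.linear_zero)+
  have "symbol (loop_op u n (wd w)) = (if n = -1 then pvar u * symbol (wd w) else 0)" for w
    using assms by (cases "good w")
      (simp_all add: loop_op_neg loop_op_bad symbol_wd symbol_simps word_symbol_Cons word_symbol_bad)
  then show ?thesis by (rule plin_eqI[OF lin])
qed

text \<open>The zero mode of u acts on words as the derivation x t^n to [u, x] t^n. It preserves
  exponents, so letters below t^-1 go on contributing 0.\<close>

lemma symbol_loop_op_0:
  assumes "u \<in> carrier L"
  shows "symbol (loop_op u 0 p) = poly_bracket L (pvar u) (symbol p)"
proof -
  have lin: "plin (\<lambda>p. symbol (loop_op u 0 p))" "plin (\<lambda>p. poly_bracket L (pvar u) (symbol p))"
    by (rule plin_comp[OF symbol_lin loop_op_lin] plin_comp[OF poly_bracket_lin(2) symbol_lin])+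
  have "symbol (loop_op u 0 (wd w)) = poly_bracket L (pvar u) (symbol (wd w))" for w
  proof (induction w)
    case Nil
    show ?case by (simp add: loop_op_vac symbol_simps symbol_wd poly_bracket_one)
  next
    case (Cons x w)
    show ?case
    proof (cases "good (x # w)")
      case True
      then have "symbol (loop_op u 0 (wd (x # w))) = (if snd x = -1 then
          pvar (fst x) * poly_bracket L (pvar u) (word_symbol w) + pvar \<lbrace>u, fst x\<rbrace> * word_symbol w else 0)"
        using Cons assms by (simp add: wd_Cons loop_op_commute symbol_simps symbol_loop_op_neg symbol_wd)
      also have "\<dots> = poly_bracket L (pvar u) (symbol (wd (x # w)))"
        using True by (simp add: symbol_wd word_symbol_Cons poly_bracket_mult_right poly_bracket_pvar
            poly_bracket_simps mult.commute)
      finally show ?thesis .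
    next
      case False
      then show ?thesis by (simp add: loop_op_bad symbol_simps symbol_wd word_symbol_bad poly_bracket_simps del: good_simps)
    qed
  qed
  then show ?thesis by (rule plin_eqI[OF lin])
qed

text \<open>For a commutator relator the two orders have the same symbol, and the bracket letter has
  exponent at most -2, hence symbol 0. The linearity relators land on generators of the ideal or on
  0.\<close>

lemma symbol_rel:
  assumes "p \<in> rel"
  shows "symbol p \<in> lin_ideal"
proof (rule plin_rel[OF symbol_lin _ _ _ _ lin_ideal_subspace assms])
  fix w w' u v and n :: int assume uv: "u \<in> carrier L" "v \<in> carrier L" "n < 0"
  have "symbol (add_relator w u v n w') =
      (if n = -1 then word_symbol w * word_symbol w' * (pvar (u \<oplus> v) - pvar u - pvar v) else 0)"
    using uv by (simp add: symbol_simps symbol_wd word_symbol_append word_symbol_Cons algebra_simps)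
  then show "symbol (add_relator w u v n w') \<in> lin_ideal"
    using uv by (simp add: lin_ideal_mult polys_mult word_symbol_polys lin_ideal_add lin_ideal_closed)
next
  fix w w' c u and n :: int assume u: "u \<in> carrier L" "n < 0"
  have "symbol (smult_relator w c u n w') =
      (if n = -1 then word_symbol w * word_symbol w' * (pvar (c \<odot> u) - c *c pvar u) else 0)"
    using u by (simp add: symbol_simps symbol_wd word_symbol_append word_symbol_Cons algebra_simps mult_pm_scale
        del: pm_scale_single)
  then show "symbol (smult_relator w c u n w') \<in> lin_ideal"
    using u by (simp add: lin_ideal_mult polys_mult word_symbol_polys lin_ideal_smult lin_ideal_closed del: pm_scale_single)
next
  fix w w' u v and m n :: int assume "u \<in> carrier L" "v \<in> carrier L" "m < 0" "n < 0"
  then show "symbol (comm_relator w u m v n w') \<in> lin_ideal"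
    by (simp add: symbol_simps symbol_wd word_symbol_append word_symbol_Cons lin_ideal_closed mult.left_commute)
qed (simp add: symbol_wd word_symbol_bad lin_ideal_closed)

section \<open>Symbols of modes and of vertex algebra products\<close>

definition symbol_kernel :: "'a words set"
  where "symbol_kernel = {p. symbol p \<in> lin_ideal}"

lemma symbol_kernel_subspace: "pm.subspace symbol_kernel"
  by (rule pm.subspaceI) (simp_all add: symbol_kernel_def symbol_simps lin_ideal_closed)

lemma symbol_proj: "symbol (proj p) - symbol p \<in> lin_ideal"
  using lin_ideal_closed(4)[OF symbol_rel[OF proj_diff[of p]]] by (simp add: symbol_simps)

lemma symbol_mode_low:
  assumes "u \<in> carrier L" "n \<le> -2"
  shows "mode u n p \<in> symbol_kernel"
  using symbol_proj[of "loop_op u n p"] assms by (simp add: mode_def symbol_kernel_def symbol_loop_op_neg)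

lemma symbol_mode_minus1:
  assumes "u \<in> carrier L"
  shows "symbol (mode u (-1) p) - pvar u * symbol p \<in> lin_ideal"
  using symbol_proj[of "loop_op u (-1) p"] assms by (simp add: mode_def symbol_loop_op_neg)

lemma symbol_mode_0:
  assumes "u \<in> carrier L"
  shows "symbol (mode u 0 p) - poly_bracket L (pvar u) (symbol p) \<in> lin_ideal"
  using symbol_proj[of "loop_op u 0 p"] assms by (simp add: mode_def symbol_loop_op_0)

lemma Y_word_Cons:
  assumes "good (x # w)"
  shows "va.Y (wd (x # w)) = pm.nth_product (mode (fst x)) (snd x) (va.Y (wd w))"
proof -
  have "mode (fst x) (snd x) (wd w) = proj (wd (x # w))"
    by (simp add: mode_def wd_Cons[OF assms])
  then have "va.Y (wd (x # w)) = va.Y (mode (fst x) (snd x) (wd w))"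
    by (simp only: va.Y_P(3))
  then show ?thesis using assms by (simp add: va.Y_gen)
qed

lemma Y_word_Nil: "va.Y (wd []) = va.one_field"
  using va.Y_vacuum by simp

lemma Y_bad: "\<not> good w \<Longrightarrow> va.Y (wd w) n b = 0"
proof -
  assume "\<not> good w"
  then have "proj (wd w) = 0" by (intro proj_rel rel_bad)
  then have "va.Y (wd w) = va.Y 0" by (metis va.Y_P(3))
  then show ?thesis using va.Y_scale[of 0 0 n b] by simp
qed

text \<open>Removing the first letter turns the field into a product of a generating field with that
  of the shorter word. The three claims are proved together, for all b, because mode 0 of the longer
  word involves all modes <= 0 of the shorter one, applied also to the zero mode of u on b.\<close>

lemma symbol_Y_word:
  "(\<forall>n\<le>-2. va.Y (wd w) n b \<in> symbol_kernel) \<and>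
  symbol (va.Y (wd w) (-1) b) - word_symbol w * symbol b \<in> lin_ideal \<and>
  symbol (va.Y (wd w) 0 b) - poly_bracket L (word_symbol w) (symbol b) \<in> lin_ideal"
proof (induction w arbitrary: b)
  case Nil
  then show ?case
    by (simp add: Y_word_Nil va.one_field_def pm.subspace_0[OF symbol_kernel_subspace] symbol_proj
        symbol_simps poly_bracket_one lin_ideal_closed)
next
  case (Cons x w)
  show ?case
  proof -
    define E where "E = va.Y (wd w)"
    have E: "pm.vfield E" by (simp add: E_def)
    define u k where "u = fst x" and "k = snd x"
    \<comment> \<open>In \<open>H1\<close> a mode of u is applied last, in \<open>H2\<close> a mode
      of the shorter word.\<close>
    define H1 where "H1 n b = pm.half_jacobi (mode u) E k 0 n b" for n b
    define H2 where "H2 n b = pm.half_jacobi E (mode u) k n 0 b" for n b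
    have low: "n \<le> -2 \<Longrightarrow> E n b \<in> symbol_kernel" for n b unfolding E_def using Cons.IH by blast
    have minus1: "symbol (E (-1) b) - word_symbol w * symbol b \<in> lin_ideal" for b
      unfolding E_def using Cons.IH by blast
    have zero: "symbol (E 0 b) - poly_bracket L (word_symbol w) (symbol b) \<in> lin_ideal" for b
      unfolding E_def using Cons.IH by blast
    note ker = pm.subspace_diff[OF symbol_kernel_subspace] pm.subspace_scale[OF symbol_kernel_subspace]
    show ?thesis
    proof (cases "good (x # w)")
      case False
      then show ?thesis
        by (simp add: Y_bad word_symbol_bad poly_bracket_simps symbol_simps lin_ideal_closed
            pm.subspace_0[OF symbol_kernel_subspace] del: good_simps)
    next
      case True
      then have u: "u \<in> carrier L" "k < 0" by (simp_all add: u_def k_def)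
      have Y: "va.Y (wd (x # w)) n b = H1 n b - ((-1) powi k) *c H2 n b" for n b
        unfolding Y_word_Cons[OF True] pm.nth_product_def pm.jacobi_lhs_def
        by (simp add: H1_def H2_def E_def u_def k_def)
      have H2_low: "H2 n b \<in> symbol_kernel" if "n + k \<le> -2" for n b
        unfolding H2_def pm.half_jacobi_def
        using that by (intro pm.binsum_mem symbol_kernel_subspace low) auto
      show ?thesis
      proof (cases "k = -1")
        case False
        then have sw: "word_symbol (x # w) = 0" and k: "k \<le> -2"
          using True u by (simp_all add: word_symbol_Cons k_def)
        \<comment> \<open>With k <= -2 the outermost mode of every term has index at most -2: k - i
          for u in \<open>H1\<close>, n + k - i for the shorter word in \<open>H2\<close>.\<close>
        have "va.Y (wd (x # w)) n b \<in> symbol_kernel" if "n \<le> 0" for n b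
          unfolding Y
        proof (intro ker H2_low)
          show "H1 n b \<in> symbol_kernel"
            unfolding H1_def pm.half_jacobi_def
            using k u by (intro pm.binsum_mem symbol_kernel_subspace symbol_mode_low) auto
        qed (use that k in simp)
        then show ?thesis
          unfolding sw by (simp add: symbol_kernel_def poly_bracket_simps)
      next
        case k: True
        have sw: "word_symbol (x # w) = pvar u * word_symbol w"
          using True k by (simp add: word_symbol_Cons k_def u_def)
        \<comment> \<open>The sign (-1)^k is -1 for k = -1.\<close>
        have Y': "va.Y (wd (x # w)) n b = H1 n b + H2 n b" for n b
          by (simp add: Y k)
        \<comment> \<open>The modes of u in \<open>H1\<close> are -1 - i, so only i = 0 escapes the
          kernel.\<close>
        have H1: "H1 n b - mode u (-1) (E n b) \<in> symbol_kernel" for n b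
        proof -
          have "H1 n b - mode u (0 + k - int 0) (E (n + int 0) b) \<in> symbol_kernel"
            unfolding H1_def pm.half_jacobi_def
          proof (rule pm.binsum_mem_first[OF _ symbol_kernel_subspace])
            show "pm.vanishing (\<lambda>i. mode u (0 + k - int i) (E (n + int i) b))"
              by (rule pm.half_jacobi_vanishing[OF mode_vfield E])
          qed (use k u in \<open>auto intro: symbol_mode_low\<close>)
          then show ?thesis by (simp add: k)
        qed
        have H1': "symbol (H1 n b) - pvar u * symbol (E n b) \<in> lin_ideal" for n b
          using lin_ideal_closed(1)[OF H1[of n b, unfolded symbol_kernel_def mem_Collect_eq]
              symbol_mode_minus1[OF u(1), of "E n b"]] by (simp add: symbol_simps)
        have pu: "pvar u \<in> lpolys" using u by (simp add: polys_pvar)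
        have "va.Y (wd (x # w)) n b \<in> symbol_kernel" if "n \<le> -2" for n
        proof -
          have "symbol (E n b) \<in> lin_ideal" using low[OF that] by (simp add: symbol_kernel_def)
          from lin_ideal_closed(1)[OF H1'[of n b] lin_ideal_mult[OF pu this]]
          have "symbol (H1 n b) \<in> lin_ideal" by simp
          moreover have "symbol (H2 n b) \<in> lin_ideal"
            using H2_low[of n b] that k by (simp add: symbol_kernel_def)
          ultimately show ?thesis by (simp add: Y' symbol_kernel_def symbol_simps lin_ideal_closed)
        qed
        moreover have "symbol (va.Y (wd (x # w)) (-1) b) - word_symbol (x # w) * symbol b \<in> lin_ideal"
        proof -
          have "(symbol (H1 (-1) b) - pvar u * symbol (E (-1) b)) +
              pvar u * (symbol (E (-1) b) - word_symbol w * symbol b) + symbol (H2 (-1) b) \<in> lin_ideal"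
            using H2_low[of "-1" b] k
            by (intro lin_ideal_closed(1) H1' lin_ideal_mult pu minus1) (simp add: symbol_kernel_def)
          then show ?thesis by (simp add: Y' sw symbol_simps algebra_simps)
        qed
        moreover have "symbol (va.Y (wd (x # w)) 0 b) - poly_bracket L (word_symbol (x # w)) (symbol b) \<in> lin_ideal"
        proof -
          \<comment> \<open>At n = 0 the term i = 0 of \<open>H2\<close> survives, mode -1 of the
            shorter word after mode 0 of u. It supplies the second summand of the Leibniz rule for
            the bracket.\<close>
          have "H2 0 b - E (0 + k - int 0) (mode u (0 + int 0) b) \<in> symbol_kernel"
            unfolding H2_def pm.half_jacobi_def
          proof (rule pm.binsum_mem_first[OF _ symbol_kernel_subspace])
            show "pm.vanishing (\<lambda>i. E (0 + k - int i) (mode u (0 + int i) b))"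
              by (rule pm.half_jacobi_vanishing[OF E mode_vfield])
          qed (use k in \<open>auto intro: low\<close>)
          then have H2: "symbol (H2 0 b) - symbol (E (-1) (mode u 0 b)) \<in> lin_ideal"
            by (simp add: k symbol_kernel_def symbol_simps)
          have "(symbol (H1 0 b) - pvar u * symbol (E 0 b)) +
              pvar u * (symbol (E 0 b) - poly_bracket L (word_symbol w) (symbol b)) +
              (symbol (H2 0 b) - symbol (E (-1) (mode u 0 b))) +
              (symbol (E (-1) (mode u 0 b)) - word_symbol w * symbol (mode u 0 b)) +
              word_symbol w * (symbol (mode u 0 b) - poly_bracket L (pvar u) (symbol b)) \<in> lin_ideal"
            by (intro lin_ideal_closed(1) H1' H2 lin_ideal_mult pu minus1 zero symbol_mode_0 u word_symbol_polys)
          then show ?thesis by (simp add: Y' sw symbol_simps poly_bracket_mult_left algebra_simps)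
        qed
        ultimately show ?thesis by blast
      qed
    qed
  qed
qed

lemma Y_lin_left: "plin (\<lambda>a. va.Y a n b)"
  by (rule pm.linI) (simp_all add: va.Y_add va.Y_scale)

lemma
  shows symbol_Y_minus2: "symbol (va.Y a (-2) b) \<in> lin_ideal"
    and symbol_Y_minus1: "symbol (va.Y a (-1) b) - symbol a * symbol b \<in> lin_ideal"
    and symbol_Y_0: "symbol (va.Y a 0 b) - poly_bracket L (symbol a) (symbol b) \<in> lin_ideal"
proof -
  have lin: "plin (\<lambda>a. symbol (va.Y a n b))" for n
    by (rule plin_comp[OF symbol_lin Y_lin_left])
  from plin_memI[OF lin lin_ideal_subspace] symbol_Y_word
  show "symbol (va.Y a (-2) b) \<in> lin_ideal" by (simp add: symbol_kernel_def)
  have "plin (\<lambda>a. symbol (va.Y a (-1) b) - symbol a * symbol b)"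
    by (intro pm2.linear_compose_sub lin plin_comp[OF plin_mult(2) symbol_lin])
  from plin_memI[OF this lin_ideal_subspace] symbol_Y_word
  show "symbol (va.Y a (-1) b) - symbol a * symbol b \<in> lin_ideal" by (simp add: symbol_wd)
  have "plin (\<lambda>a. symbol (va.Y a 0 b) - poly_bracket L (symbol a) (symbol b))"
    by (intro pm2.linear_compose_sub lin plin_comp[OF poly_bracket_lin(1) symbol_lin])
  from plin_memI[OF this lin_ideal_subspace] symbol_Y_word
  show "symbol (va.Y a 0 b) - poly_bracket L (symbol a) (symbol b) \<in> lin_ideal" by (simp add: symbol_wd)
qed

section \<open>The kernel of the symbol map\<close>

text \<open>A candidate for the preimage of \<open>C2\<close> among words, described by generators
  only; including \<open>rel\<close> allows computations before projecting.\<close>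

definition decomposables :: "'a words set"
  where "decomposables = pm.span ({loop_op u n p | u n p. u \<in> carrier L \<and> n \<le> -2} \<union> rel)"

lemma decomposables_subspace: "pm.subspace decomposables"
  by (simp add: decomposables_def)

lemmas decomposables_closed = pm.subspace_add[OF decomposables_subspace]
  pm.subspace_diff[OF decomposables_subspace] pm.subspace_scale[OF decomposables_subspace]
  pm.subspace_neg[OF decomposables_subspace] pm.subspace_0[OF decomposables_subspace]

lemma decomposables_loop_op: "u \<in> carrier L \<Longrightarrow> n \<le> -2 \<Longrightarrow> loop_op u n p \<in> decomposables"
  unfolding decomposables_def by (rule pm.span_base) blast

lemma decomposables_rel: "p \<in> rel \<Longrightarrow> p \<in> decomposables"
  unfolding decomposables_def by (rule pm.span_base) blast

lemma decomposables_minimal: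
  assumes "pm.subspace W" "\<And>u n p. u \<in> carrier L \<Longrightarrow> n \<le> -2 \<Longrightarrow> loop_op u n p \<in> W"
    "\<And>p. p \<in> rel \<Longrightarrow> p \<in> W"
  shows "decomposables \<subseteq> W"
  unfolding decomposables_def by (rule pm.span_minimal) (use assms in blast)+

text \<open>Moving the letter past u t^m creates a bracket of exponent n + m <= -3, again
  decomposable.\<close>

lemma decomposables_prefix:
  assumes "p \<in> decomposables" "v \<in> carrier L" "n < 0"
  shows "loop_op v n p \<in> decomposables"
proof -
  have "decomposables \<subseteq> {p. loop_op v n p \<in> decomposables}"
  proof (rule decomposables_minimal)
    show "pm.subspace {p. loop_op v n p \<in> decomposables}"
      by (rule pm.subspaceI) (simp_all add: loop_op_simps decomposables_closed)
    show "p \<in> {p. loop_op v n p \<in> decomposables}" if "p \<in> rel" for p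
      using loop_op_rel[OF assms(2) that] by (simp add: decomposables_rel)
    show "loop_op u m p \<in> {p. loop_op v n p \<in> decomposables}" if "u \<in> carrier L" "m \<le> -2" for u m p
    proof -
      have "(loop_op v n (loop_op u m p) - loop_op u m (loop_op v n p) - loop_op \<lbrace>v, u\<rbrace> (n + m) p)
          + loop_op u m (loop_op v n p) + loop_op \<lbrace>v, u\<rbrace> (n + m) p \<in> decomposables"
        using that assms
        by (intro decomposables_closed(1) decomposables_rel loop_op_commute_rel decomposables_loop_op) auto
      then show ?thesis by simp
    qed
  qed
  then show ?thesis using assms(1) by blast
qed

lemma decomposables_word: "good w \<Longrightarrow> \<exists>x\<in>set w. snd x \<noteq> -1 \<Longrightarrow> wd w \<in> decomposables"
proof (induction w)
  case (Cons x w)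
  show ?case
  proof (cases "snd x = -1")
    case True
    then have "\<exists>y\<in>set w. snd y \<noteq> -1" using Cons.prems by auto
    then have "wd w \<in> decomposables" using Cons by simp
    then show ?thesis
      using Cons.prems by (simp add: wd_Cons decomposables_prefix)
  next
    case False
    then show ?thesis
      using Cons.prems by (simp add: wd_Cons decomposables_loop_op)
  qed
qed simp

definition minus1_word :: "'a list \<Rightarrow> 'a words"
  where "minus1_word us = wd (map (\<lambda>u. (u, -1)) us)"

lemma good_minus1: "good (map (\<lambda>u. (u, -1)) us) \<longleftrightarrow> set us \<subseteq> carrier L"
  by (auto simp: good_def)

lemma minus1_word_Cons:
  "x \<in> carrier L \<Longrightarrow> set us \<subseteq> carrier L \<Longrightarrow> minus1_word (x # us) = loop_op x (-1) (minus1_word us)"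
  by (simp add: minus1_word_def wd_Cons good_minus1)

text \<open>Exchanging two letters of exponent -1 costs a bracket letter of exponent -2.\<close>

lemma minus1_word_move:
  assumes "set us \<subseteq> carrier L" "set vs \<subseteq> carrier L" "x \<in> carrier L"
  shows "minus1_word (us @ x # vs) - minus1_word (x # us @ vs) \<in> decomposables"
  using assms(1)
proof (induction us)
  case (Cons y us)
  let ?X = "minus1_word (us @ vs)"
  have "minus1_word ((y # us) @ x # vs) - minus1_word (x # (y # us) @ vs) =
      loop_op y (-1) (minus1_word (us @ x # vs) - minus1_word (x # us @ vs)) +
      (loop_op y (-1) (loop_op x (-1) ?X) - loop_op x (-1) (loop_op y (-1) ?X) - loop_op \<lbrace>y, x\<rbrace> (-1 + -1) ?X) +
      loop_op \<lbrace>y, x\<rbrace> (-2) ?X"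
    using Cons.prems assms by (simp add: minus1_word_Cons loop_op_simps)
  also have "\<dots> \<in> decomposables"
    using Cons assms
    by (intro decomposables_closed(1) decomposables_prefix[of _ y] decomposables_rel[OF loop_op_commute_rel]
        decomposables_loop_op) auto
  finally show ?case .
qed (simp add: decomposables_closed)

lemma minus1_word_perm:
  assumes "mset us = mset vs" "set us \<subseteq> carrier L"
  shows "minus1_word us - minus1_word vs \<in> decomposables"
  using assms
proof (induction us arbitrary: vs)
  case (Cons x us)
  then have "x \<in> set vs" by (metis list.set_intros(1) set_mset_mset)
  then obtain vs1 vs2 where vs: "vs = vs1 @ x # vs2" by (meson split_list)
  then have mset: "mset us = mset (vs1 @ vs2)" using Cons.prems by simp
  then have sets: "set us = set (vs1 @ vs2)" by (rule mset_eq_setD)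
  have "minus1_word (x # us) - minus1_word vs = loop_op x (-1) (minus1_word us - minus1_word (vs1 @ vs2))
      - (minus1_word (vs1 @ x # vs2) - minus1_word (x # vs1 @ vs2))"
    using Cons.prems sets by (simp add: vs minus1_word_Cons loop_op_simps)
  also have "\<dots> \<in> decomposables"
    using Cons.prems sets
    by (intro decomposables_closed(2) decomposables_prefix Cons.IH mset minus1_word_move) auto
  finally show ?case .
qed (simp add: decomposables_closed)

text \<open>An arbitrary ordering of the variables of a monomial; by \<open>minus1_word_perm\<close>
  the choice is invisible modulo \<open>decomposables\<close>.\<close>

definition monomial_letters :: "('a \<Rightarrow>\<^sub>0 nat) \<Rightarrow> 'a list"
  where "monomial_letters m = (SOME us. mset us = Abs_multiset (Poly_Mapping.lookup m))"

lemma count_monomial_letters: "count (mset (monomial_letters m)) u = Poly_Mapping.lookup m u"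
proof -
  have "mset (monomial_letters m) = Abs_multiset (Poly_Mapping.lookup m)"
    unfolding monomial_letters_def by (rule someI_ex) (rule ex_mset)
  moreover have "finite {x. 0 < Poly_Mapping.lookup m x}"
    using finite_lookup[of m] by simp
  ultimately show ?thesis by (simp add: count_Abs_multiset)
qed

lemma set_monomial_letters: "set (monomial_letters m) = Poly_Mapping.keys m"
  using count_monomial_letters[of m] by (auto simp: in_keys_iff simp flip: count_greater_zero_iff set_mset_mset)

lemma count_letters_monomial:
  "Poly_Mapping.lookup (letters_monomial w) u = count (mset (map fst w)) u"
  by (induction w) (simp_all add: letters_monomial_def lookup_add lookup_single when_def)

text \<open>A linear section of \<open>symbol\<close>, as \<open>symbol_normal_form\<close>
  confirms. It respects multiplication by a variable modulo \<open>decomposables\<close>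
  only.\<close>

definition normal_form :: "'a polynomial \<Rightarrow> 'a words"
  where "normal_form = lift (\<lambda>m. minus1_word (monomial_letters m))"

lemma normal_form_lin: "plin normal_form"
  by (simp add: normal_form_def lift_lin)

lemma normal_form_wd: "normal_form (wd m) = minus1_word (monomial_letters m)"
  by (simp add: normal_form_def)

lemmas normal_form_simps = pm2.linear_0[OF normal_form_lin] pm2.linear_diff[OF normal_form_lin]
  pm2.linear_scale[OF normal_form_lin]

lemma normal_form_symbol: "p - normal_form (symbol p) \<in> decomposables"
proof -
  have "wd w - normal_form (symbol (wd w)) \<in> decomposables" for w
  proof (cases "good w")
    case False
    then show ?thesis
      by (simp add: symbol_wd word_symbol_bad normal_form_simps decomposables_rel rel_bad)
  next
    case True
    show ?thesis
    proof (cases "\<forall>x\<in>set w. snd x = -1")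
      case False
      then show ?thesis
        using True by (auto simp: symbol_wd word_symbol_def normal_form_simps intro: decomposables_word)
    next
      case minus1: True
      have "w = map (\<lambda>u. (u, -1)) (map fst w)"
        using minus1 by (induction w) (auto simp: prod_eq_iff)
      then have "wd w = minus1_word (map fst w)" by (simp add: minus1_word_def)
      moreover have "minus1_word (map fst w) - minus1_word (monomial_letters (letters_monomial w)) \<in> decomposables"
      proof (rule minus1_word_perm)
        show "mset (map fst w) = mset (monomial_letters (letters_monomial w))"
          by (rule multiset_eqI) (simp only: count_monomial_letters count_letters_monomial)
        show "set (map fst w) \<subseteq> carrier L" using True by (auto simp: good_def)
      qed
      moreover have "normal_form (symbol (wd w)) = minus1_word (monomial_letters (letters_monomial w))"
        using True minus1 by (simp add: symbol_wd word_symbol_def normal_form_wd)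
      ultimately show ?thesis by (simp only:)
    qed
  qed
  moreover have "plin (\<lambda>p. p - normal_form (symbol p))"
    by (intro pm2.linear_compose_sub pm.linear_ident plin_comp[OF normal_form_lin symbol_lin])
  ultimately show ?thesis
    using plin_memI[OF _ decomposables_subspace, of "\<lambda>p. p - normal_form (symbol p)"] by blast
qed

lemma normal_form_mult_pvar:
  assumes "Poly_Mapping.keys m \<subseteq> carrier L" "x \<in> carrier L"
  shows "normal_form (wd m * pvar x) - loop_op x (-1) (normal_form (wd m)) \<in> decomposables"
proof -
  have "mset (monomial_letters (m + Poly_Mapping.single x 1)) = mset (x # monomial_letters m)"
    by (rule multiset_eqI) (simp add: count_monomial_letters lookup_add lookup_single when_def)
  then have "minus1_word (monomial_letters (m + Poly_Mapping.single x 1)) - minus1_word (x # monomial_letters m)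
      \<in> decomposables"
    using assms keys_add[of m "Poly_Mapping.single x (1::nat)"]
    by (intro minus1_word_perm) (auto simp: set_monomial_letters)
  then show ?thesis
    using assms by (simp add: pvar_eq_wd wd_mult normal_form_wd minus1_word_Cons set_monomial_letters)
qed

text \<open>As \<open>normal_form\<close> is not multiplicative, \<open>?J\<close> quantifies over
  all multiples, which builds in stability under multiplication. On the generators the claim reduces
  to linearity of \<open>loop_op\<close> in its label modulo \<open>rel\<close>.\<close>

lemma normal_form_ideal:
  assumes "q \<in> lin_ideal"
  shows "normal_form q \<in> decomposables"
proof -
  let ?J = "{p. \<forall>q\<in>lpolys. normal_form (q * p) \<in> decomposables}"
  have "lin_ideal \<subseteq> ?J"
  proof (rule lin_ideal_minimal)
    show "pm.subspace ?J"
      by (rule pm.subspaceI) (simp_all add: distrib_left mult_pm_scale normal_form_simps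
          pm2.linear_add[OF normal_form_lin] decomposables_closed)
    show "p * q \<in> ?J" if "p \<in> lpolys" "q \<in> ?J" for p q
      using that by (auto simp: polys_mult simp flip: mult.assoc)
  next
    fix x y assume xy: "x \<in> carrier L" "y \<in> carrier L"
    show "pvar (x \<oplus> y) - pvar x - pvar y \<in> ?J"
    proof (intro CollectI ballI)
      fix q assume q: "q \<in> lpolys"
      show "normal_form (q * (pvar (x \<oplus> y) - pvar x - pvar y)) \<in> decomposables"
      proof (rule plin_memI[OF plin_comp[OF normal_form_lin plin_mult(2)] decomposables_subspace])
        fix m assume "m \<in> Poly_Mapping.keys q"
        then have m: "Poly_Mapping.keys m \<subseteq> carrier L" using q by (auto simp: polys_iff)
        let ?d = "\<lambda>x. normal_form (wd m * pvar x) - loop_op x (-1) (normal_form (wd m))"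
        have "normal_form (wd m * (pvar (x \<oplus> y) - pvar x - pvar y)) = ?d (x \<oplus> y) - ?d x - ?d y
            + (loop_op (x \<oplus> y) (-1) (normal_form (wd m)) - loop_op x (-1) (normal_form (wd m))
              - loop_op y (-1) (normal_form (wd m)))"
          by (simp add: right_diff_distrib normal_form_simps)
        also have "\<dots> \<in> decomposables"
          using xy m by (intro decomposables_closed(1,2) normal_form_mult_pvar decomposables_rel
              loop_op_add_rel) auto
        finally show "normal_form (wd m * (pvar (x \<oplus> y) - pvar x - pvar y)) \<in> decomposables" .
      qed
    qed
  next
    fix c x assume x: "x \<in> carrier L"
    show "pvar (c \<odot> x) - c *c pvar x \<in> ?J"
    proof (intro CollectI ballI)
      fix q assume q: "q \<in> lpolys"
      show "normal_form (q * (pvar (c \<odot> x) - c *c pvar x)) \<in> decomposables"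
      proof (rule plin_memI[OF plin_comp[OF normal_form_lin plin_mult(2)] decomposables_subspace])
        fix m assume "m \<in> Poly_Mapping.keys q"
        then have m: "Poly_Mapping.keys m \<subseteq> carrier L" using q by (auto simp: polys_iff)
        let ?d = "\<lambda>x. normal_form (wd m * pvar x) - loop_op x (-1) (normal_form (wd m))"
        have "normal_form (wd m * (pvar (c \<odot> x) - c *c pvar x)) = ?d (c \<odot> x) - c *c ?d x
            + (loop_op (c \<odot> x) (-1) (normal_form (wd m)) - c *c loop_op x (-1) (normal_form (wd m)))"
          by (simp add: right_diff_distrib normal_form_simps mult_pm_scale pm.scale_right_diff_distrib)
        also have "\<dots> \<in> decomposables"
          using x m by (intro decomposables_closed(1,2,3) normal_form_mult_pvar decomposables_rel
              loop_op_smult_rel) auto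
        finally show "normal_form (wd m * (pvar (c \<odot> x) - c *c pvar x)) \<in> decomposables" .
      qed
    qed
  qed
  then have "normal_form (1 * q) \<in> decomposables"
    using assms polys_one by blast
  then show ?thesis by simp
qed

lemma symbol_kernel_decomposables:
  assumes "symbol p \<in> lin_ideal"
  shows "p \<in> decomposables"
  using decomposables_closed(1)[OF normal_form_symbol normal_form_ideal[OF assms], of p] by simp

text \<open>The vacuum field has only the mode -1, so i = 1 is the sole surviving term; its weight
  is -(k choose 1) = -k.\<close>

lemma Y_mode_vac:
  assumes "u \<in> carrier L" "k < 0"
  shows "va.Y (mode u k (wd [])) (-2) q = (- of_int k) *c mode u (k - 1) q"
proof -
  let ?X = "\<lambda>i. mode u (0 + k - int i) (va.one_field (-2 + int i) q)"
  have "va.Y (mode u k (wd [])) = pm.nth_product (mode u) k va.one_field"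
    using assms(1) by (simp add: va.Y_gen Y_word_Nil)
  moreover have "pm.half_jacobi va.one_field (mode u) k (-2) 0 q = 0"
    unfolding pm.half_jacobi_def va.one_field_def using assms(2) by simp
  moreover have "pm.half_jacobi (mode u) va.one_field k 0 (-2) q = (\<Sum>i<2. ((-1) ^ i * (of_int k gchoose i)) *c ?X i)"
    unfolding pm.half_jacobi_def
    by (rule pm.binsum_eq) (auto simp: va.one_field_def pm.vfield_simps(3)[OF mode_vfield])
  moreover have "\<dots> = (- of_int k) *c mode u (k - 1) q"
    using assms(1) by (simp add: numeral_2_eq_2 va.one_field_def mode_proj pm.vfield_simps(3)[OF mode_vfield])
  ultimately show ?thesis
    by (simp add: pm.nth_product_def pm.jacobi_lhs_def)
qed

lemma C2_vertex_record:
  "C2 va.vertex_record = {{v} | v. proj v = v \<and> symbol v \<in> lin_ideal}"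
proof
  let ?V = "va.vertex_record" and ?S = "{{v} | v. proj v = v \<and> symbol v \<in> lin_ideal}"
  show "C2 ?V \<subseteq> ?S"
    unfolding C2_def
  proof (rule hull_minimal)
    show "{nprod ?V a (-2) b | a b. a \<in> carrier ?V \<and> b \<in> carrier ?V} \<subseteq> ?S"
      by (auto simp: symbol_Y_minus2)
    have "\<ominus>\<^bsub>?V\<^esub> {v} = {- v}" if "proj v = v" for v
    proof -
      have "{- v} \<in> carrier ?V" "{v} \<in> carrier ?V"
        unfolding va.vertex_record_simps(1)
        by (intro va.in_range_P; simp add: that pm2.linear_neg[OF proj_lin])+
      then show ?thesis by (intro va.vr.minus_equality) auto
    qed
    then show "submodule ?S complex_ring ?V"
      by (intro va.vr.submoduleI)
        (auto simp: proj_simps symbol_simps lin_ideal_closed pm2.linear_neg[OF proj_lin] intro: va.in_range_P)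
  qed
  show "?S \<subseteq> C2 ?V"
  proof
    fix X assume "X \<in> ?S"
    then obtain v where v: "X = {v}" "proj v = v" "symbol v \<in> lin_ideal" by blast
    have "X \<in> H" if H: "submodule H complex_ring ?V"
      and gens: "{nprod ?V a (-2) b | a b. a \<in> carrier ?V \<and> b \<in> carrier ?V} \<subseteq> H" for H
    proof -
      note add = va.vr.submoduleE(5)[OF H] and smult = va.vr.submoduleE(4)[OF H]
      have "{proj p} \<in> carrier ?V" for p by simp
      then have gen: "nprod ?V {proj a} (-2) {proj b} \<in> H" for a b
        using gens by blast
      have zero: "{0} \<in> H"
        using gen[of 0 0] va.Y_scale[of 0 0 "-2" "proj 0"] by (simp add: proj_simps)
      have "decomposables \<subseteq> {p. {proj p} \<in> H}"
      proof (rule decomposables_minimal)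
        show "pm.subspace {p. {proj p} \<in> H}"
        proof (rule pm.subspaceI)
          show "x + y \<in> {p. {proj p} \<in> H}" if "x \<in> {p. {proj p} \<in> H}" "y \<in> {p. {proj p} \<in> H}" for x y
            using that add[of "{proj x}" "{proj y}"] by (simp add: proj_simps)
          show "c *c x \<in> {p. {proj p} \<in> H}" if "x \<in> {p. {proj p} \<in> H}" for c x
            using that smult[of c "{proj x}"] by (simp add: proj_simps)
        qed (simp add: zero proj_simps)
        show "p \<in> {p. {proj p} \<in> H}" if "p \<in> rel" for p
          using that zero by (simp add: proj_rel)
        fix u n p assume u: "u \<in> carrier L" "n \<le> (-2::int)"
        \<comment> \<open>Mode n of u is hit by the product -2 with the state of mode n + 1 on the
          vacuum. The factor -(n + 1) is nonzero, since n <= -2.\<close>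
        have *: "{(- of_int (n + 1)) *c mode u n p} \<in> H"
          using gen[of "mode u (n + 1) (wd [])" p] u Y_mode_vac[of u "n + 1" p] by simp
        have "complex_of_int (n + 1) \<noteq> 0" using u by (simp only: of_int_eq_0_iff)
        then have "{mode u n p} \<in> H"
          using smult[OF _ *, of "inverse (- of_int (n + 1))"] by (simp del: of_int_add)
        then show "loop_op u n p \<in> {p. {proj p} \<in> H}"
          by (simp add: mode_def)
      qed
      then show ?thesis
        using symbol_kernel_decomposables[OF v(3)] v by auto
    qed
    then show "X \<in> C2 ?V" by (auto simp: C2_def hull_def)
  qed
qed

end

section \<open>Poisson quotients\<close>

text \<open>Each axiom for \<open>Q\<close> is tested after the injective map \<open>h\<close>,
  where it becomes an axiom of \<open>A\<close>. Coset arithmetic is thereby avoided.\<close>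

lemma poisson_algebra_transport:
  assumes A: "poisson_algebra A" and inj: "inj_on h (carrier Q)" and img: "h ` carrier Q = carrier A"
    and mult: "\<And>x y. \<lbrakk>x \<in> carrier Q; y \<in> carrier Q\<rbrakk> \<Longrightarrow> x \<otimes>\<^bsub>Q\<^esub> y \<in> carrier Q \<and> h (x \<otimes>\<^bsub>Q\<^esub> y) = h x \<otimes>\<^bsub>A\<^esub> h y"
    and add: "\<And>x y. \<lbrakk>x \<in> carrier Q; y \<in> carrier Q\<rbrakk> \<Longrightarrow> x \<oplus>\<^bsub>Q\<^esub> y \<in> carrier Q \<and> h (x \<oplus>\<^bsub>Q\<^esub> y) = h x \<oplus>\<^bsub>A\<^esub> h y"
    and smult: "\<And>c x. x \<in> carrier Q \<Longrightarrow> c \<odot>\<^bsub>Q\<^esub> x \<in> carrier Q \<and> h (c \<odot>\<^bsub>Q\<^esub> x) = c \<odot>\<^bsub>A\<^esub> h x"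
    and brack: "\<And>x y. \<lbrakk>x \<in> carrier Q; y \<in> carrier Q\<rbrakk> \<Longrightarrow> \<lbrace>x, y\<rbrace>\<^bsub>Q\<^esub> \<in> carrier Q \<and> h \<lbrace>x, y\<rbrace>\<^bsub>Q\<^esub> = \<lbrace>h x, h y\<rbrace>\<^bsub>A\<^esub>"
    and one: "\<one>\<^bsub>Q\<^esub> \<in> carrier Q" "h \<one>\<^bsub>Q\<^esub> = \<one>\<^bsub>A\<^esub>"
    and zero: "\<zero>\<^bsub>Q\<^esub> \<in> carrier Q" "h \<zero>\<^bsub>Q\<^esub> = \<zero>\<^bsub>A\<^esub>"
  shows "poisson_algebra Q" "h \<in> poisson_iso Q A"
proof -
  interpret A: poisson_algebra A by fact
  have eqI: "x = y" if "h x = h y" "x \<in> carrier Q" "y \<in> carrier Q" for x y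
    using inj_onD[OF inj that] .
  have h: "h x \<in> carrier A" if "x \<in> carrier Q" for x using that img by blast
  have neg: "\<exists>y\<in>carrier Q. y \<oplus>\<^bsub>Q\<^esub> x = \<zero>\<^bsub>Q\<^esub>" if x: "x \<in> carrier Q" for x
  proof -
    have "\<ominus>\<^bsub>A\<^esub> h x \<in> h ` carrier Q" unfolding img using h[OF x] by simp
    then obtain y where y: "y \<in> carrier Q" "h y = \<ominus>\<^bsub>A\<^esub> h x" by auto
    then have "y \<oplus>\<^bsub>Q\<^esub> x = \<zero>\<^bsub>Q\<^esub>"
      using x h[OF x] by (intro eqI) (simp_all add: add zero A.l_neg)
    then show ?thesis using y by blast
  qed
  note ops = mult add smult brack one zero h
  have ab: "abelian_group Q"
    by (rule abelian_groupI) (auto intro!: eqI simp: ops neg A.a_ac A.l_zero)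
  have mon: "Group.comm_monoid Q"
    by (rule comm_monoidI) (auto intro!: eqI simp: ops A.m_ac)
  have cr: "cring Q"
    by (rule cringI[OF ab mon]) (auto intro!: eqI simp: ops A.l_distr)
  have mod: "module complex_ring Q"
    by (rule moduleI[OF cring_complex_ring ab])
      (auto intro!: eqI simp: ops A.smult_r_distr A.smult_l_distr[simplified] A.smult_assoc1[simplified] A.smult_one[simplified])
  show "poisson_algebra Q"
  proof (intro poisson_algebra.intro lie_algebra.intro lie_algebra_axioms.intro algebra.intro
      algebra_axioms.intro poisson_algebra_axioms.intro mod cr cring_complex_ring)
  qed (auto intro!: eqI simp: ops A.bracket_add_left A.bracket_add_right A.bracket_smult_left
      A.bracket_smult_right A.bracket_alternating A.bracket_Jacobi A.bracket_Leibniz A.smult_assoc2)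
  show "h \<in> poisson_iso Q A"
    using ops inj img by (auto simp: poisson_iso_def ring_iso_def ring_hom_def bij_betw_def)
qed

lemma poisson_isomorphic_trans_sym:
  assumes "poisson_algebra Q" "poisson_algebra Q'" "h \<in> poisson_iso Q A" "h' \<in> poisson_iso Q' A"
  shows "poisson_isomorphic Q Q'"
proof -
  interpret Q: poisson_algebra Q by fact
  interpret Q': poisson_algebra Q' by fact
  define g where "g = inv_into (carrier Q') h'"
  have h: "h \<in> ring_iso Q A" and h': "h' \<in> ring_iso Q' A"
    using assms(3,4) by (auto simp: poisson_iso_def)
  have g: "g \<in> ring_iso A Q'"
    unfolding g_def by (rule ring_iso_set_sym[OF Q'.ring_axioms h'])
  have bij: "bij_betw h' (carrier Q') (carrier A)" using h' by (simp add: ring_iso_def)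
  have g_eq: "g x = y" if "y \<in> carrier Q'" "h' y = x" for x y
    unfolding g_def using that bij by (auto simp: bij_betw_def)
  have hc: "h x \<in> carrier A" if "x \<in> carrier Q" for x
    using h that by (auto simp: ring_iso_def ring_hom_def)
  have gc: "g x \<in> carrier Q'" "h' (g x) = x" if "x \<in> carrier A" for x
    using that bij by (auto simp: g_def bij_betw_def inv_into_into f_inv_into_f)
  have "g \<circ> h \<in> poisson_iso Q Q'"
    unfolding poisson_iso_def
  proof (intro CollectI conjI ballI allI)
    show "g \<circ> h \<in> ring_iso Q Q'" by (rule ring_iso_set_trans[OF h g])
    show "(g \<circ> h) (c \<odot>\<^bsub>Q\<^esub> x) = c \<odot>\<^bsub>Q'\<^esub> (g \<circ> h) x" if "x \<in> carrier Q" for c x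
      using that assms(3,4) gc[OF hc[OF that]]
      by (auto simp: poisson_iso_def intro!: g_eq)
    show "(g \<circ> h) \<lbrace>x, y\<rbrace>\<^bsub>Q\<^esub> = \<lbrace>(g \<circ> h) x, (g \<circ> h) y\<rbrace>\<^bsub>Q'\<^esub>" if "x \<in> carrier Q" "y \<in> carrier Q" for x y
      using that assms(3,4) gc[OF hc[OF that(1)]] gc[OF hc[OF that(2)]]
      by (auto simp: poisson_iso_def intro!: g_eq)
  qed
  then show ?thesis using assms(1,2) by (auto simp: poisson_isomorphic_def)
qed

text \<open>The first isomorphism theorem for the union-style coset operations: the cosets of the
  kernel are the fibres \<open>F t\<close> of f, and on fibres all operations are those of
  \<open>A\<close>.\<close>

lemma poisson_quotient_iso:
  fixes M (structure)
  assumes M: "module complex_ring M" and A: "poisson_algebra A"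
    and img: "f ` carrier M = carrier A" and ker: "N = {x \<in> carrier M. f x = \<zero>\<^bsub>A\<^esub>}"
    and e: "e \<in> carrier M" "f e = \<one>\<^bsub>A\<^esub>"
    and add: "\<And>x y. \<lbrakk>x \<in> carrier M; y \<in> carrier M\<rbrakk> \<Longrightarrow> f (x \<oplus> y) = f x \<oplus>\<^bsub>A\<^esub> f y"
    and smult: "\<And>c x. x \<in> carrier M \<Longrightarrow> f (c \<odot> x) = c \<odot>\<^bsub>A\<^esub> f x"
    and m: "\<And>x y. \<lbrakk>x \<in> carrier M; y \<in> carrier M\<rbrakk> \<Longrightarrow> m x y \<in> carrier M \<and> f (m x y) = f x \<otimes>\<^bsub>A\<^esub> f y"
    and b: "\<And>x y. \<lbrakk>x \<in> carrier M; y \<in> carrier M\<rbrakk> \<Longrightarrow> b x y \<in> carrier M \<and> f (b x y) = \<lbrace>f x, f y\<rbrace>\<^bsub>A\<^esub>"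
  shows "\<exists>h. poisson_algebra (poisson_quotient M N e m b) \<and> h \<in> poisson_iso (poisson_quotient M N e m b) A"
proof -
  interpret M: module complex_ring M by fact
  interpret A: poisson_algebra A by fact
  let ?Q = "poisson_quotient M N e m b"
  define F where "F t = {x \<in> carrier M. f x = t}" for t
  have f: "f x \<in> carrier A" if "x \<in> carrier M" for x using that img by blast
  have f_diff: "x \<ominus> y \<in> carrier M \<and> f (x \<ominus> y) \<oplus>\<^bsub>A\<^esub> f y = f x" if "x \<in> carrier M" "y \<in> carrier M" for x y
    using that by (simp add: M.minus_eq M.a_assoc M.l_neg flip: add)
  have f_diff': "f (x \<ominus> y) = \<zero>\<^bsub>A\<^esub>" if "x \<in> carrier M" "y \<in> carrier M" "f x = f y" for x y
    using f_diff[OF that(1,2)] that f A.add.r_cancel_one[of "f y" "f (x \<ominus> y)"] by auto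
  have zero: "f \<zero> = \<zero>\<^bsub>A\<^esub>"
    using add[of \<zero> \<zero>] f[of \<zero>] A.add.r_cancel_one[of "f \<zero>" "f \<zero>"] by auto
  have coset: "N +>\<^bsub>M\<^esub> x = F (f x)" if x: "x \<in> carrier M" for x
  proof
    show "N +>\<^bsub>M\<^esub> x \<subseteq> F (f x)"
      using x f by (auto simp: a_r_coset_def' ker F_def add)
    show "F (f x) \<subseteq> N +>\<^bsub>M\<^esub> x"
    proof
      fix y assume "y \<in> F (f x)"
      then have y: "y \<in> carrier M" "f y = f x" by (auto simp: F_def)
      then have "y \<ominus> x \<in> N" using x f_diff f_diff' by (simp add: ker)
      moreover have "(y \<ominus> x) \<oplus> x = y" using x y by (simp add: M.minus_eq M.a_assoc M.l_neg)
      ultimately show "y \<in> N +>\<^bsub>M\<^esub> x" by (force simp: a_r_coset_def')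
    qed
  qed
  have ne: "\<exists>x\<in>carrier M. f x = t" if "t \<in> carrier A" for t using that unfolding img[symmetric] by auto
  have carrier: "carrier ?Q = F ` carrier A"
  proof -
    have "carrier ?Q = (\<lambda>x. N +>\<^bsub>M\<^esub> x) ` carrier M"
      by (auto simp: poisson_quotient_def A_RCOSETS_def')
    also have "\<dots> = (\<lambda>x. F (f x)) ` carrier M"
      by (intro image_cong coset refl)
    finally show ?thesis unfolding img[symmetric] by (simp add: image_image)
  qed
  have op: "coset_op M N g (F s) (F t) = F (g' s t)"
    if s: "s \<in> carrier A" and t: "t \<in> carrier A"
      and g: "\<And>x y. \<lbrakk>x \<in> carrier M; y \<in> carrier M\<rbrakk> \<Longrightarrow> g x y \<in> carrier M \<and> f (g x y) = g' (f x) (f y)" for g g' s t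
  proof -
    have "N +>\<^bsub>M\<^esub> g x y = F (g' s t)" if "x \<in> F s" "y \<in> F t" for x y
      using that g by (simp add: F_def coset)
    moreover have "F s \<noteq> {}" "F t \<noteq> {}" using s t ne by (auto simp: F_def)
    ultimately show ?thesis by (simp add: coset_op_def)
  qed
  have Q_mult: "F s \<otimes>\<^bsub>?Q\<^esub> F t = F (s \<otimes>\<^bsub>A\<^esub> t)" if "s \<in> carrier A" "t \<in> carrier A" for s t
    using op[OF that, of m "(\<otimes>\<^bsub>A\<^esub>)"] m by (simp add: poisson_quotient_def)
  have Q_bracket: "\<lbrace>F s, F t\<rbrace>\<^bsub>?Q\<^esub> = F \<lbrace>s, t\<rbrace>\<^bsub>A\<^esub>" if "s \<in> carrier A" "t \<in> carrier A" for s t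
    using op[OF that, of b "lie_bracket A"] b by (simp add: poisson_quotient_def)
  have Q_add: "F s \<oplus>\<^bsub>?Q\<^esub> F t = F (s \<oplus>\<^bsub>A\<^esub> t)" if s: "s \<in> carrier A" and t: "t \<in> carrier A" for s t
  proof
    show "F s \<oplus>\<^bsub>?Q\<^esub> F t \<subseteq> F (s \<oplus>\<^bsub>A\<^esub> t)"
      by (auto simp: poisson_quotient_def set_add_def' F_def add)
    \<comment> \<open>Addition of cosets is elementwise and not a union of cosets, so the reverse
      inclusion needs an explicit splitting of z as x plus z minus x.\<close>
    obtain x where x: "x \<in> carrier M" "f x = s" using ne[OF s] by blast
    show "F (s \<oplus>\<^bsub>A\<^esub> t) \<subseteq> F s \<oplus>\<^bsub>?Q\<^esub> F t"
    proof
      fix z assume "z \<in> F (s \<oplus>\<^bsub>A\<^esub> t)"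
      then have z: "z \<in> carrier M" "f z = s \<oplus>\<^bsub>A\<^esub> t" by (auto simp: F_def)
      have "f (z \<ominus> x) \<oplus>\<^bsub>A\<^esub> s = t \<oplus>\<^bsub>A\<^esub> s"
        using f_diff[OF z(1) x(1)] z x s t by (simp add: A.a_comm)
      then have "f (z \<ominus> x) = t"
        using f_diff[OF z(1) x(1)] f s t by (simp add: A.add.right_cancel)
      then have "z \<ominus> x \<in> F t" "x \<in> F s" using x z by (auto simp: F_def)
      moreover have "x \<oplus> (z \<ominus> x) = z"
        using x z by (simp add: M.minus_eq M.a_comm[of z] M.r_neg2)
      ultimately show "z \<in> F s \<oplus>\<^bsub>?Q\<^esub> F t"
        by (force simp: poisson_quotient_def set_add_def')
    qed
  qed
  have Q_smult: "c \<odot>\<^bsub>?Q\<^esub> F t = F (c \<odot>\<^bsub>A\<^esub> t)" if t: "t \<in> carrier A" for c t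
  proof -
    have "N +>\<^bsub>M\<^esub> (c \<odot> x) = F (c \<odot>\<^bsub>A\<^esub> t)" if "x \<in> F t" for x
      using that by (simp add: F_def coset smult)
    moreover have "F t \<noteq> {}" using t ne by (auto simp: F_def)
    ultimately show ?thesis by (simp add: poisson_quotient_def)
  qed
  have Q_one: "\<one>\<^bsub>?Q\<^esub> = F \<one>\<^bsub>A\<^esub>" using coset[OF e(1)] e(2) by (simp add: poisson_quotient_def)
  have Q_zero: "\<zero>\<^bsub>?Q\<^esub> = F \<zero>\<^bsub>A\<^esub>" by (simp add: poisson_quotient_def ker F_def)
  define h where "h X = the_elem (f ` X)" for X
  have hF: "h (F t) = t" if "t \<in> carrier A" for t
  proof -
    have "f ` F t = {t}" using ne[OF that] by (auto simp: F_def)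
    then show ?thesis by (simp add: h_def)
  qed
  have "inj_on h (carrier ?Q)" unfolding carrier by (rule inj_onI) (auto simp: hF)
  moreover have "h ` carrier ?Q = carrier A" unfolding carrier using hF by force
  ultimately have "poisson_algebra ?Q" "h \<in> poisson_iso ?Q A"
    by (rule poisson_algebra_transport[OF A];
        auto simp: carrier hF Q_mult Q_bracket Q_add Q_smult Q_one Q_zero)+
  then show ?thesis by blast
qed

context lie_algebra begin

section \<open>The symmetric algebra\<close>

lemma word_symbol_minus1_word:
  "set us \<subseteq> carrier L \<Longrightarrow> symbol (minus1_word us) = wd (\<Sum>u\<leftarrow>us. Poly_Mapping.single u 1)"
proof (induction us)
  case (Cons u us)
  then show ?case
    by (simp add: minus1_word_Cons symbol_loop_op_neg pvar_eq_wd wd_mult)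
qed (simp add: minus1_word_def symbol_wd)

text \<open>It makes \<open>symbol\<close> onto \<open>lpolys\<close>, so that identities of the
  vertex algebra transfer to arbitrary polynomials.\<close>

lemma symbol_normal_form:
  assumes "p \<in> lpolys"
  shows "symbol (normal_form p) = p"
proof -
  have "symbol (normal_form (wd m)) = wd m" if "Poly_Mapping.keys m \<subseteq> carrier L" for m
  proof -
    have "(\<Sum>u\<leftarrow>monomial_letters m. Poly_Mapping.single u (1::nat)) = m"
    proof (rule poly_mapping_eqI)
      fix u
      show "Poly_Mapping.lookup (\<Sum>u\<leftarrow>monomial_letters m. Poly_Mapping.single u (1::nat)) u = Poly_Mapping.lookup m u"
        \<comment> \<open>The exponents 0 are dummies: \<open>letters_monomial\<close> looks at the
          labels only.\<close>
        using count_letters_monomial[of "map (\<lambda>u. (u, 0)) (monomial_letters m)" u]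
          count_monomial_letters[of m u]
        by (simp add: letters_monomial_def comp_def)
    qed
    then show ?thesis
      using that by (simp add: normal_form_wd word_symbol_minus1_word set_monomial_letters)
  qed
  moreover have lin: "plin (\<lambda>p. symbol (normal_form p) - p)"
    by (intro pm2.linear_compose_sub pm.linear_ident plin_comp[OF symbol_lin normal_form_lin])
  ultimately have "symbol (normal_form p) - p \<in> {0}"
    using assms by (intro plin_memI[OF lin pm.subspace_single_0, of p]) (auto simp: polys_iff)
  then show ?thesis by simp
qed

text \<open>
  On \<open>P\<^sub>2\<close> the Jacobi identity is the commutator formula \<open>a\<^sub>0 b\<^sub>0 c - b\<^sub>0 a\<^sub>0 c = (a\<^sub>0 b)\<^sub>0 c\<close>, and the symbol map
  carries it over to polynomials.
\<close>

lemma poly_bracket_derivation: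
  assumes p: "p \<in> lpolys" and q: "q \<in> lpolys" and r: "r \<in> lpolys"
  shows "poly_bracket L p (poly_bracket L q r) - poly_bracket L q (poly_bracket L p r)
    - poly_bracket L (poly_bracket L p q) r \<in> lin_ideal"
proof -
  define a b c where "a = normal_form p" and "b = normal_form q" and "c = normal_form r"
  have s: "symbol a = p" "symbol b = q" "symbol c = r"
    by (simp_all add: a_def b_def c_def symbol_normal_form p q r)
  let ?B = "poly_bracket L" and ?Y = "\<lambda>a. va.Y a 0"
  have nest: "?B (symbol x) (?B (symbol y) (symbol z)) - symbol (?Y x (?Y y z)) \<in> lin_ideal" for x y z
  proof -
    have "- ?B (symbol x) (symbol (?Y y z) - ?B (symbol y) (symbol z))
        - (symbol (?Y x (?Y y z)) - ?B (symbol x) (symbol (?Y y z))) \<in> lin_ideal"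
      by (intro lin_ideal_closed(2,4) poly_bracket_ideal_right symbol_Y_0 symbol_polys)
    then show ?thesis by (simp add: poly_bracket_simps)
  qed
  have outer: "?B (?B p q) r - symbol (?Y (?Y a b) c) \<in> lin_ideal"
  proof -
    have ab: "symbol (?Y a b) - ?B p q \<in> lin_ideal" using symbol_Y_0[of a b] by (simp add: s)
    have abc: "symbol (?Y (?Y a b) c) - ?B (symbol (?Y a b)) r \<in> lin_ideal"
      using symbol_Y_0[of "?Y a b" c] by (simp add: s)
    have "?B (symbol (?Y a b)) r - ?B (?B p q) r \<in> lin_ideal"
      using poly_bracket_ideal_left[OF ab r] by (simp add: poly_bracket_simps)
    from lin_ideal_closed(4)[OF lin_ideal_closed(1)[OF this abc]] show ?thesis by simp
  qed
  \<comment> \<open>The Jacobi identity at l = m = n = 0, where \<open>binsum 0\<close> keeps just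
    the term i = 0.\<close>
  have "?Y a (?Y b c) - ?Y b (?Y a c) = ?Y (?Y a b) c"
    using va.Y_jacobi[of a b 0 0 0 c] by (simp add: pm.jacobi_lhs_0)
  then have comm: "symbol (?Y a (?Y b c)) - symbol (?Y b (?Y a c)) = symbol (?Y (?Y a b) c)"
    by (simp flip: symbol_simps(4))
  have "(?B p (?B q r) - symbol (?Y a (?Y b c))) - (?B q (?B p r) - symbol (?Y b (?Y a c)))
      - (?B (?B p q) r - symbol (?Y (?Y a b) c)) \<in> lin_ideal"
    using lin_ideal_closed(2)[OF lin_ideal_closed(2)[OF nest[of a b c] nest[of b a c]]] outer by (simp add: s)
  then show ?thesis
    unfolding comm[symmetric] by (simp add: algebra_simps)
qed

section \<open>Projection along the linearity ideal and the resulting model\<close>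

definition poly_proj :: "'a polynomial \<Rightarrow> 'a polynomial"
  where "poly_proj = (SOME f. plin f \<and> (\<forall>x\<in>lin_ideal. f x = 0) \<and> (\<forall>x. x - f x \<in> lin_ideal))"

lemma poly_proj: "plin poly_proj \<and> (\<forall>x\<in>lin_ideal. poly_proj x = 0) \<and> (\<forall>x. x - poly_proj x \<in> lin_ideal)"
proof -
  obtain f where "plin f" "\<And>x. x \<in> lin_ideal \<Longrightarrow> f x = 0" "\<And>x. x - f x \<in> lin_ideal"
    using pm_projection[OF lin_ideal_subspace] by blast
  then have "\<exists>f. plin f \<and> (\<forall>x\<in>lin_ideal. f x = 0) \<and> (\<forall>x. x - f x \<in> lin_ideal)" by blast
  then show ?thesis unfolding poly_proj_def by (rule someI_ex)
qed

lemma poly_proj_lin: "plin poly_proj" and poly_proj_diff: "x - poly_proj x \<in> lin_ideal"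
  using poly_proj by blast+

lemmas poly_proj_simps = pm2.linear_add[OF poly_proj_lin] pm2.linear_scale[OF poly_proj_lin]
  pm2.linear_0[OF poly_proj_lin] pm2.linear_diff[OF poly_proj_lin]

lemma poly_proj_eq_0: "poly_proj x = 0 \<longleftrightarrow> x \<in> lin_ideal"
proof
  assume "poly_proj x = 0"
  then show "x \<in> lin_ideal" using poly_proj_diff[of x] by simp
qed (use poly_proj in blast)

lemma poly_proj_eqI: "x - y \<in> lin_ideal \<Longrightarrow> poly_proj x = poly_proj y"
  using poly_proj_eq_0[of "x - y"] by (simp add: poly_proj_simps)

lemma poly_proj_diff': "poly_proj x - x \<in> lin_ideal"
  using lin_ideal_closed(4)[OF poly_proj_diff[of x]] by simp

lemma poly_proj_idem: "poly_proj (poly_proj x) = poly_proj x"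
  by (rule poly_proj_eqI[OF poly_proj_diff'])

lemma poly_proj_polys:
  assumes "p \<in> lpolys"
  shows "poly_proj p \<in> lpolys"
  using polys_closed(1)[OF lin_ideal_polys[OF poly_proj_diff'[of p]] assms] by simp

lemma poly_proj_mult:
  assumes "p \<in> lpolys" "q \<in> lpolys"
  shows "poly_proj (poly_proj p * q) = poly_proj (p * q)" "poly_proj (p * poly_proj q) = poly_proj (p * q)"
proof -
  have *: "poly_proj (p * poly_proj q) = poly_proj (p * q)" if "p \<in> lpolys" for p q
    using lin_ideal_mult[OF that poly_proj_diff'[of q]]
    by (intro poly_proj_eqI) (simp add: algebra_simps)
  show "poly_proj (p * poly_proj q) = poly_proj (p * q)" by (rule *[OF assms(1)])
  show "poly_proj (poly_proj p * q) = poly_proj (p * q)" using *[OF assms(2), of p] by (simp add: mult.commute)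
qed

lemma poly_proj_bracket:
  assumes "p \<in> lpolys" "q \<in> lpolys"
  shows "poly_proj (poly_bracket L (poly_proj p) q) = poly_proj (poly_bracket L p q)"
    "poly_proj (poly_bracket L p (poly_proj q)) = poly_proj (poly_bracket L p q)"
  using poly_bracket_ideal_left[OF poly_proj_diff'[of p] assms(2)]
    poly_bracket_ideal_right[OF assms(1) poly_proj_diff'[of q]]
  by (auto intro!: poly_proj_eqI simp: poly_bracket_simps)

text \<open>
  A model of \<open>S(L)\<close> on representatives, so that its axioms are congruences modulo the linearity ideal
  rather than statements about cosets.
\<close>

definition sym_model :: "'a polynomial lie"
  where "sym_model = \<lparr>carrier = poly_proj ` lpolys, monoid.mult = (\<lambda>p q. poly_proj (p * q)), one = poly_proj 1,
    zero = 0, add = (+), smult = (*c), lie_bracket = (\<lambda>p q. poly_proj (poly_bracket L p q))\<rparr>"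

lemma sym_model_simps [simp]:
  "carrier sym_model = poly_proj ` lpolys" "p \<otimes>\<^bsub>sym_model\<^esub> q = poly_proj (p * q)"
  "\<one>\<^bsub>sym_model\<^esub> = poly_proj 1" "\<zero>\<^bsub>sym_model\<^esub> = 0" "p \<oplus>\<^bsub>sym_model\<^esub> q = p + q"
  "c \<odot>\<^bsub>sym_model\<^esub> p = c *c p" "\<lbrace>p, q\<rbrace>\<^bsub>sym_model\<^esub> = poly_proj (poly_bracket L p q)"
  by (simp_all add: sym_model_def)

text \<open>Skew-symmetry gives twice the bracket, and 2 is invertible.\<close>

lemma poly_bracket_alternating: "p \<in> lpolys \<Longrightarrow> poly_bracket L p p \<in> lin_ideal"
proof -
  assume p: "p \<in> lpolys"
  have "(1 / 2) *c (x + x) = x" for x :: "'a polynomial"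
    unfolding pm.scale_right_distrib pm.scale_left_distrib[symmetric] by simp
  then show ?thesis
    using lin_ideal_closed(3)[OF poly_bracket_skew[OF p p], of "1 / 2"] by simp
qed

text \<open>The cyclic form differs from \<open>poly_bracket_derivation\<close> by two antisymmetry
  corrections, each lying in the ideal.\<close>

lemma poly_bracket_Jacobi:
  assumes p: "p \<in> lpolys" and q: "q \<in> lpolys" and r: "r \<in> lpolys"
  shows "poly_bracket L p (poly_bracket L q r) + poly_bracket L q (poly_bracket L r p)
    + poly_bracket L r (poly_bracket L p q) \<in> lin_ideal"
proof -
  let ?B = "poly_bracket L"
  have "(?B p (?B q r) - ?B q (?B p r) - ?B (?B p q) r) + ?B q (?B p r + ?B r p)
      + (?B (?B p q) r + ?B r (?B p q)) \<in> lin_ideal"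
    using assms by (intro lin_ideal_closed(1) poly_bracket_derivation poly_bracket_ideal_right
        poly_bracket_skew poly_bracket_lpolys)
  then show ?thesis by (simp add: poly_bracket_simps algebra_simps)
qed

lemma poisson_algebra_sym_model: "poisson_algebra sym_model"
proof -
  note closed = polys_closed polys_mult polys_one poly_proj_polys poly_bracket_lpolys
  have carrierI: "poly_proj p = p \<Longrightarrow> p \<in> lpolys \<Longrightarrow> p \<in> poly_proj ` lpolys" for p
    by (rule image_eqI[of _ _ p]) simp_all
  have ab: "abelian_group sym_model"
  proof (rule abelian_groupI)
    show "\<exists>q\<in>carrier sym_model. q \<oplus>\<^bsub>sym_model\<^esub> p = \<zero>\<^bsub>sym_model\<^esub>" if "p \<in> carrier sym_model" for p
      using that by (intro bexI[of _ "- p"])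
        (auto intro!: carrierI simp: closed poly_proj_idem pm2.linear_neg[OF poly_proj_lin])
  qed (auto intro!: carrierI simp: closed poly_proj_simps poly_proj_idem algebra_simps)
  have mon: "Group.comm_monoid sym_model"
  proof (rule comm_monoidI)
    fix x assume "x \<in> carrier sym_model"
    then have x: "x \<in> lpolys" "poly_proj x = x" by (auto simp: closed poly_proj_idem)
    show "\<one>\<^bsub>sym_model\<^esub> \<otimes>\<^bsub>sym_model\<^esub> x = x"
      using x by (simp add: poly_proj_mult closed)
    fix y assume "y \<in> carrier sym_model"
    then have y: "y \<in> lpolys" by (auto simp: closed)
    show "x \<otimes>\<^bsub>sym_model\<^esub> y \<in> carrier sym_model" using x y by (simp add: closed)
    show "x \<otimes>\<^bsub>sym_model\<^esub> y = y \<otimes>\<^bsub>sym_model\<^esub> x" by (simp add: mult.commute)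
    fix z assume "z \<in> carrier sym_model"
    then have z: "z \<in> lpolys" by (auto simp: closed)
    show "x \<otimes>\<^bsub>sym_model\<^esub> y \<otimes>\<^bsub>sym_model\<^esub> z = x \<otimes>\<^bsub>sym_model\<^esub> (y \<otimes>\<^bsub>sym_model\<^esub> z)"
      using x y z by (simp add: poly_proj_mult closed mult.assoc)
  qed (simp add: closed)
  have cr: "cring sym_model"
    by (rule cringI[OF ab mon]) (auto simp: poly_proj_simps algebra_simps)
  have mod: "module complex_ring sym_model"
    by (rule moduleI[OF cring_complex_ring ab])
      (auto intro!: carrierI simp: closed poly_proj_simps poly_proj_idem algebra_simps)
  show ?thesis
  proof (intro poisson_algebra.intro lie_algebra.intro lie_algebra_axioms.intro algebra.intro
      algebra_axioms.intro poisson_algebra_axioms.intro mod cr cring_complex_ring)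
    fix x assume "x \<in> carrier sym_model"
    then have x: "x \<in> lpolys" by (auto simp: closed)
    show "\<lbrace>x, x\<rbrace>\<^bsub>sym_model\<^esub> = \<zero>\<^bsub>sym_model\<^esub>"
      using poly_bracket_alternating[OF x] by (simp add: poly_proj_eq_0)
    fix y assume "y \<in> carrier sym_model"
    then have y: "y \<in> lpolys" by (auto simp: closed)
    fix z assume "z \<in> carrier sym_model"
    then have z: "z \<in> lpolys" by (auto simp: closed)
    show "\<lbrace>x, \<lbrace>y, z\<rbrace>\<^bsub>sym_model\<^esub>\<rbrace>\<^bsub>sym_model\<^esub> \<oplus>\<^bsub>sym_model\<^esub> \<lbrace>y, \<lbrace>z, x\<rbrace>\<^bsub>sym_model\<^esub>\<rbrace>\<^bsub>sym_model\<^esub>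
        \<oplus>\<^bsub>sym_model\<^esub> \<lbrace>z, \<lbrace>x, y\<rbrace>\<^bsub>sym_model\<^esub>\<rbrace>\<^bsub>sym_model\<^esub> = \<zero>\<^bsub>sym_model\<^esub>"
      using poly_bracket_Jacobi[OF x y z] x y z
      by (simp add: poly_proj_bracket closed poly_proj_eq_0 flip: poly_proj_simps(1))
    show "\<lbrace>x, y \<otimes>\<^bsub>sym_model\<^esub> z\<rbrace>\<^bsub>sym_model\<^esub>
        = \<lbrace>x, y\<rbrace>\<^bsub>sym_model\<^esub> \<otimes>\<^bsub>sym_model\<^esub> z \<oplus>\<^bsub>sym_model\<^esub> \<lbrace>x, z\<rbrace>\<^bsub>sym_model\<^esub> \<otimes>\<^bsub>sym_model\<^esub> y"
      using x y z by (simp add: poly_proj_bracket poly_proj_mult closed poly_bracket_mult_right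
          poly_proj_simps algebra_simps)
  qed (auto simp: poly_bracket_simps poly_proj_simps poly_proj_mult mult_pm_scale closed)
qed

lemma symmetric_algebra_iso_model:
  "\<exists>h. poisson_algebra (symmetric_algebra L) \<and> h \<in> poisson_iso (symmetric_algebra L) sym_model"
  unfolding symmetric_algebra_def
proof (rule poisson_quotient_iso[where f = poly_proj])
  show "module complex_ring (poly_algebra (carrier L))"
    using algebra_poly_algebra by (rule algebra.axioms)
  show "lin_ideal = {x \<in> carrier (poly_algebra (carrier L)). poly_proj x = \<zero>\<^bsub>sym_model\<^esub>}"
    by (auto simp: poly_proj_eq_0 lin_ideal_polys)
qed (auto simp: poisson_algebra_sym_model polys_one polys_mult poly_proj_simps poly_proj_mult
    poly_proj_bracket poly_bracket_lpolys poly_proj_polys)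

lemma P2_iso_model:
  "\<exists>h. poisson_algebra (P2 va.vertex_record) \<and> h \<in> poisson_iso (P2 va.vertex_record) sym_model"
  unfolding P2_def
proof (rule poisson_quotient_iso[where f = "\<lambda>X. poly_proj (symbol (the_elem X))"])
  let ?V = "va.vertex_record"
  show "module complex_ring ?V" by (rule va.module_vertex_record)
  show "poisson_algebra sym_model" by (rule poisson_algebra_sym_model)
  have sp: "poly_proj (symbol (proj p)) = poly_proj (symbol p)" for p
    by (rule poly_proj_eqI[OF symbol_proj])
  \<comment> \<open>Surjectivity: \<open>normal_form p\<close> is a preimage of \<open>p\<close>
    under \<open>symbol\<close>, and projecting it changes the symbol by an element of the ideal
    only.\<close>
  have "poly_proj p \<in> (\<lambda>X. poly_proj (symbol (the_elem X))) ` carrier ?V" if "p \<in> lpolys" for p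
    using that by (intro image_eqI[of _ _ "{proj (normal_form p)}"]) (auto simp: sp symbol_normal_form)
  then show "(\<lambda>X. poly_proj (symbol (the_elem X))) ` carrier ?V = carrier sym_model"
    by (auto simp: symbol_polys)
  show "C2 ?V = {X \<in> carrier ?V. poly_proj (symbol (the_elem X)) = \<zero>\<^bsub>sym_model\<^esub>}"
    unfolding C2_vertex_record by (auto simp: poly_proj_eq_0 proj_idem intro: va.in_range_P)
  show "vacuum ?V \<in> carrier ?V" by (auto simp: proj_idem)
  show "poly_proj (symbol (the_elem (vacuum ?V))) = \<one>\<^bsub>sym_model\<^esub>"
    by (simp add: sp symbol_wd)
  fix X Z assume "X \<in> carrier ?V" "Z \<in> carrier ?V"
  then obtain v w where X: "X = {v}" "proj v = v" and Z: "Z = {w}" "proj w = w"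
    by (metis va.vertex_record_carrier)
  show "poly_proj (symbol (the_elem (X \<oplus>\<^bsub>?V\<^esub> Z)))
      = poly_proj (symbol (the_elem X)) \<oplus>\<^bsub>sym_model\<^esub> poly_proj (symbol (the_elem Z))"
    by (simp add: X Z symbol_simps poly_proj_simps)
  show "poly_proj (symbol (the_elem (c \<odot>\<^bsub>?V\<^esub> X))) = c \<odot>\<^bsub>sym_model\<^esub> poly_proj (symbol (the_elem X))" for c
    by (simp add: X symbol_simps poly_proj_simps)
  have in_V: "{va.Y v n w} \<in> carrier ?V" for n
    using va.in_range_P[OF va.Y_P(1)] by simp
  show "nprod ?V X (- 1) Z \<in> carrier ?V \<and> poly_proj (symbol (the_elem (nprod ?V X (- 1) Z)))
      = poly_proj (symbol (the_elem X)) \<otimes>\<^bsub>sym_model\<^esub> poly_proj (symbol (the_elem Z))"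
    using in_V poly_proj_eqI[OF symbol_Y_minus1[of v w]]
    by (simp add: X Z poly_proj_mult symbol_polys poly_proj_polys del: va.vertex_record_simps(1))
  show "nprod ?V X 0 Z \<in> carrier ?V \<and> poly_proj (symbol (the_elem (nprod ?V X 0 Z)))
      = \<lbrace>poly_proj (symbol (the_elem X)), poly_proj (symbol (the_elem Z))\<rbrace>\<^bsub>sym_model\<^esub>"
    using in_V poly_proj_eqI[OF symbol_Y_0[of v w]]
    by (simp add: X Z poly_proj_bracket symbol_polys poly_proj_polys del: va.vertex_record_simps(1))
qed

lemma P2_isomorphic_symmetric_algebra:
  "poisson_isomorphic (P2 va.vertex_record) (symmetric_algebra L)"
  using P2_iso_model symmetric_algebra_iso_model poisson_isomorphic_trans_sym by blast

end

theorem corollary5p15: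
  fixes \<gg> :: "'g lie"
  assumes "lie_algebra \<gg>"
  shows "\<exists>V :: 'g vertex_universe vertex.
    vertex_algebra V \<and> poisson_isomorphic (P2 V) (symmetric_algebra \<gg>)"
proof -
  interpret lie_algebra \<gg> by fact
  show ?thesis
    using va.vertex_algebra_vertex_record P2_isomorphic_symmetric_algebra by blast
qed

end
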